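(* Let $\varepsilon_0>0$ and let $(X^s)_{s\in\mathbb R}$ be a Banach scale. Let $T>0$, $s_0\in\mathbb R$, $m\ge 0$, $d_1\ge 0$ and $d_1'\ge 0$ be such that Assumptions 1, 2 and 3 (stated in the context) are satisfied by the linear operators $\mathcal L^\varepsilon(t)$ and the nonlinear operators $\mathcal F^\varepsilon[t,\cdot]$, $0<\varepsilon<\varepsilon_0$. Put $\delta:=\max\{d_1,d_1'+m\}$, let $D>\delta$, put $q:=D-m-d_1'$ and $$P_{min}:=\delta+\frac{D}{q}\big(\sqrt{\delta}+\sqrt{2(\delta+q)}\big)^2 ,$$ and let $P>P_{min}$ and $s\ge s_0+m$. Let $(h^\varepsilon,\underline u_0^\varepsilon)_{0<\varepsilon<\varepsilon_0}$ be bounded in $F^{s+P}=C([0,T];X^{s+P})\times X^{s+P+m}$. Then there exist $0<\underline T\le T$ (independent of $\varepsilon$) and a unique family $(\underline u^\varepsilon)_{0<\varepsilon<\varepsilon_0}$ bounded in $C([0,\underline T];X^{s+D})$ and solving, for every $\varepsilon\in(0,\varepsilon_0)$, the initial value problem $$\partial_t \underline u^\varepsilon+\frac1\varepsilon\mathcal L^\varepsilon(t)\underline u^\varepsilon+\mathcal F^\varepsilon[t,\underline u^\varepsilon]=h^\varepsilon,\qquad \underline u^\varepsilon|_{t=0}=\underline u_0^\varepsilon .$$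
   Context: Notation. $C(\lambda_1,\lambda_2,\dots)$ denotes a generic constant depending on the indicated parameters, in a nondecreasing way, and not on $\varepsilon\in(0,\varepsilon_0)$. $\mathfrak L(X_1,X_2)$ is the space of continuous linear maps between Banach spaces. For a Banach space $X$, $X_T:=C([0,T];X)$ with its canonical norm $|\cdot|_{X_T}$. $\mathcal F^\varepsilon_u$, $\mathcal F^\varepsilon_{uu}$ are the first and second derivatives of $u\mapsto \mathcal F^\varepsilon[\cdot,u]$. Banach scale. A family of Banach spaces $(X^s,|\cdot|_s)_{s\in\mathbb R}$ is a Banach scale if: (a) for all $s\le s'$, $X^{s'}\subset X^s$ and $|\cdot|_s\le|\cdot|_{s'}$; (b) there are (linear) smoothing operators $\mathcal S_\theta$, $\theta\ge1$, with $|(1-\mathcal S_\theta)u|_s\le C_{s,s'}\theta^{s-s'}|u|_{s'}$ for all $s<s'$, $u\in X^{s'}$, and, for all $s\le s'$, $u\in X^s$, $\mathcal S_\theta u\in X^{s'}$ and $|\mathcal S_\theta u|_{s'}\le C_{s,s'}\theta^{s'-s}|u|_s$; (c) for all $s\le s''\le s'$ and $u\in X^{s'}$, $|u|_{s''}\le C_{s,s',s''}|u|_s^{\mu}|u|_{s'}^{1-\mu}$, where $\mu s+(1-\mu)s'=s''$. Spaces. For $j\in\mathbb N$, $X^s_{(j)}:=\bigcap_{k=0}^jC^k([0,T];X^{s-km})$ with $|u|_{X^s_{(j)}}:=\sum_{k=0}^j|(\varepsilon\partial_t)^ku|_{X^{s-km}_T}$; $F^s:=C([0,T];X^s)\times X^{s+m}$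 with $|(f,g)|_{F^s}:=|f|_{X^s_T}+|g|_{s+m}$; and $\mathcal I^s(t,f,g):=|g|_s+\int_0^t\sup_{0\le t''\le t'}|f(t'')|_s\,dt'$. Assumption 1. (1) For all $s\ge s_0$, $\mathcal L^\varepsilon\in C(\mathbb R;\mathfrak L(X^{s+m};X^s))$ and $(\mathcal L^\varepsilon(\cdot))_{0<\varepsilon<\varepsilon_0}$ is bounded in $C([0,T];\mathfrak L(X^{s+m};X^s))$. (2) One can define an evolution operator $U^\varepsilon(\cdot)\in C(\mathbb R;\mathfrak L(X^s,X^s))$ ($s\ge s_0$) by: for $g\in X^s$, $U^\varepsilon(t)g:=u^\varepsilon(t)$, where $\partial_tu^\varepsilon+\frac1\varepsilon\mathcal L^\varepsilon(t)u^\varepsilon=0$, $u^\varepsilon|_{t=0}=g$; and $(U^\varepsilon(\cdot))_{0<\varepsilon<\varepsilon_0}$ is bounded in $C([-T,T];\mathfrak L(X^s,X^s))$. Assumption 2. For all $s\ge s_0$, $\mathcal F^\varepsilon\in C([0,T];C^2(X^{s+m},X^s))$ and, for all $u,v,v_1,v_2\in X^{s+m}$, (1) $\sup_{t\in[0,T]}|\mathcal F^\varepsilon[t,u]|_s\le C(s,T,|u|_{s_0+m})|u|_{s+m}$; (2) $\sup_{t\in[0,T]}|\mathcal F^\varepsilon_u[t,u]v|_s\le C(s,T,|u|_{s_0+m})(|v|_{s+m}+|u|_{s+m}|v|_{s_0+m})$; (3) $\sup_{t\in[0,T]}|\mathcal F^\varepsilon_{uu}[t,u](v_1,v_2)|_s\le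 C(s,T,|u|_{s_0+m})(|v_1|_{s+m}|v_2|_{s_0+m}+|v_1|_{s_0+m}|v_2|_{s+m}+|u|_{s+m}|v_1|_{s_0+m}|v_2|_{s_0+m})$. Assumption 3. For all $s\ge s_0+m$, $u^\varepsilon\in X^{s+d_1}_{(1)}$ and $(f^\varepsilon,g^\varepsilon)\in F^{s+d_1'}$, the problem $\partial_tv^\varepsilon+\frac1\varepsilon\mathcal L^\varepsilon(t)v^\varepsilon+\mathcal F^\varepsilon_u[t,u^\varepsilon]v^\varepsilon=f^\varepsilon$, $v^\varepsilon|_{t=0}=g^\varepsilon$, admits a unique solution $v^\varepsilon\in C([0,T];X^s)$ for all $\varepsilon\in(0,\varepsilon_0)$, and for all $t\in[0,T]$ $$|v^\varepsilon(t)|_s\le C(\varepsilon_0,s,T,|u^\varepsilon|_{X^{s_0+m+d_1}_{(1)}})\big(\mathcal I^{s+d_1'}(t,f^\varepsilon,g^\varepsilon)+|u^\varepsilon|_{X^{s+d_1}_{(1)}}\mathcal I^{s_0+m+d_1'}(t,f^\varepsilon,g^\varepsilon)\big).$$ *)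

theory Defs
  imports "HOL-Analysis.Analysis"
begin

section \<open>Banach spaces as subspaces of an ambient vector space\<close>

text \<open>The spaces of a scale are nested and carry different norms, so each of them is
  represented by a carrier and a norm inside one ambient real vector space. Norms and operators
  are total functions; their values outside the relevant carriers are irrelevant.\<close>

record 'a nspace =
  carr :: "'a set"
  nrm :: "'a \<Rightarrow> real"

text \<open>\<^const>\<open>Metric_space\<close> wants a distance that is symmetric and nonnegative also off the
  carrier, hence the conditional.\<close>

definition ndist :: "'a::real_vector nspace \<Rightarrow> 'a \<Rightarrow> 'a \<Rightarrow> real" where
  "ndist E x y = (if x \<in> carr E \<and> y \<in> carr E then nrm E (x - y) else 0)"

abbreviation ntopology :: "'a::real_vector nspace \<Rightarrow> 'a topology" where
  "ntopology E \<equiv> Metric_space.mtopology (carr E) (ndist E)"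

definition banach_space :: "'a::real_vector nspace \<Rightarrow> bool" where
  "banach_space E \<longleftrightarrow>
     subspace (carr E) \<and>
     (\<forall>x\<in>carr E. 0 \<le> nrm E x) \<and>
     (\<forall>x\<in>carr E. nrm E x = 0 \<longleftrightarrow> x = 0) \<and>
     (\<forall>x\<in>carr E. \<forall>y\<in>carr E. nrm E (x + y) \<le> nrm E x + nrm E y) \<and>
     (\<forall>c. \<forall>x\<in>carr E. nrm E (c *\<^sub>R x) = \<bar>c\<bar> * nrm E x) \<and>
     Metric_space.mcomplete (carr E) (ndist E)"


section \<open>Banach scales\<close>

definition linear_betw ::
  "'a::real_vector nspace \<Rightarrow> 'b::real_vector nspace \<Rightarrow> ('a \<Rightarrow> 'b) \<Rightarrow> bool" where
  "linear_betw E G A \<longleftrightarrow>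
     (\<forall>x\<in>carr E. A x \<in> carr G) \<and>
     (\<forall>x\<in>carr E. \<forall>y\<in>carr E. A (x + y) = A x + A y) \<and>
     (\<forall>c. \<forall>x\<in>carr E. A (c *\<^sub>R x) = c *\<^sub>R A x)"

definition smoothing_operators ::
  "(real \<Rightarrow> 'a::real_vector nspace) \<Rightarrow> (real \<Rightarrow> 'a \<Rightarrow> 'a) \<Rightarrow> bool" where
  "smoothing_operators X S \<longleftrightarrow>
     (\<forall>s s'. s \<le> s' \<longrightarrow> (\<forall>\<theta>\<ge>1. linear_betw (X s) (X s') (S \<theta>))) \<and>
     (\<forall>s s'. s < s' \<longrightarrow> (\<exists>C. \<forall>\<theta>\<ge>1. \<forall>u\<in>carr (X s').
        nrm (X s) (u - S \<theta> u) \<le> C * \<theta> powr (s - s') * nrm (X s') u)) \<and>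
     (\<forall>s s'. s \<le> s' \<longrightarrow> (\<exists>C. \<forall>\<theta>\<ge>1. \<forall>u\<in>carr (X s).
        nrm (X s') (S \<theta> u) \<le> C * \<theta> powr (s' - s) * nrm (X s) u))"

definition banach_scale :: "(real \<Rightarrow> 'a::real_vector nspace) \<Rightarrow> bool" where
  "banach_scale X \<longleftrightarrow>
     (\<forall>s. banach_space (X s)) \<and>
     (\<forall>s s'. s \<le> s' \<longrightarrow>
        carr (X s') \<subseteq> carr (X s) \<and> (\<forall>u\<in>carr (X s'). nrm (X s) u \<le> nrm (X s') u)) \<and>
     (\<exists>S. smoothing_operators X S) \<and>
     (\<forall>s s' s''. s \<le> s'' \<longrightarrow> s'' \<le> s' \<longrightarrow> (\<exists>C. \<forall>\<mu>\<in>{0..1}. \<forall>u\<in>carr (X s').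
        \<mu> * s + (1 - \<mu>) * s' = s'' \<longrightarrow>
        nrm (X s'') u \<le> C * nrm (X s) u powr \<mu> * nrm (X s') u powr (1 - \<mu>)))"


section \<open>Operator norms and operator-valued continuity\<close>

definition bounded_linear_betw ::
  "'a::real_vector nspace \<Rightarrow> 'b::real_vector nspace \<Rightarrow> ('a \<Rightarrow> 'b) \<Rightarrow> bool" where
  "bounded_linear_betw E G A \<longleftrightarrow>
     linear_betw E G A \<and> (\<exists>K. \<forall>x\<in>carr E. nrm G (A x) \<le> K * nrm E x)"

definition op_norm ::
  "'a::real_vector nspace \<Rightarrow> 'b::real_vector nspace \<Rightarrow> ('a \<Rightarrow> 'b) \<Rightarrow> real" where
  "op_norm E G A = (SUP x\<in>{x \<in> carr E. nrm E x \<le> 1}. nrm G (A x))"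

definition continuous_op ::
  "'c topology \<Rightarrow> 'a::real_vector nspace \<Rightarrow> 'b::real_vector nspace \<Rightarrow> ('c \<Rightarrow> 'a \<Rightarrow> 'b) \<Rightarrow> bool" where
  "continuous_op Z E G A \<longleftrightarrow>
     (\<forall>z\<in>topspace Z. bounded_linear_betw E G (A z)) \<and>
     (\<forall>z\<in>topspace Z. \<forall>e>0. \<exists>V. openin Z V \<and> z \<in> V \<and>
        (\<forall>y\<in>V. op_norm E G (\<lambda>x. A y x - A z x) < e))"

text \<open>Continuous linear maps from \<open>E\<close> to the space of continuous linear maps from \<open>E\<close> to \<open>G\<close>
  are identified with bounded bilinear maps.\<close>

definition bounded_bilinear_betw ::
  "'a::real_vector nspace \<Rightarrow> 'b::real_vector nspace \<Rightarrow> ('a \<Rightarrow> 'a \<Rightarrow> 'b) \<Rightarrow> bool" where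
  "bounded_bilinear_betw E G B \<longleftrightarrow>
     (\<forall>x\<in>carr E. linear_betw E G (B x)) \<and>
     (\<forall>y\<in>carr E. linear_betw E G (\<lambda>x. B x y)) \<and>
     (\<exists>K. \<forall>x\<in>carr E. \<forall>y\<in>carr E. nrm G (B x y) \<le> K * nrm E x * nrm E y)"

definition continuous_bilin ::
  "'c topology \<Rightarrow> 'a::real_vector nspace \<Rightarrow> 'b::real_vector nspace \<Rightarrow> ('c \<Rightarrow> 'a \<Rightarrow> 'a \<Rightarrow> 'b) \<Rightarrow> bool"
  where
  "continuous_bilin Z E G B \<longleftrightarrow>
     (\<forall>z\<in>topspace Z. bounded_bilinear_betw E G (B z)) \<and>
     (\<forall>z\<in>topspace Z. \<forall>e>0. \<exists>V. openin Z V \<and> z \<in> V \<and>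
        (\<forall>y\<in>V. \<forall>v\<in>carr E. \<forall>w\<in>carr E.
           nrm G (B y v w - B z v w) \<le> e * nrm E v * nrm E w))"

text \<open>\<open>f \<in> C([0,T]; C\<^sup>2(E,G))\<close> with first and second Frechet derivatives \<open>f'\<close> and \<open>f''\<close> in the
  second argument. The space \<open>C\<^sup>2(E,G)\<close> carries the compact-open \<open>C\<^sup>2\<close> topology, for which
  continuity in time amounts to joint continuity of \<open>f\<close>, \<open>f'\<close> and \<open>f''\<close>, the latter two with
  respect to operator norms.\<close>

definition time_continuous_C2 ::
  "real \<Rightarrow> 'a::real_vector nspace \<Rightarrow> 'b::real_vector nspace \<Rightarrow> (real \<Rightarrow> 'a \<Rightarrow> 'b) \<Rightarrow>
   (real \<Rightarrow> 'a \<Rightarrow> 'a \<Rightarrow> 'b) \<Rightarrow> (real \<Rightarrow> 'a \<Rightarrow> 'a \<Rightarrow> 'a \<Rightarrow> 'b) \<Rightarrow> bool" where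
  "time_continuous_C2 T E G f f' f'' \<longleftrightarrow>
     (let Z = prod_topology (top_of_set {0..T}) (ntopology E) in
       continuous_map Z (ntopology G) (\<lambda>(t, u). f t u) \<and>
       continuous_op Z E G (\<lambda>(t, u). f' t u) \<and>
       continuous_bilin Z E G (\<lambda>(t, u). f'' t u)) \<and>
     (\<forall>t\<in>{0..T}. \<forall>u\<in>carr E. \<forall>e>0. \<exists>d>0. \<forall>w\<in>carr E. nrm E w < d \<longrightarrow>
        nrm G (f t (u + w) - f t u - f' t u w) \<le> e * nrm E w) \<and>
     (\<forall>t\<in>{0..T}. \<forall>u\<in>carr E. \<forall>e>0. \<exists>d>0. \<forall>w\<in>carr E. nrm E w < d \<longrightarrow>
        op_norm E G (\<lambda>v. f' t (u + w) v - f' t u v - f'' t u w v) \<le> e * nrm E w)"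


section \<open>Functions of time\<close>

definition C_fun :: "real set \<Rightarrow> 'a::real_vector nspace \<Rightarrow> (real \<Rightarrow> 'a) \<Rightarrow> bool" where
  "C_fun I E u \<longleftrightarrow> continuous_map (top_of_set I) (ntopology E) u"

definition C_norm :: "real set \<Rightarrow> 'a::real_vector nspace \<Rightarrow> (real \<Rightarrow> 'a) \<Rightarrow> real" where
  "C_norm I E u = (SUP t\<in>I. nrm E (u t))"

definition has_time_deriv ::
  "'a::real_vector nspace \<Rightarrow> real set \<Rightarrow> (real \<Rightarrow> 'a) \<Rightarrow> 'a \<Rightarrow> real \<Rightarrow> bool" where
  "has_time_deriv E I u w t \<longleftrightarrow>
     w \<in> carr E \<and> (\<forall>\<tau>\<in>I. u \<tau> \<in> carr E) \<and>
     ((\<lambda>\<tau>. nrm E ((u \<tau> - u t) /\<^sub>R (\<tau> - t) - w)) \<longlongrightarrow> 0) (at t within I)"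

definition time_deriv ::
  "'a::real_vector nspace \<Rightarrow> real set \<Rightarrow> (real \<Rightarrow> 'a) \<Rightarrow> real \<Rightarrow> 'a" where
  "time_deriv E I u t = (THE w. has_time_deriv E I u w t)"

text \<open>The space \<open>X\<^sup>s\<^sub>(\<^sub>1\<^sub>) = C([0,T]; X\<^sup>s) \<inter> C\<^sup>1([0,T]; X\<^bsup>s-m\<^esup>)\<close> and its \<open>\<epsilon>\<close>-dependent norm.\<close>

definition X1_fun ::
  "(real \<Rightarrow> 'a::real_vector nspace) \<Rightarrow> real \<Rightarrow> real \<Rightarrow> real \<Rightarrow> (real \<Rightarrow> 'a) \<Rightarrow> bool" where
  "X1_fun X m T s u \<longleftrightarrow>
     C_fun {0..T} (X s) u \<and>
     (\<forall>t\<in>{0..T}. \<exists>w. has_time_deriv (X (s - m)) {0..T} u w t) \<and>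
     C_fun {0..T} (X (s - m)) (time_deriv (X (s - m)) {0..T} u)"

definition X1_norm ::
  "(real \<Rightarrow> 'a::real_vector nspace) \<Rightarrow> real \<Rightarrow> real \<Rightarrow> real \<Rightarrow> real \<Rightarrow> (real \<Rightarrow> 'a) \<Rightarrow> real" where
  "X1_norm X m T \<epsilon> s u =
     C_norm {0..T} (X s) u +
     C_norm {0..T} (X (s - m)) (\<lambda>t. \<epsilon> *\<^sub>R time_deriv (X (s - m)) {0..T} u t)"

definition F_space ::
  "(real \<Rightarrow> 'a::real_vector nspace) \<Rightarrow> real \<Rightarrow> real \<Rightarrow> real \<Rightarrow> (real \<Rightarrow> 'a) \<Rightarrow> 'a \<Rightarrow> bool" where
  "F_space X m T s f g \<longleftrightarrow> C_fun {0..T} (X s) f \<and> g \<in> carr (X (s + m))"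

definition F_norm ::
  "(real \<Rightarrow> 'a::real_vector nspace) \<Rightarrow> real \<Rightarrow> real \<Rightarrow> real \<Rightarrow> (real \<Rightarrow> 'a) \<Rightarrow> 'a \<Rightarrow> real" where
  "F_norm X m T s f g = C_norm {0..T} (X s) f + nrm (X (s + m)) g"

definition I_func ::
  "(real \<Rightarrow> 'a::real_vector nspace) \<Rightarrow> real \<Rightarrow> real \<Rightarrow> (real \<Rightarrow> 'a) \<Rightarrow> 'a \<Rightarrow> real" where
  "I_func X s t f g =
     nrm (X s) g + integral {0..t} (\<lambda>t'. SUP t''\<in>{0..t'}. nrm (X s) (f t''))"

text \<open>\<open>u\<close> solves \<open>\<partial>\<^sub>t u + L(t) u / \<epsilon> + G(t, u) = h\<close> on \<open>I\<close> with \<open>u(0) = g\<close>, the time derivative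
  being taken in \<open>E\<close> (one-sided at end points of \<open>I\<close>).\<close>

definition solves_ivp ::
  "'a::real_vector nspace \<Rightarrow> real set \<Rightarrow> real \<Rightarrow> (real \<Rightarrow> 'a \<Rightarrow> 'a) \<Rightarrow> (real \<Rightarrow> 'a \<Rightarrow> 'a) \<Rightarrow>
   (real \<Rightarrow> 'a) \<Rightarrow> 'a \<Rightarrow> (real \<Rightarrow> 'a) \<Rightarrow> bool" where
  "solves_ivp E I \<epsilon> L G h g u \<longleftrightarrow>
     u 0 = g \<and>
     (\<forall>t\<in>I. \<exists>w. has_time_deriv E I u w t \<and> w + (1 / \<epsilon>) *\<^sub>R L t (u t) + G t (u t) = h t)"


section \<open>The assumptions on the operators\<close>

text \<open>If \<open>s\<^sub>0 \<le> s < s\<^sub>0 + m\<close> and \<open>g \<in> X\<^sup>s\<close>, then \<open>L(t)\<close> is not known to be defined on the values of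
  the solution. The equation is therefore imposed for data in \<open>X\<^bsup>s+m\<^esup>\<close>, \<open>s \<ge> s\<^sub>0\<close>, with time
  derivative in \<open>X\<^sup>s\<close>; since \<open>X\<^bsup>s+m\<^esup>\<close> is dense in \<open>X\<^sup>s\<close>, this determines the bounded operator
  \<open>U(t)\<close> on all of \<open>X\<^sup>s\<close>.\<close>

definition evolution_operator ::
  "(real \<Rightarrow> 'a::real_vector nspace) \<Rightarrow> real \<Rightarrow> real \<Rightarrow> real \<Rightarrow>
   (real \<Rightarrow> 'a \<Rightarrow> 'a) \<Rightarrow> (real \<Rightarrow> 'a \<Rightarrow> 'a) \<Rightarrow> bool" where
  "evolution_operator X m s0 \<epsilon> L U \<longleftrightarrow>
     (\<forall>s\<ge>s0. continuous_op euclidean (X s) (X s) U) \<and>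
     (\<forall>s\<ge>s0. \<forall>g\<in>carr (X (s + m)).
        solves_ivp (X s) UNIV \<epsilon> L (\<lambda>_ _. 0) (\<lambda>_. 0) g (\<lambda>t. U t g) \<and>
        (\<forall>u. C_fun UNIV (X (s + m)) u \<longrightarrow>
             solves_ivp (X s) UNIV \<epsilon> L (\<lambda>_ _. 0) (\<lambda>_. 0) g u \<longrightarrow>
             (\<forall>t. u t = U t g)))"

definition assumption1 ::
  "(real \<Rightarrow> 'a::real_vector nspace) \<Rightarrow> real \<Rightarrow> real \<Rightarrow> real \<Rightarrow> real \<Rightarrow>
   (real \<Rightarrow> real \<Rightarrow> 'a \<Rightarrow> 'a) \<Rightarrow> bool" where
  "assumption1 X m s0 T \<epsilon>0 L \<longleftrightarrow>
     (\<forall>s\<ge>s0.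
        (\<forall>\<epsilon>\<in>{0<..<\<epsilon>0}. continuous_op euclidean (X (s + m)) (X s) (L \<epsilon>)) \<and>
        (\<exists>M. \<forall>\<epsilon>\<in>{0<..<\<epsilon>0}. \<forall>t\<in>{0..T}. op_norm (X (s + m)) (X s) (L \<epsilon> t) \<le> M)) \<and>
     (\<exists>U. (\<forall>\<epsilon>\<in>{0<..<\<epsilon>0}. evolution_operator X m s0 \<epsilon> (L \<epsilon>) (U \<epsilon>)) \<and>
        (\<forall>s\<ge>s0. \<exists>M. \<forall>\<epsilon>\<in>{0<..<\<epsilon>0}. \<forall>t\<in>{-T..T}. op_norm (X s) (X s) (U \<epsilon> t) \<le> M))"

text \<open>Constants \<open>C s r\<close> below are nondecreasing in \<open>s\<close> and in the norm \<open>r\<close>, and independent of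
  \<open>\<epsilon>\<close>; they may also depend on the fixed numbers \<open>T\<close> and \<open>\<epsilon>\<^sub>0\<close>.\<close>

definition nondecreasing2 :: "(real \<Rightarrow> real \<Rightarrow> real) \<Rightarrow> bool" where
  "nondecreasing2 C \<longleftrightarrow> (\<forall>s s' r r'. s \<le> s' \<longrightarrow> r \<le> r' \<longrightarrow> C s r \<le> C s' r')"

definition assumption2 ::
  "(real \<Rightarrow> 'a::real_vector nspace) \<Rightarrow> real \<Rightarrow> real \<Rightarrow> real \<Rightarrow> real \<Rightarrow>
   (real \<Rightarrow> real \<Rightarrow> 'a \<Rightarrow> 'a) \<Rightarrow> (real \<Rightarrow> real \<Rightarrow> 'a \<Rightarrow> 'a \<Rightarrow> 'a) \<Rightarrow>
   (real \<Rightarrow> real \<Rightarrow> 'a \<Rightarrow> 'a \<Rightarrow> 'a \<Rightarrow> 'a) \<Rightarrow> bool" where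
  "assumption2 X m s0 T \<epsilon>0 F Fu Fuu \<longleftrightarrow>
     (\<forall>s\<ge>s0. \<forall>\<epsilon>\<in>{0<..<\<epsilon>0}.
        time_continuous_C2 T (X (s + m)) (X s) (F \<epsilon>) (Fu \<epsilon>) (Fuu \<epsilon>)) \<and>
     (\<exists>C. nondecreasing2 C \<and>
        (\<forall>s\<ge>s0. \<forall>\<epsilon>\<in>{0<..<\<epsilon>0}. \<forall>u\<in>carr (X (s + m)). \<forall>t\<in>{0..T}.
           nrm (X s) (F \<epsilon> t u) \<le> C s (nrm (X (s0 + m)) u) * nrm (X (s + m)) u)) \<and>
     (\<exists>C. nondecreasing2 C \<and>
        (\<forall>s\<ge>s0. \<forall>\<epsilon>\<in>{0<..<\<epsilon>0}. \<forall>u\<in>carr (X (s + m)). \<forall>v\<in>carr (X (s + m)). \<forall>t\<in>{0..T}.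
           nrm (X s) (Fu \<epsilon> t u v) \<le> C s (nrm (X (s0 + m)) u) *
             (nrm (X (s + m)) v + nrm (X (s + m)) u * nrm (X (s0 + m)) v))) \<and>
     (\<exists>C. nondecreasing2 C \<and>
        (\<forall>s\<ge>s0. \<forall>\<epsilon>\<in>{0<..<\<epsilon>0}. \<forall>u\<in>carr (X (s + m)).
           \<forall>v1\<in>carr (X (s + m)). \<forall>v2\<in>carr (X (s + m)). \<forall>t\<in>{0..T}.
           nrm (X s) (Fuu \<epsilon> t u v1 v2) \<le> C s (nrm (X (s0 + m)) u) *
             (nrm (X (s + m)) v1 * nrm (X (s0 + m)) v2 +
              nrm (X (s0 + m)) v1 * nrm (X (s + m)) v2 +
              nrm (X (s + m)) u * nrm (X (s0 + m)) v1 * nrm (X (s0 + m)) v2)))"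

definition assumption3 ::
  "(real \<Rightarrow> 'a::real_vector nspace) \<Rightarrow> real \<Rightarrow> real \<Rightarrow> real \<Rightarrow> real \<Rightarrow> real \<Rightarrow> real \<Rightarrow>
   (real \<Rightarrow> real \<Rightarrow> 'a \<Rightarrow> 'a) \<Rightarrow> (real \<Rightarrow> real \<Rightarrow> 'a \<Rightarrow> 'a \<Rightarrow> 'a) \<Rightarrow> bool" where
  "assumption3 X m s0 d1 d1' T \<epsilon>0 L Fu \<longleftrightarrow>
     (\<exists>C. nondecreasing2 C \<and>
        (\<forall>s\<ge>s0 + m. \<forall>\<epsilon>\<in>{0<..<\<epsilon>0}. \<forall>u f g.
           X1_fun X m T (s + d1) u \<longrightarrow> F_space X m T (s + d1') f g \<longrightarrow>
           (let sol = (\<lambda>v. C_fun {0..T} (X s) v \<and>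
                  solves_ivp (X (s - m)) {0..T} \<epsilon> (L \<epsilon>) (\<lambda>t. Fu \<epsilon> t (u t)) f g v)
            in \<exists>v. sol v \<and> (\<forall>w. sol w \<longrightarrow> (\<forall>t\<in>{0..T}. w t = v t)) \<and>
                 (\<forall>t\<in>{0..T}. nrm (X s) (v t) \<le>
                    C s (X1_norm X m T \<epsilon> (s0 + m + d1) u) *
                    (I_func X (s + d1') t f g +
                     X1_norm X m T \<epsilon> (s + d1) u * I_func X (s0 + m + d1') t f g)))))"


section \<open>Bounded families of solutions of the nonlinear problem\<close>

text \<open>Only the values of \<open>u \<epsilon> t\<close> for \<open>0 < \<epsilon> < \<epsilon>\<^sub>0\<close> and \<open>0 \<le> t \<le> T\<close> matter. The equation holds in
  \<open>X\<^bsup>r-m\<^esup>\<close>, where all its terms are continuous functions of time.\<close>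

definition bounded_solution_family ::
  "(real \<Rightarrow> 'a::real_vector nspace) \<Rightarrow> real \<Rightarrow> real \<Rightarrow> real \<Rightarrow> real \<Rightarrow>
   (real \<Rightarrow> real \<Rightarrow> 'a \<Rightarrow> 'a) \<Rightarrow> (real \<Rightarrow> real \<Rightarrow> 'a \<Rightarrow> 'a) \<Rightarrow>
   (real \<Rightarrow> real \<Rightarrow> 'a) \<Rightarrow> (real \<Rightarrow> 'a) \<Rightarrow> (real \<Rightarrow> real \<Rightarrow> 'a) \<Rightarrow> bool" where
  "bounded_solution_family X m T \<epsilon>0 r L F h u0 u \<longleftrightarrow>
     (\<forall>\<epsilon>\<in>{0<..<\<epsilon>0}. C_fun {0..T} (X r) (u \<epsilon>) \<and>
        solves_ivp (X (r - m)) {0..T} \<epsilon> (L \<epsilon>) (F \<epsilon>) (h \<epsilon>) (u0 \<epsilon>) (u \<epsilon>)) \<and>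
     (\<exists>M. \<forall>\<epsilon>\<in>{0<..<\<epsilon>0}. C_norm {0..T} (X r) (u \<epsilon>) \<le> M)"

end

theory Submission
  imports Defs
begin

text \<open>The solution is constructed by a Nash--Moser iteration with geometrically growing smoothing
  parameters \<open>\<theta>\<^sub>k = \<theta>\<^sub>0 \<Lambda>\<^sup>k\<close>, on a time interval \<open>[0,T']\<close> whose length is chosen last. Let \<open>u\<close> be an
  approximate solution with residual \<open>r\<close>, that is, \<open>\<partial>\<^sub>t u + L u / \<epsilon> + F[u] = h - r\<close> and \<open>u(0) = u\<^sub>0\<close>.
  The next one is \<open>u + v\<close>, where \<open>v(0) = 0\<close> and \<open>v\<close> solves the problem linearised at \<open>S\<^sub>\<theta> u\<close> with right-hand
  side \<open>S\<^sub>\<theta> r\<close>. Its residual is the sum of the smoothing error \<open>r - S\<^sub>\<theta> r\<close>, the substitution error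
  \<open>(F\<^sub>u[S\<^sub>\<theta> u] - F\<^sub>u[u]) v\<close>, and the Taylor remainder of \<open>F\<close> with opposite sign. Since \<open>v\<close> is not smoothed, no
  commutator with \<open>L / \<epsilon>\<close> arises and all constants are independent of \<open>\<epsilon>\<close>.

  With \<open>\<alpha> = P/2 > D\<close>, the residual decays like \<open>\<theta>\<^sup>-\<^sup>\<alpha>\<close> in \<open>X\<^bsup>s+D-m\<^esup>\<close>, while it may grow like \<open>\<theta>\<^sup>\<beta>\<close> in
  \<open>X\<^bsup>s+P\<^esup>\<close>. The smoothing error is the only part of the new residual without a factor \<open>v\<close>. It trades growth
  in the high norm for decay in the low one, and a suitable choice of \<open>\<Lambda>\<close> and \<open>\<theta>\<^sub>0\<close> makes it small enough.
  The linear estimate gives \<open>v\<close> a factor \<open>T'\<close> and the size \<open>\<theta>\<^bsup>\<sigma>-\<alpha>\<^esup>\<close> in \<open>X\<^bsup>s+\<sigma>\<^esup>\<close> for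
  \<open>\<sigma> = 0, D, P + m\<close> (lemma \<open>increment\<close>). By
  tameness the other errors are then of the required size in both norms with a factor \<open>T'\<close> (lemma
  \<open>step_error\<close>), which absorbs all remaining constants (lemma \<open>iteration_step\<close>). The increments are summable in
  \<open>X\<^bsup>s+D\<^esup>\<close> because \<open>\<alpha> > D\<close>, and the limit is a solution (lemma \<open>scheme_limit\<close>). This argument works
  for \<open>P > 2 D\<close>, a consequence of \<open>P > P\<^sub>m\<^sub>i\<^sub>n\<close>.

  The linear estimate is available only on \<open>[0,T]\<close>, whereas smallness is available only on \<open>[0,T']\<close>. The
  coefficient of the linearised problem is therefore extended past \<open>T'\<close> by a reflection that preserves continuous
  differentiability with bounds independent of \<open>T'\<close> (lemmas \<open>C1_fun_extend\<close> and \<open>linear_solve\<close>).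

  For uniqueness (lemma \<open>sol_unique\<close>), the difference \<open>p\<close> of two solutions solves a linearised problem
  whose right-hand side is a Taylor remainder of \<open>F\<close>. By tameness it is bounded by \<open>C |p|\<^sub>s\<close>, without loss of
  derivatives, and a Gronwall argument gives \<open>p = 0\<close>.\<close>

section \<open>Normed spaces and continuous functions of time\<close>

lemma banach_space_zero: "banach_space E \<Longrightarrow> 0 \<in> carr E"
  by (auto simp: banach_space_def subspace_def)

lemma banach_space_add: "banach_space E \<Longrightarrow> x \<in> carr E \<Longrightarrow> y \<in> carr E \<Longrightarrow> x + y \<in> carr E"
  by (auto simp: banach_space_def subspace_def)

lemma banach_space_scale: "banach_space E \<Longrightarrow> x \<in> carr E \<Longrightarrow> c *\<^sub>R x \<in> carr E"
  by (auto simp: banach_space_def subspace_def)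

lemma banach_space_diff: "banach_space E \<Longrightarrow> x \<in> carr E \<Longrightarrow> y \<in> carr E \<Longrightarrow> x - y \<in> carr E"
  by (auto simp: banach_space_def intro: subspace_diff)

lemma banach_space_minus: "banach_space E \<Longrightarrow> x \<in> carr E \<Longrightarrow> - x \<in> carr E"
  by (auto simp: banach_space_def intro: subspace_neg)

lemmas banach_space_closed =
  banach_space_zero banach_space_add banach_space_scale banach_space_diff banach_space_minus

lemma nrm_nonneg: "banach_space E \<Longrightarrow> x \<in> carr E \<Longrightarrow> 0 \<le> nrm E x"
  by (auto simp: banach_space_def)

lemma nrm_eq_0: "banach_space E \<Longrightarrow> x \<in> carr E \<Longrightarrow> nrm E x = 0 \<longleftrightarrow> x = 0"
  by (auto simp: banach_space_def)

lemma nrm_zero: "banach_space E \<Longrightarrow> nrm E 0 = 0"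
  by (simp add: nrm_eq_0 banach_space_zero)

lemma nrm_add: "banach_space E \<Longrightarrow> x \<in> carr E \<Longrightarrow> y \<in> carr E \<Longrightarrow> nrm E (x + y) \<le> nrm E x + nrm E y"
  by (auto simp: banach_space_def)

lemma nrm_scale: "banach_space E \<Longrightarrow> x \<in> carr E \<Longrightarrow> nrm E (c *\<^sub>R x) = \<bar>c\<bar> * nrm E x"
  by (auto simp: banach_space_def)

lemma nrm_minus: "banach_space E \<Longrightarrow> x \<in> carr E \<Longrightarrow> nrm E (- x) = nrm E x"
  using nrm_scale[of E x "-1"] by simp

lemma nrm_diff:
  assumes "banach_space E" "x \<in> carr E" "y \<in> carr E"
  shows "nrm E (x - y) \<le> nrm E x + nrm E y"
  using nrm_add[OF assms(1,2), of "- y"] nrm_minus[OF assms(1,3)] banach_space_minus[OF assms(1,3)]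
  by simp

lemma nrm_diff_commute:
  assumes "banach_space E" "x \<in> carr E" "y \<in> carr E"
  shows "nrm E (x - y) = nrm E (y - x)"
  using nrm_minus[OF assms(1) banach_space_diff[OF assms]] by simp

lemma nrm_triangle:
  assumes "banach_space E" "x \<in> carr E" "y \<in> carr E" "z \<in> carr E"
  shows "nrm E (x - z) \<le> nrm E (x - y) + nrm E (y - z)"
  using nrm_add[OF assms(1) banach_space_diff[OF assms(1,2,3)] banach_space_diff[OF assms(1,3,4)]] by simp

lemma nrm_le_add_diff:
  assumes "banach_space E" "x \<in> carr E" "y \<in> carr E"
  shows "nrm E x \<le> nrm E y + nrm E (x - y)"
  using nrm_add[OF assms(1,3) banach_space_diff[OF assms]] by simp

lemma nrm_abs_diff:
  assumes "banach_space E" "x \<in> carr E" "y \<in> carr E"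
  shows "\<bar>nrm E x - nrm E y\<bar> \<le> nrm E (x - y)"
  using nrm_le_add_diff[OF assms] nrm_le_add_diff[OF assms(1,3,2)] nrm_diff_commute[OF assms] by linarith

lemma Metric_space_ndist:
  assumes "banach_space E"
  shows "Metric_space (carr E) (ndist E)"
proof
  show "0 \<le> ndist E x y" for x y
    using assms by (auto simp: ndist_def intro: nrm_nonneg banach_space_closed)
  show "ndist E x y = ndist E y x" for x y
    using assms by (auto simp: ndist_def intro: nrm_diff_commute)
  show "(ndist E x y = 0) = (x = y)" if "x \<in> carr E" "y \<in> carr E" for x y
    using assms that by (auto simp: ndist_def nrm_eq_0 banach_space_closed)
  show "ndist E x z \<le> ndist E x y + ndist E y z" if "x \<in> carr E" "y \<in> carr E" "z \<in> carr E" for x y z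
    using assms that by (auto simp: ndist_def intro: nrm_triangle)
qed

lemma C_fun_iff:
  assumes "banach_space E"
  shows "C_fun I E u \<longleftrightarrow> (\<forall>t\<in>I. u t \<in> carr E) \<and>
    (\<forall>t\<in>I. ((\<lambda>\<tau>. nrm E (u \<tau> - u t)) \<longlongrightarrow> 0) (at t within I))" (is "?l \<longleftrightarrow> ?r")
proof -
  interpret M: Metric_space "carr E" "ndist E" using assms by (rule Metric_space_ndist)
  have ev: "(\<exists>U. openin (top_of_set I) U \<and> t \<in> U \<and> (\<forall>y\<in>U. u y \<in> M.mball (u t) e)) \<longleftrightarrow>
      (\<forall>\<^sub>F \<tau> in at t within I. nrm E (u \<tau> - u t) < e)"
    if c: "\<forall>t\<in>I. u t \<in> carr E" and t: "t \<in> I" and e: "e > 0" for t e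
  proof
    assume "\<exists>U. openin (top_of_set I) U \<and> t \<in> U \<and> (\<forall>y\<in>U. u y \<in> M.mball (u t) e)"
    then obtain S where "open S" "t \<in> S" "\<forall>y\<in>I \<inter> S. u y \<in> M.mball (u t) e"
      by (auto simp: openin_open)
    then show "\<forall>\<^sub>F \<tau> in at t within I. nrm E (u \<tau> - u t) < e"
      unfolding eventually_at_topological using c t
      by (intro exI[of _ S]) (auto simp: ndist_def nrm_diff_commute[OF assms])
  next
    assume "\<forall>\<^sub>F \<tau> in at t within I. nrm E (u \<tau> - u t) < e"
    then obtain S where S: "open S" "t \<in> S" "\<forall>\<tau>\<in>S. \<tau> \<noteq> t \<longrightarrow> \<tau> \<in> I \<longrightarrow> nrm E (u \<tau> - u t) < e"
      unfolding eventually_at_topological by blast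
    show "\<exists>U. openin (top_of_set I) U \<and> t \<in> U \<and> (\<forall>y\<in>U. u y \<in> M.mball (u t) e)"
    proof (intro exI[of _ "I \<inter> S"] conjI ballI)
      show "u y \<in> M.mball (u t) e" if "y \<in> I \<inter> S" for y
      proof (cases "y = t")
        case True
        then show ?thesis using c t e by (auto simp: ndist_def nrm_zero[OF assms])
      next
        case False
        then show ?thesis using S that c t by (auto simp: ndist_def nrm_diff_commute[OF assms, of "u t"])
      qed
    qed (use S t in \<open>auto simp: openin_open\<close>)
  qed
  have lim: "((\<lambda>\<tau>. nrm E (u \<tau> - u t)) \<longlongrightarrow> 0) (at t within I) \<longleftrightarrow>
     (\<forall>e>0. \<forall>\<^sub>F \<tau> in at t within I. nrm E (u \<tau> - u t) < e)"
    if c: "\<forall>t\<in>I. u t \<in> carr E" and t: "t \<in> I" for t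
  proof -
    have *: "\<forall>\<^sub>F \<tau> in at t within I. 0 \<le> nrm E (u \<tau> - u t)"
      unfolding eventually_at_filter using c t
      by (auto intro!: always_eventually nrm_nonneg assms banach_space_closed)
    have "(\<forall>\<^sub>F \<tau> in at t within I. dist (nrm E (u \<tau> - u t)) 0 < e) \<longleftrightarrow>
       (\<forall>\<^sub>F \<tau> in at t within I. nrm E (u \<tau> - u t) < e)" for e
      by (rule eventually_subst) (use * in \<open>eventually_elim, simp\<close>)
    then show ?thesis by (simp add: tendsto_iff)
  qed
  show ?thesis
    unfolding C_fun_def M.continuous_map_to_metric
  proof (intro iffI conjI ballI)
    assume a: "\<forall>x\<in>topspace (top_of_set I). \<forall>\<epsilon>>0. \<exists>U. openin (top_of_set I) U \<and> x \<in> U \<and> (\<forall>y\<in>U. u y \<in> M.mball (u x) \<epsilon>)"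
    show c: "u t \<in> carr E" if "t \<in> I" for t
      using a[rule_format, of t 1] that by auto
    show "((\<lambda>\<tau>. nrm E (u \<tau> - u t)) \<longlongrightarrow> 0) (at t within I)" if "t \<in> I" for t
      using a that c lim ev by simp
  next
    fix t
    assume "t \<in> topspace (top_of_set I)" "(\<forall>t\<in>I. u t \<in> carr E) \<and>
    (\<forall>t\<in>I. ((\<lambda>\<tau>. nrm E (u \<tau> - u t)) \<longlongrightarrow> 0) (at t within I))"
    then show "\<forall>\<epsilon>>0. \<exists>U. openin (top_of_set I) U \<and> t \<in> U \<and> (\<forall>y\<in>U. u y \<in> M.mball (u t) \<epsilon>)"
      using lim ev by simp
  qed
qed

lemma C_fun_carr: "banach_space E \<Longrightarrow> C_fun I E u \<Longrightarrow> t \<in> I \<Longrightarrow> u t \<in> carr E"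
  by (simp add: C_fun_iff)

lemma C_funI:
  assumes "banach_space E" "\<And>t. t \<in> I \<Longrightarrow> u t \<in> carr E"
    and "\<And>t. t \<in> I \<Longrightarrow> (b t \<longlongrightarrow> 0) (at t within I)"
    and "\<And>t \<tau>. t \<in> I \<Longrightarrow> \<tau> \<in> I \<Longrightarrow> nrm E (u \<tau> - u t) \<le> b t \<tau>"
  shows "C_fun I E u"
proof -
  have "((\<lambda>\<tau>. nrm E (u \<tau> - u t)) \<longlongrightarrow> 0) (at t within I)" if t: "t \<in> I" for t
  proof (rule Lim_null_comparison[OF _ assms(3)[OF t]])
    have "0 \<le> nrm E (u x - u t)" if "x \<in> I" for x
      using assms(1,2) t that by (intro nrm_nonneg banach_space_diff) auto
    then show "\<forall>\<^sub>F x in at t within I. norm (nrm E (u x - u t)) \<le> b t x"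
      unfolding eventually_at_filter using assms(4)[OF t]
      by (intro always_eventually) auto
  qed
  then show ?thesis using assms by (simp add: C_fun_iff)
qed

lemma C_funD: "banach_space E \<Longrightarrow> C_fun I E u \<Longrightarrow> t \<in> I \<Longrightarrow>
  ((\<lambda>\<tau>. nrm E (u \<tau> - u t)) \<longlongrightarrow> 0) (at t within I)"
  by (simp add: C_fun_iff)

lemma C_fun_subset:
  assumes "banach_space E" "C_fun I E u" "J \<subseteq> I"
  shows "C_fun J E u"
  using assms by (auto simp: C_fun_iff intro: tendsto_within_subset)

lemma C_fun_cong:
  assumes "banach_space E" "C_fun I E u" "\<And>t. t \<in> I \<Longrightarrow> v t = u t"
  shows "C_fun I E v"
  using assms(2) unfolding C_fun_def
  by (rule continuous_map_eq) (use assms in auto)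

lemma C_fun_const: "banach_space E \<Longrightarrow> x \<in> carr E \<Longrightarrow> C_fun I E (\<lambda>_. x)"
  by (auto simp: C_fun_iff nrm_zero)

lemma C_fun_nrm:
  assumes "banach_space E" "C_fun I E u"
  shows "continuous_on I (\<lambda>t. nrm E (u t))"
  unfolding continuous_on_def
proof
  fix t assume t: "t \<in> I"
  have "((\<lambda>\<tau>. nrm E (u \<tau>) - nrm E (u t)) \<longlongrightarrow> 0) (at t within I)"
  proof (rule Lim_null_comparison[OF _ C_funD[OF assms t]])
    show "\<forall>\<^sub>F x in at t within I. norm (nrm E (u x) - nrm E (u t)) \<le> nrm E (u x - u t)"
      unfolding eventually_at_filter using assms t
      by (auto intro!: always_eventually nrm_abs_diff C_fun_carr[OF assms])
  qed
  then show "((\<lambda>t. nrm E (u t)) \<longlongrightarrow> nrm E (u t)) (at t within I)"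
    by (simp add: LIM_zero_iff)
qed

lemma C_fun_bdd:
  assumes "banach_space E" "C_fun I E u" "compact I"
  shows "bdd_above ((\<lambda>t. nrm E (u t)) ` I)"
  using compact_continuous_image[OF C_fun_nrm[OF assms(1,2)] assms(3)]
  by (intro bounded_imp_bdd_above compact_imp_bounded)

lemma nrm_le_C_norm:
  assumes "banach_space E" "C_fun I E u" "compact I" "t \<in> I"
  shows "nrm E (u t) \<le> C_norm I E u"
  unfolding C_norm_def using C_fun_bdd[OF assms(1-3)] assms(4) by (rule cSUP_upper2) simp

lemma C_norm_le:
  assumes "I \<noteq> {}" "\<And>t. t \<in> I \<Longrightarrow> nrm E (u t) \<le> B"
  shows "C_norm I E u \<le> B"
  unfolding C_norm_def using assms by (intro cSUP_least) auto

lemma C_fun_add: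
  assumes B: "banach_space E" and "C_fun I E u" "C_fun I E v"
  shows "C_fun I E (\<lambda>t. u t + v t)"
proof (rule C_funI[OF B])
  note c = C_fun_carr[OF B assms(2)] C_fun_carr[OF B assms(3)]
  show "u t + v t \<in> carr E" if "t \<in> I" for t using that c B by (intro banach_space_closed)
  show "((\<lambda>\<tau>. nrm E (u \<tau> - u t) + nrm E (v \<tau> - v t)) \<longlongrightarrow> 0) (at t within I)" if "t \<in> I" for t
    by (rule tendsto_add_zero) (use C_funD[OF B] assms that in auto)
  show "nrm E (u \<tau> + v \<tau> - (u t + v t)) \<le> nrm E (u \<tau> - u t) + nrm E (v \<tau> - v t)" if "t \<in> I" "\<tau> \<in> I" for t \<tau>
    using nrm_add[OF B, of "u \<tau> - u t" "v \<tau> - v t"] c that B by (simp add: banach_space_closed algebra_simps)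
qed

lemma C_fun_scale:
  assumes B: "banach_space E" and "C_fun I E u" "continuous_on I c"
  shows "C_fun I E (\<lambda>t. c t *\<^sub>R u t)"
proof (rule C_funI[OF B])
  note c = C_fun_carr[OF B assms(2)]
  show "c t *\<^sub>R u t \<in> carr E" if "t \<in> I" for t using that c B by (intro banach_space_closed)
  show "((\<lambda>\<tau>. \<bar>c \<tau>\<bar> * nrm E (u \<tau> - u t) + \<bar>c \<tau> - c t\<bar> * nrm E (u t)) \<longlongrightarrow> 0) (at t within I)" if "t \<in> I" for t
  proof -
    have "(c \<longlongrightarrow> c t) (at t within I)" using assms(3) that by (auto simp: continuous_on_def)
    then have "((\<lambda>\<tau>. \<bar>c \<tau>\<bar> * nrm E (u \<tau> - u t) + \<bar>c \<tau> - c t\<bar> * nrm E (u t)) \<longlongrightarrow>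
         \<bar>c t\<bar> * 0 + \<bar>c t - c t\<bar> * nrm E (u t)) (at t within I)"
      by (intro tendsto_intros C_funD[OF B assms(2) that])
    then show ?thesis by simp
  qed
  show "nrm E (c \<tau> *\<^sub>R u \<tau> - c t *\<^sub>R u t) \<le> \<bar>c \<tau>\<bar> * nrm E (u \<tau> - u t) + \<bar>c \<tau> - c t\<bar> * nrm E (u t)" if "t \<in> I" "\<tau> \<in> I" for t \<tau>
  proof -
    have "c \<tau> *\<^sub>R u \<tau> - c t *\<^sub>R u t = c \<tau> *\<^sub>R (u \<tau> - u t) + (c \<tau> - c t) *\<^sub>R u t"
      by (simp add: algebra_simps)
    then show ?thesis
      using nrm_add[OF B, of "c \<tau> *\<^sub>R (u \<tau> - u t)" "(c \<tau> - c t) *\<^sub>R u t"] c[OF that(1)] c[OF that(2)] B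
      by (simp add: banach_space_closed nrm_scale[OF B])
  qed
qed

lemma C_fun_diff:
  assumes B: "banach_space E" and "C_fun I E u" "C_fun I E v"
  shows "C_fun I E (\<lambda>t. u t - v t)"
  using C_fun_add[OF B assms(2) C_fun_scale[OF B assms(3), of "\<lambda>_. -1"]] by simp

lemma C_fun_compose:
  assumes B: "banach_space E" and "C_fun I E u" "continuous_on J \<alpha>" "\<alpha> ` J \<subseteq> I"
  shows "C_fun J E (\<lambda>t. u (\<alpha> t))"
proof -
  have "continuous_map (top_of_set J) (top_of_set I) \<alpha>"
    using assms by auto
  then show ?thesis
    using assms(2) unfolding C_fun_def
    using continuous_map_compose[of "top_of_set J" "top_of_set I" \<alpha> "ntopology E" u] by (simp add: o_def)
qed

text \<open>The continuous embedding of one normed space into another one with the same ambient space.\<close>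

definition embeds :: "'a::real_vector nspace \<Rightarrow> 'a nspace \<Rightarrow> bool" where
  "embeds E G \<longleftrightarrow> carr E \<subseteq> carr G \<and> (\<forall>x\<in>carr E. nrm G x \<le> nrm E x)"

lemma C_fun_embeds:
  assumes "banach_space E" "banach_space G" "embeds E G" "C_fun I E u"
  shows "C_fun I G u"
proof (rule C_funI)
  show "u t \<in> carr G" if "t \<in> I" for t
    using C_fun_carr[OF assms(1,4) that] assms(3) by (auto simp: embeds_def)
  show "((\<lambda>\<tau>. nrm E (u \<tau> - u t)) \<longlongrightarrow> 0) (at t within I)" if "t \<in> I" for t
    using C_funD[OF assms(1,4) that] .
  show "nrm G (u \<tau> - u t) \<le> nrm E (u \<tau> - u t)" if "t \<in> I" "\<tau> \<in> I" for t \<tau>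
    using C_fun_carr[OF assms(1,4)] that assms(1,3) by (auto simp: embeds_def banach_space_closed)
qed fact

lemma C_fun_Un_closed:
  assumes B: "banach_space E" and "C_fun {a..b} E u" "C_fun {b..c} E u" "a \<le> b" "b \<le> c"
  shows "C_fun {a..c} E u"
  unfolding C_fun_iff[OF B]
proof (intro conjI ballI)
  have I: "{a..c} = {a..b} \<union> {b..c}" using assms by auto
  show "u t \<in> carr E" if "t \<in> {a..c}" for t
    using C_fun_carr[OF B assms(2), of t] C_fun_carr[OF B assms(3), of t] that by force
  show "((\<lambda>\<tau>. nrm E (u \<tau> - u t)) \<longlongrightarrow> 0) (at t within {a..c})" if t: "t \<in> {a..c}" for t
  proof -
    have n: "at t within S = bot" if "closed S" "t \<notin> S" for S
      using that by (simp add: at_within_eq_bot_iff closure_closed)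
    have "((\<lambda>\<tau>. nrm E (u \<tau> - u t)) \<longlongrightarrow> 0) (at t within {a..b})"
      using C_funD[OF B assms(2), of t] n[of "{a..b}"] by (cases "t \<in> {a..b}") auto
    moreover have "((\<lambda>\<tau>. nrm E (u \<tau> - u t)) \<longlongrightarrow> 0) (at t within {b..c})"
      using C_funD[OF B assms(3), of t] n[of "{b..c}"] by (cases "t \<in> {b..c}") auto
    ultimately show ?thesis unfolding I by (rule Lim_Un)
  qed
qed

section \<open>Operators\<close>

lemma linear_betw_zero: "banach_space E \<Longrightarrow> linear_betw E G A \<Longrightarrow> A 0 = 0"
  unfolding linear_betw_def using banach_space_zero[of E] by (metis scale_zero_left)

lemma linear_betw_diff:
  assumes "banach_space E" "linear_betw E G A" "x \<in> carr E" "y \<in> carr E"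
  shows "A (x - y) = A x - A y"
proof -
  have "A (x + (-1) *\<^sub>R y) = A x + (-1) *\<^sub>R A y"
    using assms banach_space_scale[OF assms(1), of y "-1"] unfolding linear_betw_def by metis
  then show ?thesis by simp
qed

lemma linear_betw_sub:
  assumes "banach_space G" "linear_betw E G A" "linear_betw E G B"
  shows "linear_betw E G (\<lambda>x. A x - B x)"
  using assms unfolding linear_betw_def
  by (auto simp: banach_space_closed algebra_simps)

lemma bounded_linear_betw_sub:
  assumes "banach_space E" "banach_space G" "bounded_linear_betw E G A" "bounded_linear_betw E G B"
  shows "bounded_linear_betw E G (\<lambda>x. A x - B x)"
proof -
  obtain K1 K2 where K: "\<forall>x\<in>carr E. nrm G (A x) \<le> K1 * nrm E x" "\<forall>x\<in>carr E. nrm G (B x) \<le> K2 * nrm E x"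
    using assms by (auto simp: bounded_linear_betw_def)
  have c: "A x \<in> carr G" "B x \<in> carr G" if "x \<in> carr E" for x
    using assms that by (auto simp: bounded_linear_betw_def linear_betw_def)
  have "nrm G (A x - B x) \<le> (K1 + K2) * nrm E x" if "x \<in> carr E" for x
    using nrm_diff[OF assms(2) c[OF that]] K that by (force simp: distrib_right)
  then show ?thesis
    using assms linear_betw_sub[OF assms(2)] unfolding bounded_linear_betw_def by blast
qed

lemma nrm_le_op_norm:
  assumes "banach_space E" "banach_space G" "bounded_linear_betw E G A" "x \<in> carr E"
  shows "nrm G (A x) \<le> op_norm E G A * nrm E x"
proof (cases "x = 0")
  case True
  then show ?thesis
    using assms linear_betw_zero[of E G A] by (auto simp: nrm_zero bounded_linear_betw_def)
next
  case False
  obtain K where K: "\<forall>x\<in>carr E. nrm G (A x) \<le> K * nrm E x" and l: "linear_betw E G A"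
    using assms by (auto simp: bounded_linear_betw_def)
  define c where "c = nrm E x"
  have c: "c > 0" using False nrm_eq_0[OF assms(1,4)] nrm_nonneg[OF assms(1,4)] by (simp add: c_def)
  have y: "(1/c) *\<^sub>R x \<in> carr E" "nrm E ((1/c) *\<^sub>R x) = 1"
    using assms c by (auto simp: banach_space_closed nrm_scale[OF assms(1,4)] c_def)
  have bdd: "bdd_above ((\<lambda>x. nrm G (A x)) ` {x \<in> carr E. nrm E x \<le> 1})"
  proof (rule bdd_aboveI2)
    fix z assume z: "z \<in> {x \<in> carr E. nrm E x \<le> 1}"
    have "nrm G (A z) \<le> K * nrm E z" using K z by auto
    also have "\<dots> \<le> \<bar>K\<bar> * 1"
      using z nrm_nonneg[OF assms(1), of z] by (intro mult_mono) auto
    finally show "nrm G (A z) \<le> \<bar>K\<bar>" by simp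
  qed
  have "nrm G (A ((1/c) *\<^sub>R x)) \<le> op_norm E G A"
    unfolding op_norm_def using y by (intro cSUP_upper[OF _ bdd]) auto
  moreover have "A ((1/c) *\<^sub>R x) = (1/c) *\<^sub>R A x" using l assms(4) by (auto simp: linear_betw_def)
  moreover have "A x \<in> carr G" using l assms(4) by (auto simp: linear_betw_def)
  ultimately have "(1/c) * nrm G (A x) \<le> op_norm E G A"
    using nrm_scale[OF assms(2), of "A x" "1/c"] c by simp
  then show ?thesis using c by (simp add: field_simps c_def)
qed

lemma C_fun_continuous_op:
  assumes BE: "banach_space E" and BG: "banach_space G"
    and A: "continuous_op Z E G A" and g: "continuous_map (top_of_set I) Z \<gamma>" and v: "C_fun I E v"
  shows "C_fun I G (\<lambda>t. A (\<gamma> t) (v t))"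
proof -
  have gz: "\<gamma> t \<in> topspace Z" if "t \<in> I" for t using g that by (auto simp: continuous_map_def)
  have bl: "bounded_linear_betw E G (A (\<gamma> t))" if "t \<in> I" for t
    using A gz that by (auto simp: continuous_op_def)
  have l: "linear_betw E G (A (\<gamma> t))" if "t \<in> I" for t
    using bl that by (auto simp: bounded_linear_betw_def)
  note vc = C_fun_carr[OF BE v]
  have Ac: "A (\<gamma> t) x \<in> carr G" if "t \<in> I" "x \<in> carr E" for t x
    using l that by (auto simp: linear_betw_def)
  have est: "nrm G (A (\<gamma> \<tau>) (v \<tau>) - A (\<gamma> t) (v t)) \<le>
      op_norm E G (\<lambda>x. A (\<gamma> \<tau>) x - A (\<gamma> t) x) * nrm E (v \<tau>) + op_norm E G (A (\<gamma> t)) * nrm E (v \<tau> - v t)"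
    if "t \<in> I" "\<tau> \<in> I" for t \<tau>
  proof -
    have "nrm G (A (\<gamma> \<tau>) (v \<tau>) - A (\<gamma> t) (v t)) \<le> nrm G (A (\<gamma> \<tau>) (v \<tau>) - A (\<gamma> t) (v \<tau>)) + nrm G (A (\<gamma> t) (v \<tau>) - A (\<gamma> t) (v t))"
      by (rule nrm_triangle[OF BG]) (use Ac vc that in auto)
    also have "A (\<gamma> t) (v \<tau>) - A (\<gamma> t) (v t) = A (\<gamma> t) (v \<tau> - v t)"
      using linear_betw_diff[OF BE l] vc that by auto
    also have "nrm G (A (\<gamma> \<tau>) (v \<tau>) - A (\<gamma> t) (v \<tau>)) \<le> op_norm E G (\<lambda>x. A (\<gamma> \<tau>) x - A (\<gamma> t) x) * nrm E (v \<tau>)"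
      by (rule nrm_le_op_norm[OF BE BG bounded_linear_betw_sub[OF BE BG]]) (use bl vc that in auto)
    also have "nrm G (A (\<gamma> t) (v \<tau> - v t)) \<le> op_norm E G (A (\<gamma> t)) * nrm E (v \<tau> - v t)"
      by (rule nrm_le_op_norm[OF BE BG]) (use bl vc that BE in \<open>auto simp: banach_space_closed\<close>)
    finally show ?thesis by simp
  qed
  have opnn: "0 \<le> op_norm E G (\<lambda>x. A (\<gamma> \<tau>) x - A (\<gamma> t) x)" if "t \<in> I" "\<tau> \<in> I" for t \<tau>
  proof -
    have bs: "bounded_linear_betw E G (\<lambda>x. A (\<gamma> \<tau>) x - A (\<gamma> t) x)"
      using bounded_linear_betw_sub[OF BE BG] bl that by auto
    obtain K where K: "\<forall>x\<in>carr E. nrm G (A (\<gamma> \<tau>) x - A (\<gamma> t) x) \<le> K * nrm E x"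
      using bs by (auto simp: bounded_linear_betw_def)
    have "nrm G ((\<lambda>x. A (\<gamma> \<tau>) x - A (\<gamma> t) x) 0) \<le> op_norm E G (\<lambda>x. A (\<gamma> \<tau>) x - A (\<gamma> t) x)"
      unfolding op_norm_def
    proof (rule cSUP_upper)
      show "bdd_above ((\<lambda>x. nrm G (A (\<gamma> \<tau>) x - A (\<gamma> t) x)) ` {x \<in> carr E. nrm E x \<le> 1})"
      proof (rule bdd_aboveI2)
        fix z assume z: "z \<in> {x \<in> carr E. nrm E x \<le> 1}"
        have "nrm G (A (\<gamma> \<tau>) z - A (\<gamma> t) z) \<le> K * nrm E z" using K z by auto
        also have "\<dots> \<le> \<bar>K\<bar> * 1"
          using z nrm_nonneg[OF BE, of z] by (intro mult_mono) auto
        finally show "nrm G (A (\<gamma> \<tau>) z - A (\<gamma> t) z) \<le> \<bar>K\<bar>" by simp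
      qed
    qed (use BE in \<open>auto simp: banach_space_closed nrm_zero\<close>)
    moreover have "(A (\<gamma> \<tau>) 0 - A (\<gamma> t) 0) = 0"
      using linear_betw_zero[OF BE l] that by auto
    ultimately show ?thesis by (simp add: nrm_zero[OF BG])
  qed
  have lim: "((\<lambda>\<tau>. op_norm E G (\<lambda>x. A (\<gamma> \<tau>) x - A (\<gamma> t) x)) \<longlongrightarrow> 0) (at t within I)" if t: "t \<in> I" for t
  proof (rule tendstoI)
    fix e :: real assume "e > 0"
    then obtain V where V: "openin Z V" "\<gamma> t \<in> V" "\<forall>y\<in>V. op_norm E G (\<lambda>x. A y x - A (\<gamma> t) x) < e"
      using A gz[OF t] unfolding continuous_op_def by meson
    have "openin (top_of_set I) {x \<in> I. \<gamma> x \<in> V}"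
      using g V(1) by (auto simp: continuous_map_def)
    then obtain S where S: "open S" "{x \<in> I. \<gamma> x \<in> V} = I \<inter> S" by (auto simp: openin_open)
    then show "\<forall>\<^sub>F \<tau> in at t within I. dist (op_norm E G (\<lambda>x. A (\<gamma> \<tau>) x - A (\<gamma> t) x)) 0 < e"
      unfolding eventually_at_topological using V t opnn[OF t]
      by (intro exI[of _ S]) (auto simp: set_eq_iff)
  qed
  show ?thesis
  proof (rule C_funI[OF BG _ _ est])
    show "A (\<gamma> t) (v t) \<in> carr G" if "t \<in> I" for t using Ac vc that by auto
    show "((\<lambda>\<tau>. op_norm E G (\<lambda>x. A (\<gamma> \<tau>) x - A (\<gamma> t) x) * nrm E (v \<tau>) + op_norm E G (A (\<gamma> t)) * nrm E (v \<tau> - v t)) \<longlongrightarrow> 0) (at t within I)"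
      if t: "t \<in> I" for t
    proof -
      have "((\<lambda>\<tau>. nrm E (v \<tau>)) \<longlongrightarrow> nrm E (v t)) (at t within I)"
        using C_fun_nrm[OF BE v] t by (auto simp: continuous_on_def)
      then have "((\<lambda>\<tau>. op_norm E G (\<lambda>x. A (\<gamma> \<tau>) x - A (\<gamma> t) x) * nrm E (v \<tau>) + op_norm E G (A (\<gamma> t)) * nrm E (v \<tau> - v t)) \<longlongrightarrow>
        0 * nrm E (v t) + op_norm E G (A (\<gamma> t)) * 0) (at t within I)"
        by (intro tendsto_intros lim[OF t] C_funD[OF BE v t])
      then show ?thesis by simp
    qed
  qed auto
qed

lemma C_fun_bounded_linear:
  assumes BE: "banach_space E" and BG: "banach_space G"
    and A: "bounded_linear_betw E G A" and v: "C_fun I E v"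
  shows "C_fun I G (\<lambda>t. A (v t))"
proof -
  have l: "linear_betw E G A" using A by (auto simp: bounded_linear_betw_def)
  note vc = C_fun_carr[OF BE v]
  show ?thesis
  proof (rule C_funI[OF BG])
    show "A (v t) \<in> carr G" if "t \<in> I" for t using l vc that by (auto simp: linear_betw_def)
    show "nrm G (A (v \<tau>) - A (v t)) \<le> op_norm E G A * nrm E (v \<tau> - v t)" if "t \<in> I" "\<tau> \<in> I" for t \<tau>
      using nrm_le_op_norm[OF BE BG A, of "v \<tau> - v t"] linear_betw_diff[OF BE l] vc that BE
      by (simp add: banach_space_closed)
    show "((\<lambda>\<tau>. op_norm E G A * nrm E (v \<tau> - v t)) \<longlongrightarrow> 0) (at t within I)" if "t \<in> I" for t
      using tendsto_mult_left[OF C_funD[OF BE v that], of "op_norm E G A"] by simp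
  qed
qed

lemma continuous_map_graph:
  assumes "C_fun I E u" "I \<subseteq> J"
  shows "continuous_map (top_of_set I) (prod_topology (top_of_set J) (ntopology E)) (\<lambda>t. (t, u t))"
  using assms by (auto simp: continuous_map_pairwise o_def C_fun_def continuous_map_in_subtopology)

section \<open>Differentiation in time\<close>

lemma has_time_deriv_iff:
  assumes B: "banach_space E" and t: "t \<in> I"
  shows "has_time_deriv E I u w t \<longleftrightarrow> w \<in> carr E \<and> (\<forall>\<tau>\<in>I. u \<tau> \<in> carr E) \<and>
    (\<forall>e>0. \<exists>d>0. \<forall>\<tau>\<in>I. \<bar>\<tau> - t\<bar> < d \<longrightarrow> nrm E (u \<tau> - u t - (\<tau> - t) *\<^sub>R w) \<le> e * \<bar>\<tau> - t\<bar>)"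
proof -
  have "((\<lambda>\<tau>. nrm E ((u \<tau> - u t) /\<^sub>R (\<tau> - t) - w)) \<longlongrightarrow> 0) (at t within I) \<longleftrightarrow>
    (\<forall>e>0. \<exists>d>0. \<forall>\<tau>\<in>I. \<bar>\<tau> - t\<bar> < d \<longrightarrow> nrm E (u \<tau> - u t - (\<tau> - t) *\<^sub>R w) \<le> e * \<bar>\<tau> - t\<bar>)"
    if w: "w \<in> carr E" and u: "\<forall>\<tau>\<in>I. u \<tau> \<in> carr E"
  proof -
    define Q where "Q \<tau> = nrm E ((u \<tau> - u t) /\<^sub>R (\<tau> - t) - w)" for \<tau>
    have c: "(u \<tau> - u t) /\<^sub>R (\<tau> - t) - w \<in> carr E" if "\<tau> \<in> I" for \<tau>
      using u w t that by (simp add: banach_space_closed B)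
    have Q0: "Q \<tau> \<ge> 0" if "\<tau> \<in> I" for \<tau>
      unfolding Q_def by (rule nrm_nonneg[OF B c[OF that]])
    have Q: "nrm E (u \<tau> - u t - (\<tau> - t) *\<^sub>R w) = Q \<tau> * \<bar>\<tau> - t\<bar>" if "\<tau> \<in> I" "\<tau> \<noteq> t" for \<tau>
    proof -
      have "u \<tau> - u t - (\<tau> - t) *\<^sub>R w = (\<tau> - t) *\<^sub>R ((u \<tau> - u t) /\<^sub>R (\<tau> - t) - w)"
        using that by (simp add: scaleR_diff_right)
      then show ?thesis unfolding Q_def using nrm_scale[OF B c[OF that(1)]] by (simp add: mult.commute)
    qed
    have z: "nrm E (u t - u t - (t - t) *\<^sub>R w) \<le> e * \<bar>t - t\<bar>" for e
      by (simp add: nrm_zero[OF B])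
    have "(Q \<longlongrightarrow> 0) (at t within I) \<longleftrightarrow>
      (\<forall>e>0. \<exists>d>0. \<forall>\<tau>\<in>I. \<tau> \<noteq> t \<and> \<bar>\<tau> - t\<bar> < d \<longrightarrow> Q \<tau> < e)"
      unfolding tendsto_iff eventually_at using Q0 by (auto simp: dist_real_def)
    also have "\<dots> \<longleftrightarrow> (\<forall>e>0. \<exists>d>0. \<forall>\<tau>\<in>I. \<tau> \<noteq> t \<and> \<bar>\<tau> - t\<bar> < d \<longrightarrow> Q \<tau> \<le> e)"
    proof (intro iffI allI impI)
      fix e :: real assume "\<forall>e>0. \<exists>d>0. \<forall>\<tau>\<in>I. \<tau> \<noteq> t \<and> \<bar>\<tau> - t\<bar> < d \<longrightarrow> Q \<tau> < e" "e > 0"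
      then show "\<exists>d>0. \<forall>\<tau>\<in>I. \<tau> \<noteq> t \<and> \<bar>\<tau> - t\<bar> < d \<longrightarrow> Q \<tau> \<le> e"
        by (meson less_imp_le)
    next
      fix e :: real assume a: "\<forall>e>0. \<exists>d>0. \<forall>\<tau>\<in>I. \<tau> \<noteq> t \<and> \<bar>\<tau> - t\<bar> < d \<longrightarrow> Q \<tau> \<le> e" "e > 0"
      then obtain d where "d > 0" "\<forall>\<tau>\<in>I. \<tau> \<noteq> t \<and> \<bar>\<tau> - t\<bar> < d \<longrightarrow> Q \<tau> \<le> e/2"
        by (metis half_gt_zero)
      with a(2) show "\<exists>d>0. \<forall>\<tau>\<in>I. \<tau> \<noteq> t \<and> \<bar>\<tau> - t\<bar> < d \<longrightarrow> Q \<tau> < e"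
        by (intro exI[of _ d]) fastforce
    qed
    also have "\<dots> \<longleftrightarrow> (\<forall>e>0. \<exists>d>0. \<forall>\<tau>\<in>I. \<bar>\<tau> - t\<bar> < d \<longrightarrow> nrm E (u \<tau> - u t - (\<tau> - t) *\<^sub>R w) \<le> e * \<bar>\<tau> - t\<bar>)"
    proof -
      have "(\<tau> \<noteq> t \<and> \<bar>\<tau> - t\<bar> < d \<longrightarrow> Q \<tau> \<le> e) \<longleftrightarrow>
         (\<bar>\<tau> - t\<bar> < d \<longrightarrow> nrm E (u \<tau> - u t - (\<tau> - t) *\<^sub>R w) \<le> e * \<bar>\<tau> - t\<bar>)" if "\<tau> \<in> I" for \<tau> d e
        using z Q[OF that] by (cases "\<tau> = t") auto
      then show ?thesis by simp
    qed
    finally show ?thesis unfolding Q_def .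
  qed
  then show ?thesis unfolding has_time_deriv_def by blast
qed

lemma has_time_derivD:
  assumes B: "banach_space E" and t: "t \<in> I" and h: "has_time_deriv E I u w t" and e: "e > 0"
  obtains d where "d > 0"
    "\<And>\<tau>. \<tau> \<in> I \<Longrightarrow> \<bar>\<tau> - t\<bar> < d \<Longrightarrow> nrm E (u \<tau> - u t - (\<tau> - t) *\<^sub>R w) \<le> e * \<bar>\<tau> - t\<bar>"
proof -
  from iffD1[OF has_time_deriv_iff[OF B t] h]
  have "\<forall>e>0. \<exists>d>0. \<forall>\<tau>\<in>I. \<bar>\<tau> - t\<bar> < d \<longrightarrow> nrm E (u \<tau> - u t - (\<tau> - t) *\<^sub>R w) \<le> e * \<bar>\<tau> - t\<bar>"
    by (elim conjE)
  then show thesis using e that by blast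
qed

lemma has_time_deriv_carr:
  assumes "has_time_deriv E I u w t"
  shows "w \<in> carr E" "\<tau> \<in> I \<Longrightarrow> u \<tau> \<in> carr E"
  using assms by (auto simp: has_time_deriv_def)

lemma has_time_deriv_unique:
  assumes B: "banach_space E" and "t \<in> {a..b}" "a < b"
    and 1: "has_time_deriv E {a..b} u w t" and 2: "has_time_deriv E {a..b} u w' t"
  shows "w = w'"
proof -
  note c1 = has_time_deriv_carr[OF 1] and c2 = has_time_deriv_carr[OF 2]
  let ?q = "\<lambda>\<tau>. (u \<tau> - u t) /\<^sub>R (\<tau> - t)"
  have "((\<lambda>\<tau>. nrm E (?q \<tau> - w) + nrm E (?q \<tau> - w')) \<longlongrightarrow> 0) (at t within {a..b})"
    using 1 2 unfolding has_time_deriv_def by (intro tendsto_add_zero) auto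
  moreover have "\<forall>\<^sub>F \<tau> in at t within {a..b}. nrm E (w - w') \<le> nrm E (?q \<tau> - w) + nrm E (?q \<tau> - w')"
    unfolding eventually_at_filter
  proof (intro always_eventually allI impI)
    fix \<tau> assume "\<tau> \<in> {a..b}"
    then have q: "?q \<tau> \<in> carr E" using c1(2)[of \<tau>] c1(2)[of t] assms(2) B by (simp add: banach_space_closed)
    show "nrm E (w - w') \<le> nrm E (?q \<tau> - w) + nrm E (?q \<tau> - w')"
      using nrm_triangle[OF B c1(1) q c2(1)] nrm_diff_commute[OF B c1(1) q] by simp
  qed
  ultimately have "nrm E (w - w') \<le> 0"
    using assms(2,3) by (intro tendsto_lowerbound) (auto simp: trivial_limit_within islimpt_Icc)
  then have "nrm E (w - w') = 0" using nrm_nonneg[OF B banach_space_diff[OF B c1(1) c2(1)]] by simp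
  then show ?thesis using nrm_eq_0[OF B banach_space_diff[OF B c1(1) c2(1)]] by simp
qed

lemma time_deriv_eq:
  assumes "banach_space E" "t \<in> {a..b}" "a < b" "has_time_deriv E {a..b} u w t"
  shows "time_deriv E {a..b} u t = w"
  unfolding time_deriv_def using assms has_time_deriv_unique by (intro the_equality) blast+

lemma has_time_deriv_subset:
  assumes "has_time_deriv E I u w t" "J \<subseteq> I"
  shows "has_time_deriv E J u w t"
  using assms unfolding has_time_deriv_def by (auto intro: tendsto_within_subset)

lemma has_time_deriv_cong:
  assumes "has_time_deriv E I u w t" "t \<in> I" "\<And>\<tau>. \<tau> \<in> I \<Longrightarrow> v \<tau> = u \<tau>"
  shows "has_time_deriv E I v w t"
proof -
  have "((\<lambda>\<tau>. nrm E ((v \<tau> - v t) /\<^sub>R (\<tau> - t) - w)) \<longlongrightarrow> 0) (at t within I) \<longleftrightarrow>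
     ((\<lambda>\<tau>. nrm E ((u \<tau> - u t) /\<^sub>R (\<tau> - t) - w)) \<longlongrightarrow> 0) (at t within I)"
    using assms by (intro Lim_cong_within) auto
  then show ?thesis using assms by (auto simp: has_time_deriv_def)
qed

lemma has_time_deriv_Un_closed:
  assumes "has_time_deriv E {a..b} u w t" "has_time_deriv E {b..c} u w t" "a \<le> b" "b \<le> c"
  shows "has_time_deriv E {a..c} u w t"
proof -
  have I: "{a..c} = {a..b} \<union> {b..c}" using assms by auto
  show ?thesis using assms unfolding has_time_deriv_def I by (auto intro: Lim_Un)
qed

text \<open>Away from an interior boundary point only one of the two halves of the interval matters.\<close>

lemma has_time_deriv_extend:
  assumes "has_time_deriv E {a..b} u w t" "t \<in> {a..b}" "t \<noteq> b" "\<And>\<tau>. \<tau> \<in> {b..c} \<Longrightarrow> u \<tau> \<in> carr E" "b \<le> c"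
  shows "has_time_deriv E {a..c} u w t"
proof -
  have I: "{a..c} = {a..b} \<union> {b..c}" using assms by auto
  have "at t within {b..c} = bot" using assms by (simp add: at_within_eq_bot_iff closure_closed)
  then have "((\<lambda>\<tau>. nrm E ((u \<tau> - u t) /\<^sub>R (\<tau> - t) - w)) \<longlongrightarrow> 0) (at t within {a..c})"
    unfolding I using assms(1) by (intro Lim_Un) (auto simp: has_time_deriv_def)
  then show ?thesis using assms unfolding has_time_deriv_def I by auto
qed

lemma has_time_deriv_extend_left:
  assumes "has_time_deriv E {b..c} u w t" "t \<in> {b..c}" "t \<noteq> b" "\<And>\<tau>. \<tau> \<in> {a..b} \<Longrightarrow> u \<tau> \<in> carr E" "a \<le> b"
  shows "has_time_deriv E {a..c} u w t"
proof -
  have I: "{a..c} = {a..b} \<union> {b..c}" using assms by auto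
  have "at t within {a..b} = bot" using assms by (simp add: at_within_eq_bot_iff closure_closed)
  then have "((\<lambda>\<tau>. nrm E ((u \<tau> - u t) /\<^sub>R (\<tau> - t) - w)) \<longlongrightarrow> 0) (at t within {a..c})"
    unfolding I using assms(1) by (intro Lim_Un) (auto simp: has_time_deriv_def)
  then show ?thesis using assms unfolding has_time_deriv_def I by auto
qed

lemma has_time_deriv_embeds:
  assumes BE: "banach_space E" and BG: "banach_space G" and "embeds E G" "t \<in> I" "has_time_deriv E I u w t"
  shows "has_time_deriv G I u w t"
proof -
  note c = has_time_deriv_carr[OF assms(5)]
  have le: "nrm G (u \<tau> - u t - (\<tau> - t) *\<^sub>R w) \<le> nrm E (u \<tau> - u t - (\<tau> - t) *\<^sub>R w)" if "\<tau> \<in> I" for \<tau>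
    using assms(3,4) c that BE by (auto simp: embeds_def banach_space_closed)
  show ?thesis
    unfolding has_time_deriv_iff[OF BG assms(4)]
  proof (intro conjI ballI allI impI)
    fix e :: real assume "e > 0"
    then obtain d where "d > 0" "\<And>\<tau>. \<tau> \<in> I \<Longrightarrow> \<bar>\<tau> - t\<bar> < d \<Longrightarrow> nrm E (u \<tau> - u t - (\<tau> - t) *\<^sub>R w) \<le> e * \<bar>\<tau> - t\<bar>"
      using has_time_derivD[OF BE assms(4,5)] by metis
    then show "\<exists>d>0. \<forall>\<tau>\<in>I. \<bar>\<tau> - t\<bar> < d \<longrightarrow> nrm G (u \<tau> - u t - (\<tau> - t) *\<^sub>R w) \<le> e * \<bar>\<tau> - t\<bar>"
      using le by (intro exI[of _ d]) (auto intro: order_trans)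
  qed (use c assms(3) in \<open>auto simp: embeds_def\<close>)
qed

lemma has_time_deriv_add:
  assumes B: "banach_space E" and t: "t \<in> I" and 1: "has_time_deriv E I u w t" and 2: "has_time_deriv E I v z t"
  shows "has_time_deriv E I (\<lambda>\<tau>. u \<tau> + v \<tau>) (w + z) t"
  unfolding has_time_deriv_iff[OF B t]
proof (intro conjI ballI allI impI)
  note c1 = has_time_deriv_carr[OF 1] and c2 = has_time_deriv_carr[OF 2]
  show "w + z \<in> carr E" using c1 c2 B by (simp add: banach_space_closed)
  show "u \<tau> + v \<tau> \<in> carr E" if "\<tau> \<in> I" for \<tau> using c1 c2 B that by (simp add: banach_space_closed)
  fix e :: real assume "e > 0"
  then have e2: "e/2 > 0" by simp
  obtain d1 where d1: "d1 > 0" "\<And>\<tau>. \<tau> \<in> I \<Longrightarrow> \<bar>\<tau> - t\<bar> < d1 \<Longrightarrow> nrm E (u \<tau> - u t - (\<tau> - t) *\<^sub>R w) \<le> e/2 * \<bar>\<tau> - t\<bar>"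
    using has_time_derivD[OF B t 1 e2] by metis
  obtain d2 where d2: "d2 > 0" "\<And>\<tau>. \<tau> \<in> I \<Longrightarrow> \<bar>\<tau> - t\<bar> < d2 \<Longrightarrow> nrm E (v \<tau> - v t - (\<tau> - t) *\<^sub>R z) \<le> e/2 * \<bar>\<tau> - t\<bar>"
    using has_time_derivD[OF B t 2 e2] by metis
  note d = d1 d2
  show "\<exists>d>0. \<forall>\<tau>\<in>I. \<bar>\<tau> - t\<bar> < d \<longrightarrow> nrm E (u \<tau> + v \<tau> - (u t + v t) - (\<tau> - t) *\<^sub>R (w + z)) \<le> e * \<bar>\<tau> - t\<bar>"
  proof (intro exI[of _ "min d1 d2"] conjI ballI impI)
    fix \<tau> assume \<tau>: "\<tau> \<in> I" "\<bar>\<tau> - t\<bar> < min d1 d2"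
    have eq: "u \<tau> + v \<tau> - (u t + v t) - (\<tau> - t) *\<^sub>R (w + z) =
      (u \<tau> - u t - (\<tau> - t) *\<^sub>R w) + (v \<tau> - v t - (\<tau> - t) *\<^sub>R z)" by (simp add: algebra_simps)
    have "nrm E (u \<tau> + v \<tau> - (u t + v t) - (\<tau> - t) *\<^sub>R (w + z)) \<le> nrm E (u \<tau> - u t - (\<tau> - t) *\<^sub>R w) + nrm E (v \<tau> - v t - (\<tau> - t) *\<^sub>R z)"
      unfolding eq using c1 c2 t \<tau> B by (intro nrm_add) (auto simp: banach_space_closed)
    moreover have "nrm E (u \<tau> - u t - (\<tau> - t) *\<^sub>R w) \<le> e/2 * \<bar>\<tau> - t\<bar>" "nrm E (v \<tau> - v t - (\<tau> - t) *\<^sub>R z) \<le> e/2 * \<bar>\<tau> - t\<bar>"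
      using d \<tau> by auto
    ultimately show "nrm E (u \<tau> + v \<tau> - (u t + v t) - (\<tau> - t) *\<^sub>R (w + z)) \<le> e * \<bar>\<tau> - t\<bar>" by linarith
  qed (use d in auto)
qed

lemma has_time_deriv_bounded_linear:
  assumes BE: "banach_space E" and BG: "banach_space G" and t: "t \<in> I" and u: "has_time_deriv E I u w t"
    and A: "bounded_linear_betw E G A"
  shows "has_time_deriv G I (\<lambda>\<tau>. A (u \<tau>)) (A w) t"
proof -
  note c = has_time_deriv_carr[OF u]
  have l: "linear_betw E G A" using A by (auto simp: bounded_linear_betw_def)
  let ?q = "\<lambda>\<tau>. (u \<tau> - u t) /\<^sub>R (\<tau> - t) - w"
  have qc: "?q \<tau> \<in> carr E" if "\<tau> \<in> I" for \<tau> using c t BE that by (simp add: banach_space_closed)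
  have Aq: "(A (u \<tau>) - A (u t)) /\<^sub>R (\<tau> - t) - A w = A (?q \<tau>)" if "\<tau> \<in> I" for \<tau>
  proof -
    have "A (?q \<tau>) = A ((u \<tau> - u t) /\<^sub>R (\<tau> - t)) - A w"
      using c t BE that by (intro linear_betw_diff[OF BE l]) (simp_all add: banach_space_closed)
    also have "A ((u \<tau> - u t) /\<^sub>R (\<tau> - t)) = A (u \<tau> - u t) /\<^sub>R (\<tau> - t)"
      using l c t BE that by (simp add: linear_betw_def banach_space_closed)
    also have "A (u \<tau> - u t) = A (u \<tau>) - A (u t)"
      using c t BE that by (intro linear_betw_diff[OF BE l]) (simp_all add: banach_space_closed)
    finally show ?thesis by simp
  qed
  have "((\<lambda>\<tau>. op_norm E G A * nrm E (?q \<tau>)) \<longlongrightarrow> op_norm E G A * 0) (at t within I)"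
    using u unfolding has_time_deriv_def by (intro tendsto_intros) auto
  then have "((\<lambda>\<tau>. op_norm E G A * nrm E (?q \<tau>)) \<longlongrightarrow> 0) (at t within I)" by simp
  then have "((\<lambda>\<tau>. nrm G ((A (u \<tau>) - A (u t)) /\<^sub>R (\<tau> - t) - A w)) \<longlongrightarrow> 0) (at t within I)"
  proof (rule Lim_null_comparison[rotated])
    have "norm (nrm G ((A (u \<tau>) - A (u t)) /\<^sub>R (\<tau> - t) - A w)) \<le> op_norm E G A * nrm E (?q \<tau>)" if "\<tau> \<in> I" for \<tau>
      unfolding Aq[OF that] using nrm_le_op_norm[OF BE BG A qc[OF that]] nrm_nonneg[OF BG, of "A (?q \<tau>)"]
        l qc[OF that] by (simp add: linear_betw_def)
    then show "\<forall>\<^sub>F \<tau> in at t within I. norm (nrm G ((A (u \<tau>) - A (u t)) /\<^sub>R (\<tau> - t) - A w)) \<le> op_norm E G A * nrm E (?q \<tau>)"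
      unfolding eventually_at_filter by (intro always_eventually) auto
  qed
  then show ?thesis using l c by (auto simp: has_time_deriv_def linear_betw_def)
qed

lemma bounded_linear_betw_scale: "banach_space E \<Longrightarrow> bounded_linear_betw E E (\<lambda>x. c *\<^sub>R x)"
  unfolding bounded_linear_betw_def linear_betw_def
  by (auto simp: banach_space_closed algebra_simps nrm_scale intro!: exI[of _ "\<bar>c\<bar>"])

lemma has_time_deriv_scale:
  assumes "banach_space E" "t \<in> I" "has_time_deriv E I u w t"
  shows "has_time_deriv E I (\<lambda>\<tau>. c *\<^sub>R u \<tau>) (c *\<^sub>R w) t"
  using has_time_deriv_bounded_linear[OF assms(1,1,2,3) bounded_linear_betw_scale[OF assms(1)]] .

lemma has_time_deriv_diff:
  assumes "banach_space E" "t \<in> I" "has_time_deriv E I u w t" "has_time_deriv E I v z t"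
  shows "has_time_deriv E I (\<lambda>\<tau>. u \<tau> - v \<tau>) (w - z) t"
  using has_time_deriv_add[OF assms(1-3) has_time_deriv_scale[OF assms(1,2,4), of "-1"]] by simp

lemma has_time_deriv_line:
  assumes "banach_space E" "t \<in> I" "p \<in> carr E"
  shows "has_time_deriv E I (\<lambda>\<tau>. \<tau> *\<^sub>R p) p t"
  unfolding has_time_deriv_iff[OF assms(1,2)] using assms
  by (auto simp: banach_space_closed scaleR_diff_left nrm_zero intro: exI[of _ 1])

lemma has_time_deriv_compose:
  assumes B: "banach_space E" and t: "t \<in> J" and u: "has_time_deriv E I u w (\<alpha> t)"
    and a: "(\<alpha> has_real_derivative a) (at t within J)" and im: "\<alpha> ` J \<subseteq> I"
  shows "has_time_deriv E J (\<lambda>\<tau>. u (\<alpha> \<tau>)) (a *\<^sub>R w) t"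
  unfolding has_time_deriv_iff[OF B t]
proof (intro conjI ballI allI impI)
  note c = has_time_deriv_carr[OF u]
  have t': "\<alpha> t \<in> I" using im t by auto
  have cI: "u (\<alpha> \<tau>) \<in> carr E" if "\<tau> \<in> J" for \<tau> using c(2) im that by auto
  show "a *\<^sub>R w \<in> carr E" using c B by (simp add: banach_space_closed)
  show "u (\<alpha> \<tau>) \<in> carr E" if "\<tau> \<in> J" for \<tau> using cI that .
  fix e :: real assume e: "e > 0"
  define W where "W = nrm E w"
  have W: "W \<ge> 0" unfolding W_def using c B by (simp add: nrm_nonneg)
  define e1 where "e1 = e / (2 * (\<bar>a\<bar> + 1))"
  have e1: "e1 > 0" unfolding e1_def using e by (simp add: add_pos_nonneg)
  obtain d1 where d1: "d1 > 0" "\<And>\<tau>. \<tau> \<in> I \<Longrightarrow> \<bar>\<tau> - \<alpha> t\<bar> < d1 \<Longrightarrow> nrm E (u \<tau> - u (\<alpha> t) - (\<tau> - \<alpha> t) *\<^sub>R w) \<le> e1 * \<bar>\<tau> - \<alpha> t\<bar>"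
    using has_time_derivD[OF B t' u e1] by metis
  define e2 where "e2 = min 1 (e / (2 * (W + 1)))"
  have e2: "e2 > 0" unfolding e2_def using e W by (simp add: add_nonneg_pos)
  have "(*) a = (\<lambda>x. x * a)" by (auto simp: mult.commute)
  then have "(\<alpha> has_derivative (\<lambda>x. x * a)) (at t within J)"
    using a unfolding has_field_derivative_def by simp
  then obtain d2 where d2: "d2 > 0" "\<forall>\<tau>\<in>J. \<bar>\<tau> - t\<bar> < d2 \<longrightarrow> \<bar>\<alpha> \<tau> - \<alpha> t - (\<tau> - t) * a\<bar> \<le> e2 * \<bar>\<tau> - t\<bar>"
    using e2 unfolding has_derivative_within_alt by auto
  define d where "d = min d2 (d1 / (\<bar>a\<bar> + 1))"
  have d: "d > 0" unfolding d_def using d1 d2 by (simp add: add_nonneg_pos)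
  show "\<exists>d>0. \<forall>\<tau>\<in>J. \<bar>\<tau> - t\<bar> < d \<longrightarrow> nrm E (u (\<alpha> \<tau>) - u (\<alpha> t) - (\<tau> - t) *\<^sub>R a *\<^sub>R w) \<le> e * \<bar>\<tau> - t\<bar>"
  proof (intro exI[of _ d] conjI ballI impI d)
    fix \<tau> assume \<tau>: "\<tau> \<in> J" "\<bar>\<tau> - t\<bar> < d"
    have 1: "\<bar>\<alpha> \<tau> - \<alpha> t - (\<tau> - t) * a\<bar> \<le> e2 * \<bar>\<tau> - t\<bar>" using d2 \<tau> by (auto simp: d_def)
    also have "\<dots> \<le> 1 * \<bar>\<tau> - t\<bar>" unfolding e2_def by (intro mult_right_mono) auto
    finally have "\<bar>\<alpha> \<tau> - \<alpha> t\<bar> \<le> \<bar>\<tau> - t\<bar> + \<bar>(\<tau> - t) * a\<bar>"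
      using abs_triangle_ineq2[of "\<alpha> \<tau> - \<alpha> t" "(\<tau> - t) * a"] by simp
    then have 2: "\<bar>\<alpha> \<tau> - \<alpha> t\<bar> \<le> (\<bar>a\<bar> + 1) * \<bar>\<tau> - t\<bar>"
      by (simp add: abs_mult distrib_left distrib_right mult.commute add.commute)
    also have "\<dots> < (\<bar>a\<bar> + 1) * (d1 / (\<bar>a\<bar> + 1))" using \<tau> unfolding d_def by (intro mult_strict_left_mono) auto
    also have "\<dots> = d1" by (simp add: add_nonneg_eq_0_iff)
    finally have "nrm E (u (\<alpha> \<tau>) - u (\<alpha> t) - (\<alpha> \<tau> - \<alpha> t) *\<^sub>R w) \<le> e1 * \<bar>\<alpha> \<tau> - \<alpha> t\<bar>"
      using d1 im \<tau> by auto
    also have "\<dots> \<le> e1 * ((\<bar>a\<bar> + 1) * \<bar>\<tau> - t\<bar>)" using 2 e1 by (intro mult_left_mono) auto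
    also have "\<dots> = e/2 * \<bar>\<tau> - t\<bar>" unfolding e1_def by (simp add: field_simps add_nonneg_eq_0_iff)
    finally have 3: "nrm E (u (\<alpha> \<tau>) - u (\<alpha> t) - (\<alpha> \<tau> - \<alpha> t) *\<^sub>R w) \<le> e/2 * \<bar>\<tau> - t\<bar>" .
    have "nrm E ((\<alpha> \<tau> - \<alpha> t - (\<tau> - t) * a) *\<^sub>R w) = \<bar>\<alpha> \<tau> - \<alpha> t - (\<tau> - t) * a\<bar> * W"
      unfolding W_def using nrm_scale[OF B c(1)] .
    also have "\<dots> \<le> (e2 * \<bar>\<tau> - t\<bar>) * W" using 1 W by (intro mult_right_mono) auto
    also have "\<dots> \<le> (e / (2 * (W + 1)) * \<bar>\<tau> - t\<bar>) * (W + 1)" unfolding e2_def using W e by (intro mult_mono) auto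
    also have "\<dots> = e/2 * \<bar>\<tau> - t\<bar>" using W by (simp add: field_simps)
    finally have 4: "nrm E ((\<alpha> \<tau> - \<alpha> t - (\<tau> - t) * a) *\<^sub>R w) \<le> e/2 * \<bar>\<tau> - t\<bar>" .
    have eq: "u (\<alpha> \<tau>) - u (\<alpha> t) - (\<tau> - t) *\<^sub>R a *\<^sub>R w =
       (u (\<alpha> \<tau>) - u (\<alpha> t) - (\<alpha> \<tau> - \<alpha> t) *\<^sub>R w) + (\<alpha> \<tau> - \<alpha> t - (\<tau> - t) * a) *\<^sub>R w" by (simp add: algebra_simps)
    have "nrm E (u (\<alpha> \<tau>) - u (\<alpha> t) - (\<tau> - t) *\<^sub>R a *\<^sub>R w) \<le> nrm E (u (\<alpha> \<tau>) - u (\<alpha> t) - (\<alpha> \<tau> - \<alpha> t) *\<^sub>R w) + nrm E ((\<alpha> \<tau> - \<alpha> t - (\<tau> - t) * a) *\<^sub>R w)"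
      unfolding eq using cI[OF \<tau>(1)] cI[OF t] c B by (intro nrm_add) (auto simp: banach_space_closed)
    then show "nrm E (u (\<alpha> \<tau>) - u (\<alpha> t) - (\<tau> - t) *\<^sub>R a *\<^sub>R w) \<le> e * \<bar>\<tau> - t\<bar>" using 3 4 by simp
  qed
qed

text \<open>The mean value inequality, by bisection.\<close>

lemma nrm_deriv_bound:
  assumes B: "banach_space E" and ab: "a \<le> b"
    and der: "\<And>t. t \<in> {a..b} \<Longrightarrow> has_time_deriv E {a..b} \<phi> (w t) t"
    and bd: "\<And>t. t \<in> {a..b} \<Longrightarrow> nrm E (w t) \<le> K"
  shows "nrm E (\<phi> b - \<phi> a) \<le> K * (b - a)"
proof -
  have c: "\<phi> t \<in> carr E" if "t \<in> {a..b}" for t using has_time_deriv_carr(2)[OF der[OF that] that] .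
  have wc: "w t \<in> carr E" if "t \<in> {a..b}" for t using has_time_deriv_carr(1)[OF der[OF that]] .
  have main: "nrm E (\<phi> b - \<phi> a) \<le> (K + e) * (b - a)" if e: "e > 0" for e
  proof -
    define Q where "Q x y \<longleftrightarrow> (a \<le> x \<and> x \<le> y \<and> y \<le> b \<longrightarrow> nrm E (\<phi> y - \<phi> x) \<le> (K + e) * (y - x))" for x y
    have "Q a b"
      using ab
    proof (induction rule: Bolzano)
      case (trans x y z)
      show ?case unfolding Q_def
      proof
        assume r: "a \<le> x \<and> x \<le> z \<and> z \<le> b"
        have "nrm E (\<phi> z - \<phi> x) \<le> nrm E (\<phi> z - \<phi> y) + nrm E (\<phi> y - \<phi> x)"
          using r trans by (intro nrm_triangle B c) auto
        also have "\<dots> \<le> (K + e) * (z - y) + (K + e) * (y - x)"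
          using trans r unfolding Q_def by (intro add_mono) auto
        finally show "nrm E (\<phi> z - \<phi> x) \<le> (K + e) * (z - x)" by (simp add: algebra_simps)
      qed
    next
      case (local x)
      then have x: "x \<in> {a..b}" by auto
      obtain d where d: "d > 0" "\<And>\<tau>. \<tau> \<in> {a..b} \<Longrightarrow> \<bar>\<tau> - x\<bar> < d \<Longrightarrow> nrm E (\<phi> \<tau> - \<phi> x - (\<tau> - x) *\<^sub>R w x) \<le> e * \<bar>\<tau> - x\<bar>"
        using has_time_derivD[OF B x der[OF x] e] by metis
      have est: "nrm E (\<phi> \<tau> - \<phi> x) \<le> (K + e) * \<bar>\<tau> - x\<bar>" if "\<tau> \<in> {a..b}" "\<bar>\<tau> - x\<bar> < d" for \<tau>
      proof -
        have "nrm E (\<phi> \<tau> - \<phi> x) \<le> nrm E ((\<tau> - x) *\<^sub>R w x) + nrm E (\<phi> \<tau> - \<phi> x - (\<tau> - x) *\<^sub>R w x)"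
          using c[OF that(1)] c[OF x] wc[OF x] B by (intro nrm_le_add_diff) (auto simp: banach_space_closed)
        also have "\<dots> \<le> \<bar>\<tau> - x\<bar> * K + e * \<bar>\<tau> - x\<bar>"
          using d that bd[OF x] nrm_scale[OF B wc[OF x], of "\<tau> - x"] by (intro add_mono) (auto intro!: mult_left_mono)
        finally show ?thesis by (simp add: algebra_simps)
      qed
      show ?case
      proof (intro exI[of _ d] conjI allI impI d(1))
        fix p q assume pq: "p \<le> x \<and> x \<le> q \<and> q - p < d"
        show "Q p q" unfolding Q_def
        proof
          assume r: "a \<le> p \<and> p \<le> q \<and> q \<le> b"
          have "nrm E (\<phi> q - \<phi> p) \<le> nrm E (\<phi> q - \<phi> x) + nrm E (\<phi> x - \<phi> p)"
            using r pq x by (intro nrm_triangle B c) auto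
          also have "nrm E (\<phi> x - \<phi> p) = nrm E (\<phi> p - \<phi> x)"
            using r pq x by (intro nrm_diff_commute B c) auto
          also have "nrm E (\<phi> q - \<phi> x) + nrm E (\<phi> p - \<phi> x) \<le> (K + e) * \<bar>q - x\<bar> + (K + e) * \<bar>p - x\<bar>"
            using r pq x by (intro add_mono est) auto
          also have "\<dots> = (K + e) * (q - p)" using pq by (simp add: algebra_simps)
          finally show "nrm E (\<phi> q - \<phi> p) \<le> (K + e) * (q - p)" .
        qed
      qed
    qed
    then show ?thesis using ab by (auto simp: Q_def)
  qed
  show ?thesis
  proof (cases "a = b")
    case True
    then show ?thesis by (simp add: nrm_zero[OF B])
  next
    case False
    show ?thesis
    proof (rule field_le_epsilon)
      fix e :: real assume "e > 0"
      then have "nrm E (\<phi> b - \<phi> a) \<le> (K + e / (b - a)) * (b - a)" using False ab by (intro main) auto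
      also have "\<dots> = K * (b - a) + e" using False by (simp add: field_simps)
      finally show "nrm E (\<phi> b - \<phi> a) \<le> K * (b - a) + e" .
    qed
  qed
qed

section \<open>Limits\<close>

lemma uniform_limit_C_fun:
  assumes B: "banach_space E" and u: "\<And>k::nat. C_fun I E (u k)" and v: "\<And>t. t \<in> I \<Longrightarrow> v t \<in> carr E"
    and e: "\<And>k t. t \<in> I \<Longrightarrow> nrm E (v t - u k t) \<le> e k" and "e \<longlonglongrightarrow> 0"
  shows "C_fun I E v"
  unfolding C_fun_iff[OF B]
proof (intro conjI ballI)
  show "v t \<in> carr E" if "t \<in> I" for t using v that .
  fix t assume t: "t \<in> I"
  note uc = C_fun_carr[OF B u]
  show "((\<lambda>\<tau>. nrm E (v \<tau> - v t)) \<longlongrightarrow> 0) (at t within I)"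
  proof (rule tendstoI)
    fix r :: real assume r: "r > 0"
    then obtain k where k: "e k < r/3"
      using order_tendstoD(2)[OF assms(5), of "r/3"] by (auto simp: eventually_sequentially)
    have "\<forall>\<^sub>F \<tau> in at t within I. nrm E (u k \<tau> - u k t) < r/3"
      using order_tendstoD(2)[OF C_funD[OF B u t], of "r/3"] r by simp
    then show "\<forall>\<^sub>F \<tau> in at t within I. dist (nrm E (v \<tau> - v t)) 0 < r"
      unfolding eventually_at_filter
    proof (eventually_elim, intro impI)
      fix \<tau> assume *: "\<tau> \<noteq> t \<longrightarrow> \<tau> \<in> I \<longrightarrow> nrm E (u k \<tau> - u k t) < r/3" and 1: "\<tau> \<noteq> t" "\<tau> \<in> I"
      have "nrm E (v \<tau> - v t) \<le> nrm E (v \<tau> - u k \<tau>) + nrm E (u k \<tau> - v t)"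
        using 1 t v uc B by (intro nrm_triangle) auto
      also have "nrm E (u k \<tau> - v t) \<le> nrm E (u k \<tau> - u k t) + nrm E (u k t - v t)"
        using 1 t v uc B by (intro nrm_triangle) auto
      also have "nrm E (u k t - v t) = nrm E (v t - u k t)"
        using 1 t v uc B by (intro nrm_diff_commute) auto
      finally have "nrm E (v \<tau> - v t) < r" using e[OF t, of k] e[OF 1(2), of k] k * 1 by linarith
      moreover have "nrm E (v \<tau> - v t) \<ge> 0" using 1 t v B by (intro nrm_nonneg banach_space_diff) auto
      ultimately show "dist (nrm E (v \<tau> - v t)) 0 < r" by simp
    qed
  qed
qed

lemma uniform_limit_exists:
  assumes B: "banach_space E" and u: "\<And>k::nat. C_fun I E (u k)"
    and c: "\<And>k t. t \<in> I \<Longrightarrow> nrm E (u (Suc k) t - u k t) \<le> c k" and sc: "summable c" and c0: "\<And>k. c k \<ge> 0"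
  shows "\<exists>v. C_fun I E v \<and> (\<forall>k. \<forall>t\<in>I. nrm E (v t - u k t) \<le> (\<Sum>j. c (j + k)))"
proof -
  interpret M: Metric_space "carr E" "ndist E" using B by (rule Metric_space_ndist)
  note uc = C_fun_carr[OF B u]
  define e where "e k = (\<Sum>j. c (j + k))" for k
  have e0: "e \<longlonglongrightarrow> 0" unfolding e_def using suminf_exist_split2[OF sc] .
  have sk: "summable (\<lambda>j. c (j + k))" for k using sc by (subst summable_iff_shift)
  have part: "nrm E (u (k + n) t - u k t) \<le> (\<Sum>j<n. c (j + k))" if "t \<in> I" for n k t
  proof (induction n)
    case 0 show ?case by (simp add: nrm_zero[OF B])
  next
    case (Suc n)
    have "nrm E (u (k + Suc n) t - u k t) \<le> nrm E (u (Suc (k + n)) t - u (k + n) t) + nrm E (u (k + n) t - u k t)"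
      using that uc B by (simp, intro nrm_triangle) auto
    also have "\<dots> \<le> c (k + n) + (\<Sum>j<n. c (j + k))" using c[OF that] Suc by (intro add_mono) auto
    finally show ?case by (simp add: add.commute)
  qed
  have tail: "nrm E (u n t - u k t) \<le> e k" if "t \<in> I" "k \<le> n" for n k t
  proof -
    have "nrm E (u (k + (n - k)) t - u k t) \<le> (\<Sum>j<n-k. c (j + k))" using part that by blast
    also have "\<dots> \<le> e k" unfolding e_def using sk c0 by (intro sum_le_suminf) auto
    finally show ?thesis using that by simp
  qed
  have "\<exists>x. limitin M.mtopology (\<lambda>k. u k t) x sequentially" if t: "t \<in> I" for t
  proof -
    have "M.MCauchy (\<lambda>k. u k t)"
      unfolding M.MCauchy_def
    proof (intro conjI allI impI)
      show "range (\<lambda>k. u k t) \<subseteq> carr E" using uc t by auto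
      fix r :: real assume "r > 0"
      then obtain N where N: "e N < r/2"
        using order_tendstoD(2)[OF e0, of "r/2"] by (auto simp: eventually_sequentially)
      show "\<exists>N. \<forall>n n'. N \<le> n \<longrightarrow> N \<le> n' \<longrightarrow> ndist E (u n t) (u n' t) < r"
      proof (intro exI[of _ N] allI impI)
        fix n n' assume n: "N \<le> n" "N \<le> n'"
        have "nrm E (u n t - u n' t) \<le> nrm E (u n t - u N t) + nrm E (u N t - u n' t)"
          using t uc B by (intro nrm_triangle) auto
        also have "nrm E (u N t - u n' t) = nrm E (u n' t - u N t)"
          using t uc B by (intro nrm_diff_commute) auto
        finally show "ndist E (u n t) (u n' t) < r"
          using tail[OF t n(1)] tail[OF t n(2)] N uc[OF t] by (simp add: ndist_def)
      qed
    qed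
    then show ?thesis using B by (simp add: banach_space_def M.mcomplete_def)
  qed
  then obtain v where v: "\<And>t. t \<in> I \<Longrightarrow> limitin M.mtopology (\<lambda>k. u k t) (v t) sequentially"
    by metis
  have vc: "v t \<in> carr E" if "t \<in> I" for t using v[OF that] by (simp add: M.limitin_metric)
  have ve: "nrm E (v t - u k t) \<le> e k" if t: "t \<in> I" for t k
  proof (rule field_le_epsilon)
    fix r :: real assume "r > 0"
    then have "\<forall>\<^sub>F n in sequentially. ndist E (u n t) (v t) < r"
      using v[OF t] by (auto simp: M.limitin_metric elim!: allE[of _ r] eventually_mono)
    then obtain N where N: "\<forall>n\<ge>N. ndist E (u n t) (v t) < r" by (auto simp: eventually_sequentially)
    define n where "n = max N k"
    have "nrm E (v t - u k t) \<le> nrm E (v t - u n t) + nrm E (u n t - u k t)"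
      using t vc uc B by (intro nrm_triangle) auto
    also have "nrm E (v t - u n t) = nrm E (u n t - v t)"
      using t vc uc B by (intro nrm_diff_commute) auto
    also have "\<dots> < r" using N uc[OF t] vc[OF t] unfolding ndist_def n_def by (metis max.cobounded1)
    finally show "nrm E (v t - u k t) \<le> e k + r" using tail[OF t, of k n] by (simp add: n_def)
  qed
  have "C_fun I E v" using uniform_limit_C_fun[OF B u vc ve e0] .
  then show ?thesis using ve unfolding e_def by blast
qed

lemma uniform_limit_deriv:
  assumes B: "banach_space E" and t: "t \<in> {a..b}"
    and der: "\<And>k t. t \<in> {a..b} \<Longrightarrow> has_time_deriv E {a..b} (u k) (w k t) t"
    and v: "\<And>t. t \<in> {a..b} \<Longrightarrow> v t \<in> carr E" and z: "C_fun {a..b} E z"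
    and e1: "\<And>k t. t \<in> {a..b} \<Longrightarrow> nrm E (v t - u k t) \<le> e k"
    and e2: "\<And>k t. t \<in> {a..b} \<Longrightarrow> nrm E (z t - w k t) \<le> e k" and e0: "e \<longlonglongrightarrow> (0::real)"
  shows "has_time_deriv E {a..b} v (z t) t"
  unfolding has_time_deriv_iff[OF B t]
proof (intro conjI ballI allI impI)
  note zc = C_fun_carr[OF B z]
  have uc: "u k \<tau> \<in> carr E" if "\<tau> \<in> {a..b}" for k \<tau> using has_time_deriv_carr(2)[OF der[OF that] that] .
  have wc: "w k \<tau> \<in> carr E" if "\<tau> \<in> {a..b}" for k \<tau> using has_time_deriv_carr(1)[OF der[OF that]] .
  show "z t \<in> carr E" using zc t .
  show "v \<tau> \<in> carr E" if "\<tau> \<in> {a..b}" for \<tau> using v that .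
  fix r :: real assume r: "r > 0"
  have "\<forall>\<^sub>F \<tau> in at t within {a..b}. nrm E (z \<tau> - z t) < r/2"
    using order_tendstoD(2)[OF C_funD[OF B z t], of "r/2"] r by simp
  then obtain d where d: "d > 0" "\<forall>\<tau>\<in>{a..b}. \<tau> \<noteq> t \<and> dist \<tau> t < d \<longrightarrow> nrm E (z \<tau> - z t) < r/2"
    unfolding eventually_at by auto
  then have d': "nrm E (z \<tau> - z t) \<le> r/2" if "\<tau> \<in> {a..b}" "\<bar>\<tau> - t\<bar> < d" for \<tau>
    using that r by (cases "\<tau> = t") (auto simp: nrm_zero[OF B] dist_real_def less_imp_le)
  show "\<exists>d>0. \<forall>\<tau>\<in>{a..b}. \<bar>\<tau> - t\<bar> < d \<longrightarrow> nrm E (v \<tau> - v t - (\<tau> - t) *\<^sub>R z t) \<le> r * \<bar>\<tau> - t\<bar>"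
  proof (intro exI[of _ d] conjI ballI impI d(1))
    fix \<tau> assume \<tau>: "\<tau> \<in> {a..b}" "\<bar>\<tau> - t\<bar> < d"
    have step: "nrm E (v \<tau> - v t - (\<tau> - t) *\<^sub>R z t) \<le> r/2 * \<bar>\<tau> - t\<bar> + (2 + 2 * \<bar>\<tau> - t\<bar>) * e k" for k
    proof -
      \<comment> \<open>the deviation of \<open>u k\<close> from a line with the slope that the limit should have\<close>
      define \<phi> where "\<phi> x = u k x - x *\<^sub>R z t" for x
      let ?S = "{min t \<tau>..max t \<tau>}"
      have S: "?S \<subseteq> {a..b}" using t \<tau> by auto
      have "nrm E (\<phi> (max t \<tau>) - \<phi> (min t \<tau>)) \<le> (r/2 + e k) * (max t \<tau> - min t \<tau>)"
      proof (rule nrm_deriv_bound[OF B])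
        fix x assume x: "x \<in> ?S"
        have x': "x \<in> {a..b}" "\<bar>x - t\<bar> < d" using S x \<tau> by (auto simp: min_def max_def split: if_splits)
        show "has_time_deriv E ?S \<phi> (w k x - z t) x"
          unfolding \<phi>_def by (intro has_time_deriv_diff has_time_deriv_line B x zc t)
            (rule has_time_deriv_subset[OF der[OF x'(1)] S])
        have "nrm E (w k x - z t) \<le> nrm E (w k x - z x) + nrm E (z x - z t)"
          using x' t zc wc B by (intro nrm_triangle) auto
        moreover have "nrm E (w k x - z x) = nrm E (z x - w k x)"
          using x' t zc wc B by (intro nrm_diff_commute) auto
        ultimately show "nrm E (w k x - z t) \<le> r/2 + e k"
          using d'[OF x'] e2[OF x'(1), of k] by linarith
      qed auto
      also have "nrm E (\<phi> (max t \<tau>) - \<phi> (min t \<tau>)) = nrm E (\<phi> \<tau> - \<phi> t)"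
      proof (cases "t \<le> \<tau>")
        case False
        have "nrm E (\<phi> t - \<phi> \<tau>) = nrm E (\<phi> \<tau> - \<phi> t)"
          unfolding \<phi>_def using \<tau> t uc zc B by (intro nrm_diff_commute banach_space_closed) auto
        then show ?thesis using False by (simp add: max_def min_def)
      qed (auto simp: max_def min_def)
      also have "max t \<tau> - min t \<tau> = \<bar>\<tau> - t\<bar>" by (auto simp: max_def min_def)
      also have "\<phi> \<tau> - \<phi> t = u k \<tau> - u k t - (\<tau> - t) *\<^sub>R z t" unfolding \<phi>_def by (simp add: algebra_simps)
      finally have 1: "nrm E (u k \<tau> - u k t - (\<tau> - t) *\<^sub>R z t) \<le> (r/2 + e k) * \<bar>\<tau> - t\<bar>" .
      have ek: "e k \<ge> 0" using e1[OF t, of k] nrm_nonneg[OF B banach_space_diff[OF B v[OF t] uc[OF t]], of k] by linarith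
      have eq: "v \<tau> - v t - (\<tau> - t) *\<^sub>R z t = (u k \<tau> - u k t - (\<tau> - t) *\<^sub>R z t) + ((v \<tau> - u k \<tau>) - (v t - u k t))"
        by simp
      have "nrm E (v \<tau> - v t - (\<tau> - t) *\<^sub>R z t) \<le> nrm E (u k \<tau> - u k t - (\<tau> - t) *\<^sub>R z t) + nrm E ((v \<tau> - u k \<tau>) - (v t - u k t))"
        unfolding eq using \<tau> t uc zc v B by (intro nrm_add banach_space_closed) auto
      moreover have "nrm E ((v \<tau> - u k \<tau>) - (v t - u k t)) \<le> nrm E (v \<tau> - u k \<tau>) + nrm E (v t - u k t)"
        using \<tau> t uc zc v B by (intro nrm_diff banach_space_closed) auto
      ultimately have "nrm E (v \<tau> - v t - (\<tau> - t) *\<^sub>R z t) \<le> (r/2 + e k) * \<bar>\<tau> - t\<bar> + 2 * e k"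
        using 1 e1[OF t, of k] e1[OF \<tau>(1), of k] by linarith
      moreover have "e k * \<bar>\<tau> - t\<bar> \<ge> 0" using ek by simp
      ultimately show ?thesis by (simp add: algebra_simps)
    qed
    have "(\<lambda>k. r/2 * \<bar>\<tau> - t\<bar> + (2 + 2 * \<bar>\<tau> - t\<bar>) * e k) \<longlonglongrightarrow> r/2 * \<bar>\<tau> - t\<bar> + (2 + 2 * \<bar>\<tau> - t\<bar>) * 0"
      by (intro tendsto_intros e0)
    then have "nrm E (v \<tau> - v t - (\<tau> - t) *\<^sub>R z t) \<le> r/2 * \<bar>\<tau> - t\<bar> + (2 + 2 * \<bar>\<tau> - t\<bar>) * 0"
      by (rule tendsto_lowerbound) (intro always_eventually allI step trivial_limit_sequentially)+
    also have "\<dots> \<le> r * \<bar>\<tau> - t\<bar>" using r by (simp add: field_simps)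
    finally show "nrm E (v \<tau> - v t - (\<tau> - t) *\<^sub>R z t) \<le> r * \<bar>\<tau> - t\<bar>" .
  qed
qed

section \<open>Taylor estimates\<close>

context
  fixes T :: real and E G :: "'a::real_vector nspace" and f f' f'' t
  assumes BE: "banach_space E" and BG: "banach_space G"
    and C2: "time_continuous_C2 T E G f f' f''" and t: "t \<in> {0..T}"
begin

lemma C2_carr: "u \<in> carr E \<Longrightarrow> f t u \<in> carr G"
proof -
  assume u: "u \<in> carr E"
  interpret ME: Metric_space "carr E" "ndist E" using BE by (rule Metric_space_ndist)
  interpret MG: Metric_space "carr G" "ndist G" using BG by (rule Metric_space_ndist)
  have "continuous_map (prod_topology (top_of_set {0..T}) (ntopology E)) (ntopology G) (\<lambda>(t, u). f t u)"
    using C2 by (simp add: time_continuous_C2_def Let_def)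
  from continuous_map_image_subset_topspace[OF this]
  have "(\<lambda>(t, u). f t u) ` ({0..T} \<times> carr E) \<subseteq> carr G" by simp
  moreover have "(t, u) \<in> {0..T} \<times> carr E" using t u by simp
  ultimately have "(\<lambda>(t, u). f t u) (t, u) \<in> carr G" by blast
  then show ?thesis by simp
qed

lemma C2_deriv_linear: "u \<in> carr E \<Longrightarrow> bounded_linear_betw E G (f' t u)"
proof -
  assume u: "u \<in> carr E"
  interpret ME: Metric_space "carr E" "ndist E" using BE by (rule Metric_space_ndist)
  have "continuous_op (prod_topology (top_of_set {0..T}) (ntopology E)) E G (\<lambda>(t, u). f' t u)"
    using C2 by (simp add: time_continuous_C2_def Let_def)
  then have "bounded_linear_betw E G ((\<lambda>(t, u). f' t u) (t, u))"
    using t u unfolding continuous_op_def by fastforce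
  then show ?thesis by simp
qed

lemma C2_deriv2_bilinear: "u \<in> carr E \<Longrightarrow> bounded_bilinear_betw E G (f'' t u)"
proof -
  assume u: "u \<in> carr E"
  interpret ME: Metric_space "carr E" "ndist E" using BE by (rule Metric_space_ndist)
  have "continuous_bilin (prod_topology (top_of_set {0..T}) (ntopology E)) E G (\<lambda>(t, u). f'' t u)"
    using C2 by (simp add: time_continuous_C2_def Let_def)
  then have "bounded_bilinear_betw E G ((\<lambda>(t, u). f'' t u) (t, u))"
    using t u unfolding continuous_bilin_def by fastforce
  then show ?thesis by simp
qed

lemma C2_deriv_carr: "u \<in> carr E \<Longrightarrow> v \<in> carr E \<Longrightarrow> f' t u v \<in> carr G"
  using C2_deriv_linear[of u] by (auto simp: bounded_linear_betw_def linear_betw_def)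

lemma C2_deriv2_linear:
  assumes "u \<in> carr E" "p \<in> carr E"
  shows "bounded_linear_betw E G (f'' t u p)"
proof -
  obtain K where "\<forall>x\<in>carr E. linear_betw E G (f'' t u x)"
     "\<forall>x\<in>carr E. \<forall>y\<in>carr E. nrm G (f'' t u x y) \<le> K * nrm E x * nrm E y"
    using C2_deriv2_bilinear[OF assms(1)] by (auto simp: bounded_bilinear_betw_def)
  then show ?thesis
    using assms unfolding bounded_linear_betw_def by (intro conjI exI[of _ "K * nrm E p"]) auto
qed

lemma C2_deriv2_scale1:
  assumes "u \<in> carr E" "p \<in> carr E" "v \<in> carr E"
  shows "f'' t u (c *\<^sub>R p) v = c *\<^sub>R f'' t u p v"
  using C2_deriv2_bilinear[OF assms(1)] assms by (auto simp: bounded_bilinear_betw_def linear_betw_def)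

lemma C2_line_carr: "u \<in> carr E \<Longrightarrow> p \<in> carr E \<Longrightarrow> u + c *\<^sub>R p \<in> carr E"
  using BE by (simp add: banach_space_closed)

lemma C2_line_deriv:
  assumes u: "u \<in> carr E" and p: "p \<in> carr E" and x: "x \<in> {0..1}"
  shows "has_time_deriv G {0..1} (\<lambda>\<tau>. f t (u + \<tau> *\<^sub>R p)) (f' t (u + x *\<^sub>R p) p) x"
  unfolding has_time_deriv_iff[OF BG x]
proof (intro conjI ballI allI impI)
  note z = C2_line_carr[OF u p]
  show "f' t (u + x *\<^sub>R p) p \<in> carr G" using z p by (intro C2_deriv_carr)
  show "f t (u + \<tau> *\<^sub>R p) \<in> carr G" for \<tau> using z by (intro C2_carr)
  fix e :: real assume e: "e > 0"
  define N where "N = nrm E p"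
  have N: "N \<ge> 0" unfolding N_def using BE p by (rule nrm_nonneg)
  define e1 where "e1 = e / (N + 1)"
  have e1: "e1 > 0" unfolding e1_def using e N by simp
  have fr: "\<forall>t\<in>{0..T}. \<forall>u\<in>carr E. \<forall>e>0. \<exists>d>0. \<forall>w\<in>carr E. nrm E w < d \<longrightarrow>
        nrm G (f t (u + w) - f t u - f' t u w) \<le> e * nrm E w"
    using C2 unfolding time_continuous_C2_def by (elim conjE)
  from fr[rule_format, OF t z[of x] e1]
  obtain d where d: "d > 0" "\<forall>w\<in>carr E. nrm E w < d \<longrightarrow>
        nrm G (f t ((u + x *\<^sub>R p) + w) - f t (u + x *\<^sub>R p) - f' t (u + x *\<^sub>R p) w) \<le> e1 * nrm E w"
    by (elim exE conjE)
  show "\<exists>d>0. \<forall>\<tau>\<in>{0..1}. \<bar>\<tau> - x\<bar> < d \<longrightarrow> nrm G (f t (u + \<tau> *\<^sub>R p) - f t (u + x *\<^sub>R p) - (\<tau> - x) *\<^sub>R f' t (u + x *\<^sub>R p) p) \<le> e * \<bar>\<tau> - x\<bar>"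
  proof (intro exI[of _ "d / (N + 1)"] conjI ballI impI)
    show "d / (N + 1) > 0" using d N by simp
    fix \<tau> assume \<tau>: "\<bar>\<tau> - x\<bar> < d / (N + 1)"
    let ?w = "(\<tau> - x) *\<^sub>R p"
    have wc: "?w \<in> carr E" using p BE by (simp add: banach_space_closed)
    have nw: "nrm E ?w = \<bar>\<tau> - x\<bar> * N" unfolding N_def using nrm_scale[OF BE p] .
    also have "\<dots> \<le> \<bar>\<tau> - x\<bar> * (N + 1)" by (intro mult_left_mono) auto
    also have "\<dots> < d" using \<tau> N by (simp add: pos_less_divide_eq)
    finally have wd: "nrm E ?w < d" .
    have "nrm G (f t ((u + x *\<^sub>R p) + ?w) - f t (u + x *\<^sub>R p) - f' t (u + x *\<^sub>R p) ?w) \<le> e1 * nrm E ?w"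
      using d(2)[rule_format, OF wc wd] .
    also have "f' t (u + x *\<^sub>R p) ?w = (\<tau> - x) *\<^sub>R f' t (u + x *\<^sub>R p) p"
      using C2_deriv_linear[OF z] p by (simp add: bounded_linear_betw_def linear_betw_def)
    also have "(u + x *\<^sub>R p) + ?w = u + \<tau> *\<^sub>R p" by (simp add: algebra_simps)
    also have "e1 * nrm E ?w = e * \<bar>\<tau> - x\<bar> * (N / (N + 1))" unfolding nw e1_def by simp
    also have "\<dots> \<le> e * \<bar>\<tau> - x\<bar> * 1" using N e by (intro mult_left_mono) auto
    finally show "nrm G (f t (u + \<tau> *\<^sub>R p) - f t (u + x *\<^sub>R p) - (\<tau> - x) *\<^sub>R f' t (u + x *\<^sub>R p) p) \<le> e * \<bar>\<tau> - x\<bar>" by simp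
  qed
qed

lemma C2_deriv_line_deriv:
  assumes u: "u \<in> carr E" and p: "p \<in> carr E" and v: "v \<in> carr E" and x: "x \<in> {0..1}"
  shows "has_time_deriv G {0..1} (\<lambda>\<tau>. f' t (u + \<tau> *\<^sub>R p) v) (f'' t (u + x *\<^sub>R p) p v) x"
  unfolding has_time_deriv_iff[OF BG x]
proof (intro conjI ballI allI impI)
  note z = C2_line_carr[OF u p]
  show "f'' t (u + x *\<^sub>R p) p v \<in> carr G"
    using C2_deriv2_linear[OF z p] v by (auto simp: bounded_linear_betw_def linear_betw_def)
  show "f' t (u + \<tau> *\<^sub>R p) v \<in> carr G" for \<tau> using z v by (intro C2_deriv_carr)
  fix e :: real assume e: "e > 0"
  define N where "N = nrm E p"
  define M where "M = nrm E v"
  have N: "N \<ge> 0" unfolding N_def using BE p by (rule nrm_nonneg)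
  have M: "M \<ge> 0" unfolding M_def using BE v by (rule nrm_nonneg)
  define e1 where "e1 = e / ((N + 1) * (M + 1))"
  have e1: "e1 > 0" unfolding e1_def using e N M by simp
  let ?A = "\<lambda>w v. f' t ((u + x *\<^sub>R p) + w) v - f' t (u + x *\<^sub>R p) v - f'' t (u + x *\<^sub>R p) w v"
  have fr: "\<forall>t\<in>{0..T}. \<forall>u\<in>carr E. \<forall>e>0. \<exists>d>0. \<forall>w\<in>carr E. nrm E w < d \<longrightarrow>
        op_norm E G (\<lambda>v. f' t (u + w) v - f' t u v - f'' t u w v) \<le> e * nrm E w"
    using C2 unfolding time_continuous_C2_def by (elim conjE)
  from fr[rule_format, OF t z[of x] e1]
  obtain d where d: "d > 0" "\<forall>w\<in>carr E. nrm E w < d \<longrightarrow> op_norm E G (?A w) \<le> e1 * nrm E w"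
    by (elim exE conjE)
  show "\<exists>d>0. \<forall>\<tau>\<in>{0..1}. \<bar>\<tau> - x\<bar> < d \<longrightarrow> nrm G (f' t (u + \<tau> *\<^sub>R p) v - f' t (u + x *\<^sub>R p) v - (\<tau> - x) *\<^sub>R f'' t (u + x *\<^sub>R p) p v) \<le> e * \<bar>\<tau> - x\<bar>"
  proof (intro exI[of _ "d / (N + 1)"] conjI ballI impI)
    show "d / (N + 1) > 0" using d N by simp
    fix \<tau> assume \<tau>: "\<bar>\<tau> - x\<bar> < d / (N + 1)"
    let ?w = "(\<tau> - x) *\<^sub>R p"
    have wc: "?w \<in> carr E" using p BE by (simp add: banach_space_closed)
    have nw: "nrm E ?w = \<bar>\<tau> - x\<bar> * N" unfolding N_def using nrm_scale[OF BE p] .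
    also have "\<dots> \<le> \<bar>\<tau> - x\<bar> * (N + 1)" by (intro mult_left_mono) auto
    also have "\<dots> < d" using \<tau> N by (simp add: pos_less_divide_eq)
    finally have wd: "nrm E ?w < d" .
    have op: "op_norm E G (?A ?w) \<le> e1 * nrm E ?w"
      using d(2)[rule_format, OF wc wd] .
    have "bounded_linear_betw E G (?A ?w)"
      using z wc banach_space_add[OF BE z wc]
      by (intro bounded_linear_betw_sub[OF BE BG] C2_deriv_linear C2_deriv2_linear)
    then have "nrm G (?A ?w v) \<le> op_norm E G (?A ?w) * nrm E v"
      by (rule nrm_le_op_norm[OF BE BG _ v])
    also have "\<dots> \<le> (e1 * nrm E ?w) * nrm E v" using op M unfolding M_def by (rule mult_right_mono)
    also have "f'' t (u + x *\<^sub>R p) ?w v = (\<tau> - x) *\<^sub>R f'' t (u + x *\<^sub>R p) p v"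
      by (rule C2_deriv2_scale1[OF z p v])
    also have "(u + x *\<^sub>R p) + ?w = u + \<tau> *\<^sub>R p" by (simp add: algebra_simps)
    also have "(e1 * nrm E ?w) * nrm E v = e * \<bar>\<tau> - x\<bar> * (N / (N + 1) * (M / (M + 1)))"
      unfolding nw e1_def M_def by simp
    also have "\<dots> \<le> e * \<bar>\<tau> - x\<bar> * (1 * 1)" using N M e by (intro mult_left_mono mult_mono) auto
    finally show "nrm G (f' t (u + \<tau> *\<^sub>R p) v - f' t (u + x *\<^sub>R p) v - (\<tau> - x) *\<^sub>R f'' t (u + x *\<^sub>R p) p v) \<le> e * \<bar>\<tau> - x\<bar>" by simp
  qed
qed

lemma C2_increment:
  assumes u: "u \<in> carr E" and p: "p \<in> carr E"
    and bd: "\<And>x. x \<in> {0..1} \<Longrightarrow> nrm G (f' t (u + x *\<^sub>R p) p) \<le> K"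
  shows "nrm G (f t (u + p) - f t u) \<le> K"
  using nrm_deriv_bound[OF BG _ C2_line_deriv[OF u p] bd] by simp

lemma C2_deriv_increment:
  assumes u: "u \<in> carr E" and p: "p \<in> carr E" and v: "v \<in> carr E"
    and bd: "\<And>x. x \<in> {0..1} \<Longrightarrow> nrm G (f'' t (u + x *\<^sub>R p) p v) \<le> K"
  shows "nrm G (f' t (u + p) v - f' t u v) \<le> K"
  using nrm_deriv_bound[OF BG _ C2_deriv_line_deriv[OF u p v] bd] by simp

lemma C2_taylor:
  assumes u: "u \<in> carr E" and p: "p \<in> carr E"
    and bd: "\<And>x. x \<in> {0..1} \<Longrightarrow> nrm G (f'' t (u + x *\<^sub>R p) p p) \<le> K"
  shows "nrm G (f t (u + p) - f t u - f' t u p) \<le> K"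
proof -
  note z = C2_line_carr[OF u p]
  have c: "f' t u p \<in> carr G" using u p by (rule C2_deriv_carr)
  have c2: "f'' t (u + x *\<^sub>R p) p p \<in> carr G" for x
    using C2_deriv2_linear[OF z p] p by (auto simp: bounded_linear_betw_def linear_betw_def)
  have K: "K \<ge> 0" using bd[of 0] nrm_nonneg[OF BG c2[of 0]] by simp
  have bd1: "nrm G (f' t (u + y *\<^sub>R p) p - f' t u p) \<le> K" if y: "y \<in> {0..1}" for y
  proof (rule C2_deriv_increment[OF u _ p])
    show "y *\<^sub>R p \<in> carr E" using p BE by (simp add: banach_space_closed)
    fix x :: real assume x: "x \<in> {0..1}"
    have xy: "x * y \<in> {0..1}" using x y by (auto intro: mult_le_one)
    have "f'' t (u + x *\<^sub>R (y *\<^sub>R p)) (y *\<^sub>R p) p = y *\<^sub>R f'' t (u + (x * y) *\<^sub>R p) p p"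
      using C2_deriv2_scale1[OF z[of "x*y"] p p] by simp
    then have "nrm G (f'' t (u + x *\<^sub>R (y *\<^sub>R p)) (y *\<^sub>R p) p) = y * nrm G (f'' t (u + (x * y) *\<^sub>R p) p p)"
      using nrm_scale[OF BG c2] y by simp
    also have "\<dots> \<le> 1 * K" using y bd[OF xy] K nrm_nonneg[OF BG c2] by (intro mult_mono) auto
    finally show "nrm G (f'' t (u + x *\<^sub>R (y *\<^sub>R p)) (y *\<^sub>R p) p) \<le> K" by simp
  qed
  have "nrm G ((f t (u + 1 *\<^sub>R p) - 1 *\<^sub>R f' t u p) - (f t (u + 0 *\<^sub>R p) - 0 *\<^sub>R f' t u p)) \<le> K * (1 - 0)"
  proof (rule nrm_deriv_bound[OF BG])
    fix x :: real assume x: "x \<in> {0..1}"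
    show "has_time_deriv G {0..1} (\<lambda>x. f t (u + x *\<^sub>R p) - x *\<^sub>R f' t u p) (f' t (u + x *\<^sub>R p) p - f' t u p) x"
      by (intro has_time_deriv_diff[OF BG x] C2_line_deriv u p x has_time_deriv_line BG c)
  qed (use bd1 in auto)
  then show ?thesis by (simp add: algebra_simps)
qed

end

lemma C_fun_C2:
  assumes "banach_space E" "banach_space G" "time_continuous_C2 T E G f f' f''" "C_fun I E u" "I \<subseteq> {0..T}"
  shows "C_fun I G (\<lambda>t. f t (u t))"
proof -
  have "continuous_map (prod_topology (top_of_set {0..T}) (ntopology E)) (ntopology G) (\<lambda>(t, u). f t u)"
    using assms(3) by (simp add: time_continuous_C2_def Let_def)
  from continuous_map_compose[OF continuous_map_graph[OF assms(4,5)] this]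
  show ?thesis by (simp add: C_fun_def o_def)
qed

lemma C_fun_C2_deriv:
  assumes "banach_space E" "banach_space G" "time_continuous_C2 T E G f f' f''" "C_fun I E u" "C_fun I E v" "I \<subseteq> {0..T}"
  shows "C_fun I G (\<lambda>t. f' t (u t) (v t))"
proof -
  have "continuous_op (prod_topology (top_of_set {0..T}) (ntopology E)) E G (\<lambda>(t, u). f' t u)"
    using assms(3) by (simp add: time_continuous_C2_def Let_def)
  from C_fun_continuous_op[OF assms(1,2) this continuous_map_graph[OF assms(4,6)] assms(5)]
  show ?thesis by simp
qed

section \<open>Continuously differentiable functions of time and their extension\<close>

text \<open>\<open>u \<in> C(I; E) \<inter> C\<^sup>1(I; G)\<close> with derivative \<open>w\<close>.\<close>

definition C1_fun :: "'a::real_vector nspace \<Rightarrow> 'a nspace \<Rightarrow> real set \<Rightarrow> (real \<Rightarrow> 'a) \<Rightarrow> (real \<Rightarrow> 'a) \<Rightarrow> bool" where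
  "C1_fun E G I u w \<longleftrightarrow> C_fun I E u \<and> C_fun I G w \<and> (\<forall>t\<in>I. has_time_deriv G I u (w t) t)"

text \<open>The function \<open>\<psi>(\<tau>) = S \<tau> / (S + 2 \<tau>)\<close> at \<open>\<tau> = t - S\<close>. It satisfies \<open>\<psi>(0) = 0\<close>, \<open>\<psi>'(0) = 1\<close>,
  \<open>0 \<le> \<psi> < S/2\<close> and \<open>0 < \<psi>' \<le> 1\<close> for \<open>\<tau> \<ge> 0\<close>.\<close>

definition reflect :: "real \<Rightarrow> real \<Rightarrow> real" where
  "reflect S t = S * (t - S) / (S + 2 * (t - S))"

text \<open>A function on \<open>[0,S]\<close> is extended past \<open>S\<close> by the reflection
  \<open>u(S + \<tau>) = 3 u(S - \<psi>(\<tau>)) - 2 u(S - 2 \<psi>(\<tau>))\<close>. Since \<open>3 - 2 = 1\<close> and \<open>-3 + 4 = 1\<close>, it preserves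
  continuous differentiability. Its bounds do not depend on \<open>S\<close>.\<close>

definition extend :: "real \<Rightarrow> (real \<Rightarrow> 'a::real_vector) \<Rightarrow> real \<Rightarrow> 'a" where
  "extend S u t = (if t \<le> S then u t
     else 3 *\<^sub>R u (S - reflect S t) - 2 *\<^sub>R u (S - 2 * reflect S t))"

text \<open>The derivative of the extension, in terms of the derivative \<open>w\<close> of the original function.\<close>

definition extend_deriv :: "real \<Rightarrow> (real \<Rightarrow> 'a::real_vector) \<Rightarrow> real \<Rightarrow> 'a" where
  "extend_deriv S w t = (if t \<le> S then w t
     else (S / (S + 2 * (t - S)))\<^sup>2 *\<^sub>R (4 *\<^sub>R w (S - 2 * reflect S t) - 3 *\<^sub>R w (S - reflect S t)))"

lemma reflect_bounds:
  assumes "0 < S" "S \<le> t"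
  shows "0 \<le> reflect S t" "2 * reflect S t \<le> S"
  using assms by (auto simp: reflect_def field_simps)

lemma reflect_maps:
  assumes "0 < S" "S \<le> t"
  shows "S - reflect S t \<in> {0..S}" "S - 2 * reflect S t \<in> {0..S}"
  using reflect_bounds[OF assms] by auto

lemma reflect_start: "reflect S S = 0"
  by (simp add: reflect_def)

lemma reflect_deriv:
  assumes "0 < S" "S \<le> t"
  shows "(reflect S has_real_derivative (S / (S + 2 * (t - S)))\<^sup>2) (at t within A)"
proof -
  have *: "S + 2 * (t - S) \<noteq> 0" using assms by auto
  have "((\<lambda>t. S * (t - S) / (S + 2 * (t - S))) has_real_derivative
      (S * (S + 2 * (t - S)) - S * (t - S) * 2) / ((S + 2 * (t - S)) * (S + 2 * (t - S)))) (at t within A)"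
    using * by (auto intro!: derivative_eq_intros)
  also have "(S * (S + 2 * (t - S)) - S * (t - S) * 2) = S * S" by (simp add: algebra_simps)
  finally show ?thesis by (simp add: reflect_def[abs_def] power2_eq_square)
qed

lemma scaleR_3_2: "3 *\<^sub>R x - 2 *\<^sub>R x = (x :: 'a::real_vector)"
  using scaleR_diff_left[of 3 2 x] by simp

lemma scaleR_4_3: "4 *\<^sub>R x - 3 *\<^sub>R x = (x :: 'a::real_vector)"
  using scaleR_diff_left[of 4 3 x] by simp

lemma extend_eq: "t \<le> S \<Longrightarrow> extend S u t = u t"
  by (simp add: extend_def)

lemma extend_deriv_eq: "t \<le> S \<Longrightarrow> extend_deriv S w t = w t"
  by (simp add: extend_deriv_def)

lemma nrm_extend_le:
  assumes B: "banach_space E" and S: "0 < S" and "0 \<le> t"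
    and c: "\<And>t. t \<in> {0..S} \<Longrightarrow> u t \<in> carr E" and b: "\<And>t. t \<in> {0..S} \<Longrightarrow> nrm E (u t) \<le> K"
  shows "extend S u t \<in> carr E" "nrm E (extend S u t) \<le> 5 * K"
proof -
  have K: "K \<ge> 0" using b[of 0] nrm_nonneg[OF B c[of 0]] S by auto
  have "extend S u t \<in> carr E \<and> nrm E (extend S u t) \<le> 5 * K"
  proof (cases "t \<le> S")
    case True
    then show ?thesis using c[of t] b[of t] K assms(3) by (simp add: extend_def)
  next
    case False
    note r = reflect_maps[OF S, of t]
    let ?a = "u (S - reflect S t)" and ?b = "u (S - 2 * reflect S t)"
    have *: "?a \<in> carr E" "?b \<in> carr E" "nrm E ?a \<le> K" "nrm E ?b \<le> K" using c b r False by auto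
    have "nrm E (3 *\<^sub>R ?a - 2 *\<^sub>R ?b) \<le> nrm E (3 *\<^sub>R ?a) + nrm E (2 *\<^sub>R ?b)"
      using * B by (intro nrm_diff banach_space_closed)
    then show ?thesis using * B False by (simp add: extend_def nrm_scale[OF B] banach_space_closed)
  qed
  then show "extend S u t \<in> carr E" "nrm E (extend S u t) \<le> 5 * K" by auto
qed

lemma nrm_extend_deriv_le:
  assumes B: "banach_space E" and S: "0 < S" and "0 \<le> t"
    and c: "\<And>t. t \<in> {0..S} \<Longrightarrow> u t \<in> carr E" and b: "\<And>t. t \<in> {0..S} \<Longrightarrow> nrm E (u t) \<le> K"
  shows "extend_deriv S u t \<in> carr E" "nrm E (extend_deriv S u t) \<le> 7 * K"
proof -
  have K: "K \<ge> 0" using b[of 0] nrm_nonneg[OF B c[of 0]] S by auto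
  have "extend_deriv S u t \<in> carr E \<and> nrm E (extend_deriv S u t) \<le> 7 * K"
  proof (cases "t \<le> S")
    case True
    then show ?thesis using c[of t] b[of t] K assms(3) by (simp add: extend_deriv_def)
  next
    case False
    note r = reflect_maps[OF S, of t]
    let ?a = "u (S - reflect S t)" and ?b = "u (S - 2 * reflect S t)"
    let ?z = "4 *\<^sub>R ?b - 3 *\<^sub>R ?a"
    have *: "?a \<in> carr E" "?b \<in> carr E" "nrm E ?a \<le> K" "nrm E ?b \<le> K" using c b r False by auto
    have zc: "?z \<in> carr E" using * B by (intro banach_space_closed)
    have "nrm E ?z \<le> nrm E (4 *\<^sub>R ?b) + nrm E (3 *\<^sub>R ?a)"
      using * B by (intro nrm_diff banach_space_closed)
    then have z: "nrm E ?z \<le> 7 * K" using * by (simp add: nrm_scale[OF B])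
    have "(S / (S + 2 * (t - S)))\<^sup>2 \<le> 1"
      using False S by (intro power_le_one) (auto simp: field_simps)
    then have "(S / (S + 2 * (t - S)))\<^sup>2 * nrm E ?z \<le> 1 * (7 * K)"
      using z K nrm_nonneg[OF B zc] by (intro mult_mono) auto
    then show ?thesis using zc False nrm_scale[OF B zc] B by (simp add: extend_deriv_def banach_space_closed)
  qed
  then show "extend_deriv S u t \<in> carr E" "nrm E (extend_deriv S u t) \<le> 7 * K" by auto
qed

lemma continuous_on_reflect: "0 < S \<Longrightarrow> continuous_on {S..T} (reflect S)"
  by (rule DERIV_continuous_on[OF reflect_deriv]) auto

lemma C_fun_extend:
  assumes B: "banach_space E" and S: "0 < S" "S \<le> T" and u: "C_fun {0..S} E u"
  shows "C_fun {0..T} E (extend S u)"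
proof (rule C_fun_Un_closed[OF B])
  show "C_fun {0..S} E (extend S u)" using C_fun_cong[OF B u] by (simp add: extend_eq)
  have "C_fun {S..T} E (\<lambda>t. 3 *\<^sub>R u (S - reflect S t) - 2 *\<^sub>R u (S - 2 * reflect S t))"
    using reflect_maps[OF S(1)] continuous_on_reflect[OF S(1)]
    by (intro C_fun_diff C_fun_scale C_fun_compose[OF B u] B continuous_intros) auto
  then show "C_fun {S..T} E (extend S u)"
  proof (rule C_fun_cong[OF B])
    fix t assume "t \<in> {S..T}"
    then show "extend S u t = 3 *\<^sub>R u (S - reflect S t) - 2 *\<^sub>R u (S - 2 * reflect S t)"
      by (cases "t = S") (auto simp: extend_def reflect_start scaleR_3_2)
  qed
qed (use S in auto)

lemma C_fun_extend_deriv: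
  assumes B: "banach_space E" and S: "0 < S" "S \<le> T" and u: "C_fun {0..S} E u"
  shows "C_fun {0..T} E (extend_deriv S u)"
proof (rule C_fun_Un_closed[OF B])
  show "C_fun {0..S} E (extend_deriv S u)" using C_fun_cong[OF B u] by (simp add: extend_deriv_eq)
  have "C_fun {S..T} E (\<lambda>t. (S / (S + 2 * (t - S)))\<^sup>2 *\<^sub>R (4 *\<^sub>R u (S - 2 * reflect S t) - 3 *\<^sub>R u (S - reflect S t)))"
    using reflect_maps[OF S(1)] continuous_on_reflect[OF S(1)] S
    by (intro C_fun_diff C_fun_scale C_fun_compose[OF B u] B continuous_intros) auto
  then show "C_fun {S..T} E (extend_deriv S u)"
  proof (rule C_fun_cong[OF B])
    fix t assume "t \<in> {S..T}"
    then show "extend_deriv S u t = (S / (S + 2 * (t - S)))\<^sup>2 *\<^sub>R (4 *\<^sub>R u (S - 2 * reflect S t) - 3 *\<^sub>R u (S - reflect S t))"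
      using S by (cases "t = S") (auto simp: extend_deriv_def reflect_start scaleR_3_2 scaleR_4_3)
  qed
qed (use S in auto)

lemma C1_fun_extend:
  assumes BE: "banach_space E" and BG: "banach_space G" and S: "0 < S" "S \<le> T"
    and u: "C1_fun E G {0..S} u w"
  shows "C1_fun E G {0..T} (extend S u) (extend_deriv S w)"
  unfolding C1_fun_def
proof (intro conjI ballI)
  have uE: "C_fun {0..S} E u" and wG: "C_fun {0..S} G w"
    and der: "\<And>t. t \<in> {0..S} \<Longrightarrow> has_time_deriv G {0..S} u (w t) t" using u by (auto simp: C1_fun_def)
  have uc: "u t \<in> carr G" if "t \<in> {0..S}" for t using has_time_deriv_carr(2)[OF der[OF that] that] .
  have wc: "w t \<in> carr G" if "t \<in> {0..S}" for t using has_time_deriv_carr(1)[OF der[OF that]] .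
  show "C_fun {0..T} E (extend S u)" using C_fun_extend[OF BE S uE] .
  show "C_fun {0..T} G (extend_deriv S w)" using C_fun_extend_deriv[OF BG S wG] .
  let ?f = "\<lambda>t. 3 *\<^sub>R u (S - reflect S t) - 2 *\<^sub>R u (S - 2 * reflect S t)"
  let ?g = "\<lambda>t. (S / (S + 2 * (t - S)))\<^sup>2 *\<^sub>R (4 *\<^sub>R w (S - 2 * reflect S t) - 3 *\<^sub>R w (S - reflect S t))"
  have ext: "extend S u t = ?f t" "extend_deriv S w t = ?g t" if "t \<in> {S..T}" for t
    using that S by (cases "t = S"; auto simp: extend_def extend_deriv_def reflect_start scaleR_3_2 scaleR_4_3)+
  have right: "has_time_deriv G {S..T} (extend S u) (extend_deriv S w t) t" if t: "t \<in> {S..T}" for t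
  proof -
    define d where "d = (S / (S + 2 * (t - S)))\<^sup>2"
    have dr: "(reflect S has_real_derivative d) (at t within {S..T})" unfolding d_def
      using S t by (intro reflect_deriv) auto
    have 1: "((\<lambda>t. S - reflect S t) has_real_derivative - d) (at t within {S..T})"
      using dr by (auto intro!: derivative_eq_intros)
    have 2: "((\<lambda>t. S - 2 * reflect S t) has_real_derivative - 2 * d) (at t within {S..T})"
      using dr by (auto intro!: derivative_eq_intros)
    have "has_time_deriv G {S..T} ?f (3 *\<^sub>R (- d) *\<^sub>R w (S - reflect S t) - 2 *\<^sub>R (- 2 * d) *\<^sub>R w (S - 2 * reflect S t)) t"
      using t reflect_maps[OF S(1)]
      by (intro has_time_deriv_diff[OF BG t] has_time_deriv_scale[OF BG t]
         has_time_deriv_compose[OF BG t der 1] has_time_deriv_compose[OF BG t der 2]) auto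
    also have "3 *\<^sub>R (- d) *\<^sub>R w (S - reflect S t) - 2 *\<^sub>R (- 2 * d) *\<^sub>R w (S - 2 * reflect S t) = extend_deriv S w t"
      unfolding ext(2)[OF t] d_def[symmetric] by (simp add: scaleR_diff_right mult.commute)
    finally have "has_time_deriv G {S..T} ?f (extend_deriv S w t) t" .
    from has_time_deriv_cong[OF this t ext(1)] show ?thesis .
  qed
  have left: "has_time_deriv G {0..S} (extend S u) (extend_deriv S w t) t" if t: "t \<in> {0..S}" for t
    using has_time_deriv_cong[OF der[OF t] t, of "extend S u"] t by (simp add: extend_eq extend_deriv_eq)
  have cr: "extend S u t \<in> carr G" if "t \<in> {S..T}" for t
    using has_time_deriv_carr(2)[OF right[OF that] that] .
  have cl: "extend S u t \<in> carr G" if "t \<in> {0..S}" for t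
    using has_time_deriv_carr(2)[OF left[OF that] that] .
  show "has_time_deriv G {0..T} (extend S u) (extend_deriv S w t) t" if t: "t \<in> {0..T}" for t
  proof -
    consider "t < S" | "t = S" | "S < t" by linarith
    then show ?thesis
    proof cases
      case 1
      then show ?thesis using t S by (intro has_time_deriv_extend[OF left _ _ cr]) auto
    next
      case 2
      then show ?thesis using S by (intro has_time_deriv_Un_closed[OF left right]) auto
    next
      case 3
      then show ?thesis using t S by (intro has_time_deriv_extend_left[OF right _ _ cl]) auto
    qed
  qed
qed

section \<open>The linearised problem and uniqueness\<close>

text \<open>The setting of the theorem with a fixed family \<open>Sm\<close> of smoothing operators. The levels \<open>D\<close> and \<open>P\<close>
  are restricted only by the inequalities that the iteration uses.\<close>

locale singular_evolution =
  fixes X :: "real \<Rightarrow> 'a::real_vector nspace" and Sm :: "real \<Rightarrow> 'a \<Rightarrow> 'a"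
    and \<epsilon>0 T s0 m d1 d1' D P s :: real
    and L F :: "real \<Rightarrow> real \<Rightarrow> 'a \<Rightarrow> 'a"
    and Fu :: "real \<Rightarrow> real \<Rightarrow> 'a \<Rightarrow> 'a \<Rightarrow> 'a"
    and Fuu :: "real \<Rightarrow> real \<Rightarrow> 'a \<Rightarrow> 'a \<Rightarrow> 'a \<Rightarrow> 'a"
    and h :: "real \<Rightarrow> real \<Rightarrow> 'a" and u0 :: "real \<Rightarrow> 'a"
  assumes eps0: "\<epsilon>0 > 0" and scale: "banach_scale X" and smoothing: "smoothing_operators X Sm"
    and T: "T > 0" and m: "m \<ge> 0" and d1: "d1 \<ge> 0" and d1': "d1' \<ge> 0"
    and asm1: "assumption1 X m s0 T \<epsilon>0 L"
    and asm2: "assumption2 X m s0 T \<epsilon>0 F Fu Fuu"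
    and asm3: "assumption3 X m s0 d1 d1' T \<epsilon>0 L Fu"
    and D: "d1 \<le> D" "d1' + m \<le> D" and P: "2 * D < P" and s: "s0 + m \<le> s"
    and data: "\<forall>\<epsilon>\<in>{0<..<\<epsilon>0}. F_space X m T (s + P) (h \<epsilon>) (u0 \<epsilon>)"
    and data_bdd: "\<exists>M. \<forall>\<epsilon>\<in>{0<..<\<epsilon>0}. F_norm X m T (s + P) (h \<epsilon>) (u0 \<epsilon>) \<le> M"
begin

lemma X_banach [simp, intro]: "banach_space (X \<sigma>)"
  using scale by (simp add: banach_scale_def)

lemma D_nonneg: "D \<ge> 0" using D d1 by simp

lemma X_embeds: "\<sigma> \<le> \<sigma>' \<Longrightarrow> embeds (X \<sigma>') (X \<sigma>)"
  using scale by (simp add: banach_scale_def embeds_def)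

lemma X_subset: "\<sigma> \<le> \<sigma>' \<Longrightarrow> u \<in> carr (X \<sigma>') \<Longrightarrow> u \<in> carr (X \<sigma>)"
  using X_embeds[of \<sigma> \<sigma>'] by (auto simp: embeds_def)

lemma X_mono: "\<sigma> \<le> \<sigma>' \<Longrightarrow> u \<in> carr (X \<sigma>') \<Longrightarrow> nrm (X \<sigma>) u \<le> nrm (X \<sigma>') u"
  using X_embeds[of \<sigma> \<sigma>'] by (auto simp: embeds_def)

lemma C_fun_X_mono: "C_fun I (X \<sigma>') u \<Longrightarrow> \<sigma> \<le> \<sigma>' \<Longrightarrow> C_fun I (X \<sigma>) u"
  by (rule C_fun_embeds[OF _ _ X_embeds]) auto

lemma deriv_X_mono: "has_time_deriv (X \<sigma>') I u w t \<Longrightarrow> \<sigma> \<le> \<sigma>' \<Longrightarrow> t \<in> I \<Longrightarrow> has_time_deriv (X \<sigma>) I u w t"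
  by (rule has_time_deriv_embeds[OF _ _ X_embeds]) auto

lemma C1_fun_X_mono:
  "C1_fun (X \<sigma>') (X (\<sigma>' - m)) I u w \<Longrightarrow> \<sigma> \<le> \<sigma>' \<Longrightarrow> C1_fun (X \<sigma>) (X (\<sigma> - m)) I u w"
  unfolding C1_fun_def by (auto intro: C_fun_X_mono deriv_X_mono)

subsection \<open>Bounds for the operators\<close>

lemma L_levels:
  assumes "s \<le> \<sigma>"
  shows "\<forall>\<epsilon>\<in>{0<..<\<epsilon>0}. continuous_op euclidean (X \<sigma>) (X (\<sigma> - m)) (L \<epsilon>)"
    and "\<exists>M. \<forall>\<epsilon>\<in>{0<..<\<epsilon>0}. \<forall>t\<in>{0..T}. op_norm (X \<sigma>) (X (\<sigma> - m)) (L \<epsilon> t) \<le> M"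
proof -
  have "\<forall>s\<ge>s0. (\<forall>\<epsilon>\<in>{0<..<\<epsilon>0}. continuous_op euclidean (X (s + m)) (X s) (L \<epsilon>)) \<and>
        (\<exists>M. \<forall>\<epsilon>\<in>{0<..<\<epsilon>0}. \<forall>t\<in>{0..T}. op_norm (X (s + m)) (X s) (L \<epsilon> t) \<le> M)"
    using asm1 unfolding assumption1_def by (elim conjE)
  from this[THEN spec, THEN mp, of "\<sigma> - m"]
  show "\<forall>\<epsilon>\<in>{0<..<\<epsilon>0}. continuous_op euclidean (X \<sigma>) (X (\<sigma> - m)) (L \<epsilon>)"
    and "\<exists>M. \<forall>\<epsilon>\<in>{0<..<\<epsilon>0}. \<forall>t\<in>{0..T}. op_norm (X \<sigma>) (X (\<sigma> - m)) (L \<epsilon> t) \<le> M"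
    using assms s by simp_all
qed

lemma L_linear:
  assumes "\<epsilon> \<in> {0<..<\<epsilon>0}" "s \<le> \<sigma>"
  shows "bounded_linear_betw (X \<sigma>) (X (\<sigma> - m)) (L \<epsilon> t)"
  using L_levels(1)[OF assms(2)] assms(1) by (simp add: continuous_op_def)

lemma C_fun_L:
  assumes "\<epsilon> \<in> {0<..<\<epsilon>0}" "s \<le> \<sigma>" "C_fun I (X \<sigma>) u"
  shows "C_fun I (X (\<sigma> - m)) (\<lambda>t. L \<epsilon> t (u t))"
proof -
  have "continuous_op euclidean (X \<sigma>) (X (\<sigma> - m)) (L \<epsilon>)" using L_levels(1)[OF assms(2)] assms(1) by blast
  from C_fun_continuous_op[OF _ _ this _ assms(3), of "\<lambda>t. t"] show ?thesis by simp
qed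

lemma L_bound:
  assumes "s \<le> \<sigma>"
  shows "\<exists>M\<ge>0. \<forall>\<epsilon>\<in>{0<..<\<epsilon>0}. \<forall>t\<in>{0..T}. \<forall>u\<in>carr (X \<sigma>).
     nrm (X (\<sigma> - m)) (L \<epsilon> t u) \<le> M * nrm (X \<sigma>) u"
proof -
  obtain M where M: "\<forall>\<epsilon>\<in>{0<..<\<epsilon>0}. \<forall>t\<in>{0..T}. op_norm (X \<sigma>) (X (\<sigma> - m)) (L \<epsilon> t) \<le> M"
    using L_levels(2)[OF assms] by blast
  have "nrm (X (\<sigma> - m)) (L \<epsilon> t u) \<le> \<bar>M\<bar> * nrm (X \<sigma>) u" if "\<epsilon> \<in> {0<..<\<epsilon>0}" "t \<in> {0..T}" "u \<in> carr (X \<sigma>)" for \<epsilon> t u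
  proof -
    have "nrm (X (\<sigma> - m)) (L \<epsilon> t u) \<le> op_norm (X \<sigma>) (X (\<sigma> - m)) (L \<epsilon> t) * nrm (X \<sigma>) u"
      using L_linear[OF that(1) assms] that by (intro nrm_le_op_norm) auto
    also have "\<dots> \<le> \<bar>M\<bar> * nrm (X \<sigma>) u"
      using M[rule_format, OF that(1,2)] that nrm_nonneg[of "X \<sigma>" u] by (intro mult_right_mono) auto
    finally show ?thesis .
  qed
  then show ?thesis by (intro exI[of _ "\<bar>M\<bar>"]) auto
qed

lemma F_C2:
  assumes "\<epsilon> \<in> {0<..<\<epsilon>0}" "s \<le> \<sigma>"
  shows "time_continuous_C2 T (X \<sigma>) (X (\<sigma> - m)) (F \<epsilon>) (Fu \<epsilon>) (Fuu \<epsilon>)"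
proof -
  have "\<forall>s\<ge>s0. \<forall>\<epsilon>\<in>{0<..<\<epsilon>0}. time_continuous_C2 T (X (s + m)) (X s) (F \<epsilon>) (Fu \<epsilon>) (Fuu \<epsilon>)"
    using asm2 unfolding assumption2_def by (elim conjE)
  from this[THEN spec, THEN mp, of "\<sigma> - m"] show ?thesis using assms s by simp
qed

text \<open>The tame bounds, at a fixed level and on a ball of \<open>X\<^sup>s\<close>. The low norms are taken in
  \<open>X\<^sup>s\<close>, which is stronger than \<open>X\<^bsup>s0+m\<^esup>\<close>.\<close>

lemma F_bound:
  assumes "s \<le> \<sigma>"
  shows "\<exists>M\<ge>0. \<forall>\<epsilon>\<in>{0<..<\<epsilon>0}. \<forall>t\<in>{0..T}. \<forall>u\<in>carr (X \<sigma>).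
     nrm (X s) u \<le> R \<longrightarrow> nrm (X (\<sigma> - m)) (F \<epsilon> t u) \<le> M * nrm (X \<sigma>) u"
proof -
  obtain C where C: "nondecreasing2 C" and
    b: "\<forall>\<sigma>\<ge>s0. \<forall>\<epsilon>\<in>{0<..<\<epsilon>0}. \<forall>u\<in>carr (X (\<sigma> + m)). \<forall>t\<in>{0..T}.
           nrm (X \<sigma>) (F \<epsilon> t u) \<le> C \<sigma> (nrm (X (s0 + m)) u) * nrm (X (\<sigma> + m)) u"
    using asm2 unfolding assumption2_def by (elim conjE exE)
  have "nrm (X (\<sigma> - m)) (F \<epsilon> t u) \<le> \<bar>C (\<sigma> - m) R\<bar> * nrm (X \<sigma>) u"
    if *: "\<epsilon> \<in> {0<..<\<epsilon>0}" "t \<in> {0..T}" "u \<in> carr (X \<sigma>)" "nrm (X s) u \<le> R" for \<epsilon> t u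
  proof -
    have "nrm (X (s0 + m)) u \<le> nrm (X s) u" using * s by (intro X_mono X_subset[OF assms]) auto
    then have le: "C (\<sigma> - m) (nrm (X (s0 + m)) u) \<le> C (\<sigma> - m) R"
      using C * unfolding nondecreasing2_def by (meson order_refl order_trans)
    have "nrm (X (\<sigma> - m)) (F \<epsilon> t u) \<le> C (\<sigma> - m) (nrm (X (s0 + m)) u) * nrm (X (\<sigma> - m + m)) u"
      using b[rule_format, of "\<sigma> - m" \<epsilon> u t] * assms s by simp
    also have "\<dots> \<le> \<bar>C (\<sigma> - m) R\<bar> * nrm (X (\<sigma> - m + m)) u"
      using le * by (intro mult_right_mono nrm_nonneg) auto
    finally show ?thesis by simp
  qed
  then show ?thesis by (intro exI[of _ "\<bar>C (\<sigma> - m) R\<bar>"]) auto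
qed

lemma Fu_bound:
  assumes "s \<le> \<sigma>"
  shows "\<exists>M\<ge>0. \<forall>\<epsilon>\<in>{0<..<\<epsilon>0}. \<forall>t\<in>{0..T}. \<forall>u\<in>carr (X \<sigma>). \<forall>v\<in>carr (X \<sigma>).
     nrm (X s) u \<le> R \<longrightarrow> nrm (X (\<sigma> - m)) (Fu \<epsilon> t u v) \<le> M * (nrm (X \<sigma>) v + nrm (X \<sigma>) u * nrm (X s) v)"
proof -
  obtain C where C: "nondecreasing2 C" and
    b: "\<forall>\<sigma>\<ge>s0. \<forall>\<epsilon>\<in>{0<..<\<epsilon>0}. \<forall>u\<in>carr (X (\<sigma> + m)). \<forall>v\<in>carr (X (\<sigma> + m)). \<forall>t\<in>{0..T}.
           nrm (X \<sigma>) (Fu \<epsilon> t u v) \<le> C \<sigma> (nrm (X (s0 + m)) u) *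
             (nrm (X (\<sigma> + m)) v + nrm (X (\<sigma> + m)) u * nrm (X (s0 + m)) v)"
    using asm2 unfolding assumption2_def by (elim conjE exE)
  have "nrm (X (\<sigma> - m)) (Fu \<epsilon> t u v) \<le> \<bar>C (\<sigma> - m) R\<bar> * (nrm (X \<sigma>) v + nrm (X \<sigma>) u * nrm (X s) v)"
    if *: "\<epsilon> \<in> {0<..<\<epsilon>0}" "t \<in> {0..T}" "u \<in> carr (X \<sigma>)" "v \<in> carr (X \<sigma>)" "nrm (X s) u \<le> R" for \<epsilon> t u v
  proof -
    have low: "nrm (X (s0 + m)) w \<le> nrm (X s) w" if "w \<in> carr (X \<sigma>)" for w
      using that s by (intro X_mono X_subset[OF assms]) auto
    have le: "C (\<sigma> - m) (nrm (X (s0 + m)) u) \<le> C (\<sigma> - m) R"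
      using C * low[of u] unfolding nondecreasing2_def by (meson order_refl order_trans)
    have in0: "w \<in> carr (X (s0 + m))" if "w \<in> carr (X \<sigma>)" for w using X_subset[OF _ that] assms s by simp
    have nn: "0 \<le> nrm (X \<sigma>) u" "0 \<le> nrm (X \<sigma>) v" "0 \<le> nrm (X (s0 + m)) v"
      using * in0 by (auto intro!: nrm_nonneg)
    have "nrm (X (\<sigma> - m)) (Fu \<epsilon> t u v) \<le> C (\<sigma> - m) (nrm (X (s0 + m)) u) * (nrm (X (\<sigma> - m + m)) v + nrm (X (\<sigma> - m + m)) u * nrm (X (s0 + m)) v)"
      using b[rule_format, of "\<sigma> - m" \<epsilon> u v t] * assms s by simp
    also have "\<dots> \<le> \<bar>C (\<sigma> - m) R\<bar> * (nrm (X \<sigma>) v + nrm (X \<sigma>) u * nrm (X s) v)"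
      using le low[of v] nn * by (intro mult_mono add_mono mult_left_mono) auto
    finally show ?thesis .
  qed
  then show ?thesis by (intro exI[of _ "\<bar>C (\<sigma> - m) R\<bar>"]) auto
qed

lemma Fuu_bound:
  assumes "s \<le> \<sigma>"
  shows "\<exists>M\<ge>0. \<forall>\<epsilon>\<in>{0<..<\<epsilon>0}. \<forall>t\<in>{0..T}. \<forall>u\<in>carr (X \<sigma>). \<forall>p\<in>carr (X \<sigma>).
     \<forall>v\<in>carr (X \<sigma>). nrm (X s) u \<le> R \<longrightarrow> nrm (X (\<sigma> - m)) (Fuu \<epsilon> t u p v) \<le>
       M * (nrm (X \<sigma>) p * nrm (X s) v + nrm (X s) p * nrm (X \<sigma>) v + nrm (X \<sigma>) u * nrm (X s) p * nrm (X s) v)"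
proof -
  obtain C where C: "nondecreasing2 C" and
    b: "\<forall>\<sigma>\<ge>s0. \<forall>\<epsilon>\<in>{0<..<\<epsilon>0}. \<forall>u\<in>carr (X (\<sigma> + m)). \<forall>v1\<in>carr (X (\<sigma> + m)). \<forall>v2\<in>carr (X (\<sigma> + m)). \<forall>t\<in>{0..T}.
           nrm (X \<sigma>) (Fuu \<epsilon> t u v1 v2) \<le> C \<sigma> (nrm (X (s0 + m)) u) *
             (nrm (X (\<sigma> + m)) v1 * nrm (X (s0 + m)) v2 +
              nrm (X (s0 + m)) v1 * nrm (X (\<sigma> + m)) v2 +
              nrm (X (\<sigma> + m)) u * nrm (X (s0 + m)) v1 * nrm (X (s0 + m)) v2)"
    using asm2 unfolding assumption2_def by (elim conjE exE)
  have "nrm (X (\<sigma> - m)) (Fuu \<epsilon> t u p v) \<le>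
       \<bar>C (\<sigma> - m) R\<bar> * (nrm (X \<sigma>) p * nrm (X s) v + nrm (X s) p * nrm (X \<sigma>) v + nrm (X \<sigma>) u * nrm (X s) p * nrm (X s) v)"
    if *: "\<epsilon> \<in> {0<..<\<epsilon>0}" "t \<in> {0..T}" "u \<in> carr (X \<sigma>)" "p \<in> carr (X \<sigma>)" "v \<in> carr (X \<sigma>)" "nrm (X s) u \<le> R" for \<epsilon> t u p v
  proof -
    have low: "nrm (X (s0 + m)) w \<le> nrm (X s) w" if "w \<in> carr (X \<sigma>)" for w
      using that s by (intro X_mono X_subset[OF assms]) auto
    have le: "C (\<sigma> - m) (nrm (X (s0 + m)) u) \<le> C (\<sigma> - m) R"
      using C * low[of u] unfolding nondecreasing2_def by (meson order_refl order_trans)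
    have in0: "w \<in> carr (X (s0 + m))" if "w \<in> carr (X \<sigma>)" for w using X_subset[OF _ that] assms s by simp
    have ins: "w \<in> carr (X s)" if "w \<in> carr (X \<sigma>)" for w using X_subset[OF _ that] assms by simp
    have nn: "0 \<le> nrm (X \<sigma>) u" "0 \<le> nrm (X \<sigma>) v" "0 \<le> nrm (X \<sigma>) p"
      "0 \<le> nrm (X (s0 + m)) v" "0 \<le> nrm (X (s0 + m)) p" "0 \<le> nrm (X s) v" "0 \<le> nrm (X s) p"
      using * in0 ins by (auto intro!: nrm_nonneg)
    have "nrm (X (\<sigma> - m)) (Fuu \<epsilon> t u p v) \<le> C (\<sigma> - m) (nrm (X (s0 + m)) u) *
      (nrm (X (\<sigma> - m + m)) p * nrm (X (s0 + m)) v + nrm (X (s0 + m)) p * nrm (X (\<sigma> - m + m)) v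
        + nrm (X (\<sigma> - m + m)) u * nrm (X (s0 + m)) p * nrm (X (s0 + m)) v)"
      using b[rule_format, of "\<sigma> - m" \<epsilon> u p v t] * assms s by simp
    also have "\<dots> \<le> \<bar>C (\<sigma> - m) R\<bar> * (nrm (X \<sigma>) p * nrm (X s) v + nrm (X s) p * nrm (X \<sigma>) v + nrm (X \<sigma>) u * nrm (X s) p * nrm (X s) v)"
      using le low[of v] low[of p] nn * by (intro mult_mono add_mono mult_left_mono add_nonneg_nonneg mult_nonneg_nonneg) auto
    finally show ?thesis .
  qed
  then show ?thesis by (intro exI[of _ "\<bar>C (\<sigma> - m) R\<bar>"]) auto
qed

lemma C_fun_F:
  assumes "\<epsilon> \<in> {0<..<\<epsilon>0}" "s \<le> \<sigma>" "C_fun I (X \<sigma>) u" "I \<subseteq> {0..T}"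
  shows "C_fun I (X (\<sigma> - m)) (\<lambda>t. F \<epsilon> t (u t))"
  using C_fun_C2[OF _ _ F_C2[OF assms(1,2)] assms(3,4)] by simp

lemma C_fun_Fu:
  assumes "\<epsilon> \<in> {0<..<\<epsilon>0}" "s \<le> \<sigma>" "C_fun I (X \<sigma>) u" "C_fun I (X \<sigma>) v" "I \<subseteq> {0..T}"
  shows "C_fun I (X (\<sigma> - m)) (\<lambda>t. Fu \<epsilon> t (u t) (v t))"
  using C_fun_C2_deriv[OF _ _ F_C2[OF assms(1,2)] assms(3-5)] by simp

subsection \<open>The forcing term\<close>

text \<open>Integrability is not needed: the integral of a function that is not integrable is \<open>0\<close>.\<close>

lemma integral_le_power:
  fixes g :: "real \<Rightarrow> real"
  assumes "0 \<le> t" "0 \<le> A" "\<And>x. x \<in> {0..t} \<Longrightarrow> g x \<le> A * x ^ n"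
  shows "integral {0..t} g \<le> A * t ^ Suc n / Suc n"
proof (cases "g integrable_on {0..t}")
  case True
  have "((\<lambda>x. A * x ^ n) has_integral (A * t ^ Suc n / Suc n - A * 0 ^ Suc n / Suc n)) {0..t}"
    using assms(1)
    by (intro fundamental_theorem_of_calculus)
       (auto simp flip: has_real_derivative_iff_has_vector_derivative simp del: power_Suc intro!: derivative_eq_intros)
  then have "((\<lambda>x. A * x ^ n) has_integral (A * t ^ Suc n / Suc n)) {0..t}" by simp
  with True show ?thesis using assms(3) has_integral_le[OF integrable_integral[OF True]] by blast
next
  case False
  then show ?thesis using assms by (simp add: not_integrable_integral)
qed

lemma I_func_le_power:
  assumes "0 \<le> t" "0 \<le> A" "\<And>x. x \<in> {0..t} \<Longrightarrow> nrm (X \<sigma>) (f x) \<le> A * x ^ n"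
  shows "I_func X \<sigma> t f 0 \<le> A * t ^ Suc n / Suc n"
proof -
  have "(SUP t''\<in>{0..t'}. nrm (X \<sigma>) (f t'')) \<le> A * t' ^ n" if "t' \<in> {0..t}" for t'
  proof (rule cSUP_least)
    show "nrm (X \<sigma>) (f x) \<le> A * t' ^ n" if "x \<in> {0..t'}" for x
    proof -
      have "nrm (X \<sigma>) (f x) \<le> A * x ^ n" using that \<open>t' \<in> {0..t}\<close> by (intro assms(3)) auto
      also have "\<dots> \<le> A * t' ^ n" using that assms(2) by (intro mult_left_mono power_mono) auto
      finally show ?thesis .
    qed
  qed (use that in auto)
  from integral_le_power[OF assms(1,2) this] show ?thesis
    by (simp add: I_func_def nrm_zero)
qed

lemma I_func_nonneg:
  assumes "0 \<le> t" "C_fun {0..t} (X \<sigma>) f"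
  shows "0 \<le> I_func X \<sigma> t f 0"
proof -
  have "0 \<le> integral {0..t} (\<lambda>t'. SUP t''\<in>{0..t'}. nrm (X \<sigma>) (f t''))"
  proof (cases "(\<lambda>t'. SUP t''\<in>{0..t'}. nrm (X \<sigma>) (f t'')) integrable_on {0..t}")
    case True
    then show ?thesis
    proof (rule integral_nonneg)
      fix x assume x: "x \<in> {0..t}"
      have "C_fun {0..x} (X \<sigma>) f" using C_fun_subset[OF _ assms(2), of "{0..x}"] x by auto
      from nrm_le_C_norm[OF _ this, of 0] have "nrm (X \<sigma>) (f 0) \<le> C_norm {0..x} (X \<sigma>) f" using x by auto
      then show "0 \<le> (SUP t''\<in>{0..x}. nrm (X \<sigma>) (f t''))"
        using nrm_nonneg[OF _ C_fun_carr[OF _ assms(2), of 0]] assms(1) unfolding C_norm_def by fastforce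
    qed
  qed (simp add: not_integrable_integral)
  then show ?thesis by (simp add: I_func_def nrm_zero)
qed

lemma I_func_le:
  assumes "0 \<le> t" "\<And>x. x \<in> {0..t} \<Longrightarrow> f x \<in> carr (X \<sigma>) \<and> nrm (X \<sigma>) (f x) \<le> B"
  shows "I_func X \<sigma> t f 0 \<le> t * B"
proof -
  have "0 \<le> B" using assms(2)[of 0] assms(1) nrm_nonneg[of "X \<sigma>" "f 0"] by auto
  then show ?thesis using I_func_le_power[OF assms(1), of B \<sigma> f 0] assms(2) by (simp add: mult.commute)
qed

subsection \<open>The linearised problem\<close>

lemma X1_funI:
  assumes "C1_fun (X \<sigma>) (X (\<sigma> - m)) {0..T} u w"
  shows "X1_fun X m T \<sigma> u"
proof -
  have "time_deriv (X (\<sigma> - m)) {0..T} u t = w t" if "t \<in> {0..T}" for t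
    using assms that T by (intro time_deriv_eq) (auto simp: C1_fun_def)
  moreover have "C_fun {0..T} (X (\<sigma> - m)) w" using assms by (simp add: C1_fun_def)
  ultimately have "C_fun {0..T} (X (\<sigma> - m)) (time_deriv (X (\<sigma> - m)) {0..T} u)"
    using C_fun_cong[OF X_banach] by blast
  then show ?thesis using assms unfolding X1_fun_def C1_fun_def by blast
qed

lemma X1_norm_le:
  assumes "C1_fun (X \<sigma>) (X (\<sigma> - m)) {0..T} u w"
    and "\<And>t. t \<in> {0..T} \<Longrightarrow> nrm (X \<sigma>) (u t) \<le> A" "\<And>t. t \<in> {0..T} \<Longrightarrow> nrm (X (\<sigma> - m)) (\<epsilon> *\<^sub>R w t) \<le> B"
  shows "X1_norm X m T \<epsilon> \<sigma> u \<le> A + B"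
proof -
  have "time_deriv (X (\<sigma> - m)) {0..T} u t = w t" if "t \<in> {0..T}" for t
    using assms that T by (intro time_deriv_eq) (auto simp: C1_fun_def)
  then show ?thesis
    unfolding X1_norm_def using assms T by (intro add_mono C_norm_le) auto
qed

lemma X1_norm_nonneg:
  assumes "C1_fun (X \<sigma>) (X (\<sigma> - m)) {0..T} u w"
  shows "0 \<le> X1_norm X m T \<epsilon> \<sigma> u"
proof -
  have tw: "time_deriv (X (\<sigma> - m)) {0..T} u t = w t" if "t \<in> {0..T}" for t
    using assms that T by (intro time_deriv_eq) (auto simp: C1_fun_def)
  have u: "C_fun {0..T} (X \<sigma>) u" and w: "C_fun {0..T} (X (\<sigma> - m)) w" using assms by (auto simp: C1_fun_def)
  have c: "C_fun {0..T} (X (\<sigma> - m)) (\<lambda>t. \<epsilon> *\<^sub>R time_deriv (X (\<sigma> - m)) {0..T} u t)"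
    using C_fun_scale[OF _ w, of "\<lambda>_. \<epsilon>"] by (rule C_fun_cong[rotated]) (auto simp: tw)
  have "0 \<le> C_norm {0..T} (X \<sigma>) u"
    using nrm_le_C_norm[OF _ u, of 0] T nrm_nonneg[OF _ C_fun_carr[OF _ u, of 0]] by fastforce
  moreover have "0 \<le> C_norm {0..T} (X (\<sigma> - m)) (\<lambda>t. \<epsilon> *\<^sub>R time_deriv (X (\<sigma> - m)) {0..T} u t)"
    using nrm_le_C_norm[OF _ c, of 0] T nrm_nonneg[OF _ C_fun_carr[OF _ c, of 0]] by fastforce
  ultimately show ?thesis unfolding X1_norm_def by simp
qed

text \<open>\<open>v \<in> C([0,T]; X\<^sup>\<sigma>)\<close> solves the problem linearised at \<open>u\<close> with right-hand side \<open>f\<close> and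
  initial value \<open>0\<close>.\<close>

definition lin_sol :: "real \<Rightarrow> real \<Rightarrow> (real \<Rightarrow> 'a) \<Rightarrow> (real \<Rightarrow> 'a) \<Rightarrow> (real \<Rightarrow> 'a) \<Rightarrow> bool" where
  "lin_sol \<sigma> \<epsilon> u f v \<longleftrightarrow> C_fun {0..T} (X \<sigma>) v \<and>
     solves_ivp (X (\<sigma> - m)) {0..T} \<epsilon> (L \<epsilon>) (\<lambda>t. Fu \<epsilon> t (u t)) f 0 v"

lemma lin_sol_mono:
  assumes "lin_sol \<sigma>' \<epsilon> u f v" "\<sigma> \<le> \<sigma>'"
  shows "lin_sol \<sigma> \<epsilon> u f v"
  using assms unfolding lin_sol_def solves_ivp_def
  by (meson C_fun_X_mono deriv_X_mono diff_right_mono)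

lemma linear_problem:
  "\<exists>C. nondecreasing2 C \<and> (\<forall>\<sigma> \<epsilon> u f. s0 + m \<le> \<sigma> \<longrightarrow> \<epsilon> \<in> {0<..<\<epsilon>0} \<longrightarrow> X1_fun X m T (\<sigma> + d1) u \<longrightarrow>
      C_fun {0..T} (X (\<sigma> + d1')) f \<longrightarrow>
      (\<exists>v. lin_sol \<sigma> \<epsilon> u f v \<and> (\<forall>w. lin_sol \<sigma> \<epsilon> u f w \<longrightarrow> (\<forall>t\<in>{0..T}. w t = v t)) \<and>
        (\<forall>t\<in>{0..T}. nrm (X \<sigma>) (v t) \<le> C \<sigma> (X1_norm X m T \<epsilon> (s0 + m + d1) u) *
          (I_func X (\<sigma> + d1') t f 0 + X1_norm X m T \<epsilon> (\<sigma> + d1) u * I_func X (s0 + m + d1') t f 0))))"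
proof -
  obtain C where C: "nondecreasing2 C" and
    b: "\<forall>s\<ge>s0 + m. \<forall>\<epsilon>\<in>{0<..<\<epsilon>0}. \<forall>u f g.
           X1_fun X m T (s + d1) u \<longrightarrow> F_space X m T (s + d1') f g \<longrightarrow>
           (let sol = (\<lambda>v. C_fun {0..T} (X s) v \<and>
                  solves_ivp (X (s - m)) {0..T} \<epsilon> (L \<epsilon>) (\<lambda>t. Fu \<epsilon> t (u t)) f g v)
            in \<exists>v. sol v \<and> (\<forall>w. sol w \<longrightarrow> (\<forall>t\<in>{0..T}. w t = v t)) \<and>
                 (\<forall>t\<in>{0..T}. nrm (X s) (v t) \<le>
                    C s (X1_norm X m T \<epsilon> (s0 + m + d1) u) *
                    (I_func X (s + d1') t f g +
                     X1_norm X m T \<epsilon> (s + d1) u * I_func X (s0 + m + d1') t f g)))"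
    using asm3 unfolding assumption3_def by (elim exE conjE)
  show ?thesis
  proof (intro exI[of _ C] conjI C allI impI)
    fix \<sigma> \<epsilon> u f assume *: "s0 + m \<le> \<sigma>" "\<epsilon> \<in> {0<..<\<epsilon>0}" "X1_fun X m T (\<sigma> + d1) u" "C_fun {0..T} (X (\<sigma> + d1')) f"
    then have F: "F_space X m T (\<sigma> + d1') f 0" by (simp add: F_space_def banach_space_zero)
    show "\<exists>v. lin_sol \<sigma> \<epsilon> u f v \<and> (\<forall>w. lin_sol \<sigma> \<epsilon> u f w \<longrightarrow> (\<forall>t\<in>{0..T}. w t = v t)) \<and>
        (\<forall>t\<in>{0..T}. nrm (X \<sigma>) (v t) \<le> C \<sigma> (X1_norm X m T \<epsilon> (s0 + m + d1) u) *
          (I_func X (\<sigma> + d1') t f 0 + X1_norm X m T \<epsilon> (\<sigma> + d1) u * I_func X (s0 + m + d1') t f 0))"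
      using b[rule_format, OF *(1,2,3) F] unfolding Let_def lin_sol_def .
  qed
qed

text \<open>The linearised problem on a short interval \<open>[0,T']\<close>: the coefficient is extended to \<open>[0,T]\<close>
  by reflection and the right-hand side by a constant. The constant \<open>M\<close> depends neither on \<open>T'\<close> nor on
  \<open>\<epsilon>\<close>, and the estimate gains the factor \<open>T'\<close>.\<close>

lemma linear_solve:
  assumes \<tau>: "s0 + m \<le> \<tau>"
  shows "\<exists>M\<ge>0. \<forall>T' \<epsilon> u w f. T' \<in> {0<..T} \<longrightarrow> \<epsilon> \<in> {0<..<\<epsilon>0} \<longrightarrow>
      C1_fun (X (\<tau> + d1)) (X (\<tau> + d1 - m)) {0..T'} u w \<longrightarrow> C_fun {0..T'} (X (\<tau> + d1')) f \<longrightarrow>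
      (\<forall>t\<in>{0..T'}. nrm (X (s0 + m + d1)) (u t) \<le> R \<and> nrm (X (s0 + m + d1 - m)) (\<epsilon> *\<^sub>R w t) \<le> R) \<longrightarrow>
      (\<exists>v. C_fun {0..T'} (X \<tau>) v \<and> v 0 = 0 \<and>
        (\<forall>t\<in>{0..T'}. has_time_deriv (X (\<tau> - m)) {0..T'} v
           (f t - (1 / \<epsilon>) *\<^sub>R L \<epsilon> t (v t) - Fu \<epsilon> t (u t) (v t)) t) \<and>
        (\<forall>\<sigma>\<in>{s0 + m..\<tau>}. \<forall>A B B0.
          (\<forall>t\<in>{0..T'}. nrm (X (\<sigma> + d1)) (u t) \<le> A \<and> nrm (X (\<sigma> + d1 - m)) (\<epsilon> *\<^sub>R w t) \<le> A \<and>
             nrm (X (\<sigma> + d1')) (f t) \<le> B \<and> nrm (X (s0 + m + d1')) (f t) \<le> B0) \<longrightarrow>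
          (\<forall>t\<in>{0..T'}. nrm (X \<sigma>) (v t) \<le> M * T' * (B + A * B0))))"
proof -
  obtain C where C: "nondecreasing2 C" and lin: "\<forall>\<sigma> \<epsilon> u f. s0 + m \<le> \<sigma> \<longrightarrow> \<epsilon> \<in> {0<..<\<epsilon>0} \<longrightarrow> X1_fun X m T (\<sigma> + d1) u \<longrightarrow>
      C_fun {0..T} (X (\<sigma> + d1')) f \<longrightarrow>
      (\<exists>v. lin_sol \<sigma> \<epsilon> u f v \<and> (\<forall>w. lin_sol \<sigma> \<epsilon> u f w \<longrightarrow> (\<forall>t\<in>{0..T}. w t = v t)) \<and>
        (\<forall>t\<in>{0..T}. nrm (X \<sigma>) (v t) \<le> C \<sigma> (X1_norm X m T \<epsilon> (s0 + m + d1) u) *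
          (I_func X (\<sigma> + d1') t f 0 + X1_norm X m T \<epsilon> (\<sigma> + d1) u * I_func X (s0 + m + d1') t f 0)))"
    using linear_problem by (elim exE conjE)
  note lin = lin[rule_format]
  \<comment> \<open>\<open>12 = 5 + 7\<close>, the constants of \<open>nrm_extend_le\<close> and \<open>nrm_extend_deriv_le\<close>\<close>
  define M where "M = \<bar>C \<tau> (12 * R)\<bar> * 12"
  show ?thesis
  proof (intro exI[of _ M] conjI allI impI)
    show "M \<ge> 0" by (simp add: M_def)
    fix T' \<epsilon> u w f
    assume T': "T' \<in> {0<..T}" and \<epsilon>: "\<epsilon> \<in> {0<..<\<epsilon>0}"
      and u: "C1_fun (X (\<tau> + d1)) (X (\<tau> + d1 - m)) {0..T'} u w" and f: "C_fun {0..T'} (X (\<tau> + d1')) f"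
      and R: "\<forall>t\<in>{0..T'}. nrm (X (s0 + m + d1)) (u t) \<le> R \<and> nrm (X (s0 + m + d1 - m)) (\<epsilon> *\<^sub>R w t) \<le> R"
    have T'': "0 < T'" "T' \<le> T" and \<epsilon>': "0 < \<epsilon>" using T' \<epsilon> by auto
    define U where "U = extend T' u"
    define W where "W = extend_deriv T' w"
    define f' where "f' t = f (min t T')" for t
    have uw: "u t \<in> carr (X (\<tau> + d1))" "w t \<in> carr (X (\<tau> + d1 - m))" "f t \<in> carr (X (\<tau> + d1'))" if "t \<in> {0..T'}" for t
      using u f that by (auto simp: C1_fun_def C_fun_iff)
    have U: "C1_fun (X (\<tau> + d1)) (X (\<tau> + d1 - m)) {0..T} U W"
      unfolding U_def W_def by (rule C1_fun_extend[OF _ _ T'' u]) auto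
    have Us: "C1_fun (X (\<sigma> + d1)) (X (\<sigma> + d1 - m)) {0..T} U W" if "\<sigma> \<le> \<tau>" for \<sigma>
      using C1_fun_X_mono[OF U] that by simp
    have f': "C_fun {0..T} (X (\<tau> + d1')) f'" unfolding f'_def
      using T'' by (intro C_fun_compose[OF _ f]) (auto intro!: continuous_intros)
    have Ule: "X1_norm X m T \<epsilon> (\<sigma> + d1) U \<le> 12 * A" if \<sigma>: "\<sigma> \<le> \<tau>" and
      A: "\<forall>t\<in>{0..T'}. nrm (X (\<sigma> + d1)) (u t) \<le> A \<and> nrm (X (\<sigma> + d1 - m)) (\<epsilon> *\<^sub>R w t) \<le> A" for \<sigma> A
    proof -
      have u\<sigma>: "u t \<in> carr (X (\<sigma> + d1))" "w t \<in> carr (X (\<sigma> + d1 - m))" if "t \<in> {0..T'}" for t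
        using X_subset[OF _ uw(1)[OF that], of "\<sigma> + d1"] X_subset[OF _ uw(2)[OF that], of "\<sigma> + d1 - m"] \<sigma> by auto
      have "X1_norm X m T \<epsilon> (\<sigma> + d1) U \<le> 5 * A + 7 * A"
      proof (rule X1_norm_le[OF Us[OF \<sigma>]])
        fix t assume t: "t \<in> {0..T}"
        show "nrm (X (\<sigma> + d1)) (U t) \<le> 5 * A"
          unfolding U_def using T'' A t u\<sigma>(1) by (intro nrm_extend_le(2)) auto
        have wb: "nrm (X (\<sigma> + d1 - m)) (w x) \<le> A / \<epsilon>" if "x \<in> {0..T'}" for x
        proof -
          have "nrm (X (\<sigma> + d1 - m)) (\<epsilon> *\<^sub>R w x) \<le> A" using A that by blast
          then show ?thesis using nrm_scale[OF X_banach u\<sigma>(2)[OF that], of \<epsilon>] \<epsilon>' by (simp add: field_simps)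
        qed
        have Wt: "W t \<in> carr (X (\<sigma> + d1 - m))" "nrm (X (\<sigma> + d1 - m)) (W t) \<le> 7 * (A / \<epsilon>)"
          unfolding W_def using T'' t u\<sigma>(2) wb
          by (intro nrm_extend_deriv_le[where K = "A / \<epsilon>"]; auto)+
        show "nrm (X (\<sigma> + d1 - m)) (\<epsilon> *\<^sub>R W t) \<le> 7 * A"
          using Wt \<epsilon>' by (simp add: nrm_scale field_simps)
      qed
      then show ?thesis by simp
    qed
    obtain v where v: "lin_sol \<tau> \<epsilon> U f' v" using lin[OF \<tau> \<epsilon> X1_funI[OF Us[OF order_refl]] f'] by blast
    have "nrm (X \<sigma>) (v t) \<le> M * T' * (B + A * B0)"
      if \<sigma>: "\<sigma> \<in> {s0 + m..\<tau>}" and t: "t \<in> {0..T'}" and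
        AB: "\<forall>t\<in>{0..T'}. nrm (X (\<sigma> + d1)) (u t) \<le> A \<and> nrm (X (\<sigma> + d1 - m)) (\<epsilon> *\<^sub>R w t) \<le> A \<and>
             nrm (X (\<sigma> + d1')) (f t) \<le> B \<and> nrm (X (s0 + m + d1')) (f t) \<le> B0" for \<sigma> A B B0 t
    proof -
      have \<sigma>': "s0 + m \<le> \<sigma>" "\<sigma> \<le> \<tau>" using \<sigma> by auto
      have t': "t \<in> {0..T}" using t T'' by auto
      obtain v' where v': "\<forall>w. lin_sol \<sigma> \<epsilon> U f' w \<longrightarrow> (\<forall>t\<in>{0..T}. w t = v' t)"
        and est: "\<forall>t\<in>{0..T}. nrm (X \<sigma>) (v' t) \<le> C \<sigma> (X1_norm X m T \<epsilon> (s0 + m + d1) U) *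
          (I_func X (\<sigma> + d1') t f' 0 + X1_norm X m T \<epsilon> (\<sigma> + d1) U * I_func X (s0 + m + d1') t f' 0)"
        using lin[OF \<sigma>'(1) \<epsilon> X1_funI[OF Us[OF \<sigma>'(2)]] C_fun_X_mono[OF f']] \<sigma>' by auto
      have vv: "v t = v' t" using v' lin_sol_mono[OF v \<sigma>'(2)] t' by blast
      have f0: "f x \<in> carr (X (\<sigma> + d1'))" "f x \<in> carr (X (s0 + m + d1'))" if "x \<in> {0..T'}" for x
        using X_subset[OF _ uw(3)[OF that]] \<sigma>' by auto
      have t0: "(0::real) \<in> {0..T'}" using T'' by simp
      have u\<sigma>: "u 0 \<in> carr (X (\<sigma> + d1))" using X_subset[OF _ uw(1)[OF t0], of "\<sigma> + d1"] \<sigma>' by auto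
      have A0: "A \<ge> 0" using bspec[OF AB t0] nrm_nonneg[OF X_banach u\<sigma>] by linarith
      have B0: "B \<ge> 0" "B0 \<ge> 0"
        using bspec[OF AB t0] nrm_nonneg[OF X_banach f0(1)[OF t0]] nrm_nonneg[OF X_banach f0(2)[OF t0]] by linarith+
      have f'b: "f' x \<in> carr (X (\<sigma> + d1')) \<and> nrm (X (\<sigma> + d1')) (f' x) \<le> B"
        "f' x \<in> carr (X (s0 + m + d1')) \<and> nrm (X (s0 + m + d1')) (f' x) \<le> B0" if "x \<in> {0..t}" for x
        using AB f0 that t by (auto simp: f'_def)
      have t0': "0 \<le> t" using t by simp
      have I1: "I_func X (\<sigma> + d1') t f' 0 \<le> t * B" by (rule I_func_le[OF t0' f'b(1)])
      have I2: "I_func X (s0 + m + d1') t f' 0 \<le> t * B0" by (rule I_func_le[OF t0' f'b(2)])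
      have N1: "X1_norm X m T \<epsilon> (\<sigma> + d1) U \<le> 12 * A" using Ule[OF \<sigma>'(2)] AB by blast
      have N0: "X1_norm X m T \<epsilon> (s0 + m + d1) U \<le> 12 * R" by (rule Ule[OF \<tau>]) (use R in auto)
      have Nn: "0 \<le> X1_norm X m T \<epsilon> (\<sigma> + d1) U" by (rule X1_norm_nonneg[OF Us[OF \<sigma>'(2)]])
      have "X1_norm X m T \<epsilon> (\<sigma> + d1) U * I_func X (s0 + m + d1') t f' 0 \<le> X1_norm X m T \<epsilon> (\<sigma> + d1) U * (t * B0)"
        using I2 Nn by (rule mult_left_mono)
      also have "\<dots> \<le> 12 * A * (t * B0)" using N1 t B0 by (intro mult_right_mono) auto
      finally have "I_func X (\<sigma> + d1') t f' 0 + X1_norm X m T \<epsilon> (\<sigma> + d1) U * I_func X (s0 + m + d1') t f' 0 \<le> t * (B + 12 * A * B0)"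
        using I1 by (simp add: algebra_simps)
      also have "\<dots> \<le> T' * (12 * (B + A * B0))"
        using t A0 B0 by (intro mult_mono) auto
      finally have I: "I_func X (\<sigma> + d1') t f' 0 + X1_norm X m T \<epsilon> (\<sigma> + d1) U * I_func X (s0 + m + d1') t f' 0 \<le> T' * (12 * (B + A * B0))" (is "?I \<le> _") .
      have "C \<sigma> (X1_norm X m T \<epsilon> (s0 + m + d1) U) \<le> C \<tau> (12 * R)"
        using C N0 \<sigma>' unfolding nondecreasing2_def by blast
      then have Cle: "C \<sigma> (X1_norm X m T \<epsilon> (s0 + m + d1) U) \<le> \<bar>C \<tau> (12 * R)\<bar>" by simp
      have In: "0 \<le> T' * (12 * (B + A * B0))" using T'' A0 B0 by simp
      have vn: "0 \<le> nrm (X \<sigma>) (v t)"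
        using lin_sol_mono[OF v \<sigma>'(2)] t' by (intro nrm_nonneg) (auto simp: lin_sol_def C_fun_iff)
      have "nrm (X \<sigma>) (v t) \<le> \<bar>C \<tau> (12 * R)\<bar> * (T' * (12 * (B + A * B0)))"
      proof (cases "?I \<ge> 0")
        case True
        have "nrm (X \<sigma>) (v t) \<le> C \<sigma> (X1_norm X m T \<epsilon> (s0 + m + d1) U) * ?I"
          using est t' vv by simp
        also have "\<dots> \<le> \<bar>C \<tau> (12 * R)\<bar> * ?I" using Cle True by (rule mult_right_mono)
        also have "\<dots> \<le> \<bar>C \<tau> (12 * R)\<bar> * (T' * (12 * (B + A * B0)))" using I by (rule mult_left_mono) simp
        finally show ?thesis .
      next
        case False
        have fs: "C_fun {0..t} (X (\<tau> + d1')) f'" using C_fun_subset[OF _ f', of "{0..t}"] t' by auto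
        have "0 \<le> ?I" using Nn \<sigma>' \<tau> t0'
          by (intro add_nonneg_nonneg mult_nonneg_nonneg I_func_nonneg C_fun_X_mono[OF fs]) auto
        with False show ?thesis by simp
      qed
      then show ?thesis by (simp add: M_def algebra_simps)
    qed note est = this
    have der: "has_time_deriv (X (\<tau> - m)) {0..T'} v (f t - (1 / \<epsilon>) *\<^sub>R L \<epsilon> t (v t) - Fu \<epsilon> t (u t) (v t)) t"
      if t: "t \<in> {0..T'}" for t
    proof -
      have "t \<in> {0..T}" using t T'' by auto
      then obtain z where z: "has_time_deriv (X (\<tau> - m)) {0..T} v z t"
         "z + (1 / \<epsilon>) *\<^sub>R L \<epsilon> t (v t) + Fu \<epsilon> t (U t) (v t) = f' t"
        using v unfolding lin_sol_def solves_ivp_def by blast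
      have "U t = u t" "f' t = f t" using t by (auto simp: U_def f'_def extend_eq)
      then have "z = f t - (1 / \<epsilon>) *\<^sub>R L \<epsilon> t (v t) - Fu \<epsilon> t (u t) (v t)"
        using z(2) by (simp add: algebra_simps)
      then show ?thesis using has_time_deriv_subset[OF z(1), of "{0..T'}"] T'' by auto
    qed
    show "\<exists>v. C_fun {0..T'} (X \<tau>) v \<and> v 0 = 0 \<and>
        (\<forall>t\<in>{0..T'}. has_time_deriv (X (\<tau> - m)) {0..T'} v
           (f t - (1 / \<epsilon>) *\<^sub>R L \<epsilon> t (v t) - Fu \<epsilon> t (u t) (v t)) t) \<and>
        (\<forall>\<sigma>\<in>{s0 + m..\<tau>}. \<forall>A B B0.
          (\<forall>t\<in>{0..T'}. nrm (X (\<sigma> + d1)) (u t) \<le> A \<and> nrm (X (\<sigma> + d1 - m)) (\<epsilon> *\<^sub>R w t) \<le> A \<and>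
             nrm (X (\<sigma> + d1')) (f t) \<le> B \<and> nrm (X (s0 + m + d1')) (f t) \<le> B0) \<longrightarrow>
          (\<forall>t\<in>{0..T'}. nrm (X \<sigma>) (v t) \<le> M * T' * (B + A * B0)))"
    proof (intro exI[of _ v] conjI ballI allI impI)
      show "C_fun {0..T'} (X \<tau>) v"
        using v T'' C_fun_subset[of "X \<tau>" "{0..T}" v "{0..T'}"] by (auto simp: lin_sol_def)
      show "v 0 = 0" using v by (simp add: lin_sol_def solves_ivp_def)
    qed (use der est in blast)+
  qed
qed


subsection \<open>Uniqueness\<close>

text \<open>The solutions, for one value of \<open>\<epsilon>\<close>, whose existence and uniqueness are claimed.\<close>

definition is_sol :: "real \<Rightarrow> real \<Rightarrow> (real \<Rightarrow> 'a) \<Rightarrow> bool" where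
  "is_sol T' \<epsilon> u \<longleftrightarrow> C_fun {0..T'} (X (s + D)) u \<and>
     solves_ivp (X (s + D - m)) {0..T'} \<epsilon> (L \<epsilon>) (F \<epsilon>) (h \<epsilon>) (u0 \<epsilon>) u"

lemma h_cont: "\<epsilon> \<in> {0<..<\<epsilon>0} \<Longrightarrow> C_fun {0..T} (X (s + P)) (h \<epsilon>)"
  using data by (simp add: F_space_def)

lemma u0_carr: "\<epsilon> \<in> {0<..<\<epsilon>0} \<Longrightarrow> u0 \<epsilon> \<in> carr (X (s + P + m))"
  using data by (simp add: F_space_def)

lemma P_nonneg: "0 \<le> P" "D \<le> P"
  using P D_nonneg by auto

lemma sol_C1:
  assumes "is_sol T' \<epsilon> u" "\<epsilon> \<in> {0<..<\<epsilon>0}" "T' \<in> {0<..T}"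
  shows "C1_fun (X (s + D)) (X (s + D - m)) {0..T'} u (\<lambda>t. h \<epsilon> t - (1 / \<epsilon>) *\<^sub>R L \<epsilon> t (u t) - F \<epsilon> t (u t))"
  unfolding C1_fun_def
proof (intro conjI ballI)
  have sD: "s \<le> s + D" using D_nonneg by simp
  have I: "{0..T'} \<subseteq> {0..T}" using assms(3) by auto
  show u: "C_fun {0..T'} (X (s + D)) u" using assms(1) by (simp add: is_sol_def)
  have hc: "C_fun {0..T'} (X (s + D - m)) (h \<epsilon>)"
    using C_fun_X_mono[OF C_fun_subset[OF X_banach h_cont[OF assms(2)] I]] P_nonneg m by simp
  have Lc: "C_fun {0..T'} (X (s + D - m)) (\<lambda>t. (1 / \<epsilon>) *\<^sub>R L \<epsilon> t (u t))"
    by (rule C_fun_scale[OF X_banach C_fun_L[OF assms(2) sD u]]) simp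
  show "C_fun {0..T'} (X (s + D - m)) (\<lambda>t. h \<epsilon> t - (1 / \<epsilon>) *\<^sub>R L \<epsilon> t (u t) - F \<epsilon> t (u t))"
    by (rule C_fun_diff[OF X_banach C_fun_diff[OF X_banach hc Lc] C_fun_F[OF assms(2) sD u I]])
  fix t assume "t \<in> {0..T'}"
  then obtain w where w: "has_time_deriv (X (s + D - m)) {0..T'} u w t" "w + (1 / \<epsilon>) *\<^sub>R L \<epsilon> t (u t) + F \<epsilon> t (u t) = h \<epsilon> t"
    using assms(1) unfolding is_sol_def solves_ivp_def by blast
  have "w = h \<epsilon> t - (1 / \<epsilon>) *\<^sub>R L \<epsilon> t (u t) - F \<epsilon> t (u t)" using w(2) by (simp add: algebra_simps)
  with w(1) show "has_time_deriv (X (s + D - m)) {0..T'} u (h \<epsilon> t - (1 / \<epsilon>) *\<^sub>R L \<epsilon> t (u t) - F \<epsilon> t (u t)) t" by simp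
qed

text \<open>The difference \<open>p\<close> of two solutions solves the problem linearised at the first one, with the
  negative Taylor remainder of \<open>F\<close> as forcing. By tameness this remainder is bounded by a multiple of
  \<open>|p|\<^sub>s\<close>, and so Picard iteration of the linear estimate gives \<open>|p(t)|\<^sub>s \<le> B (c t)\<^sup>n / n!\<close> for all \<open>n\<close>.\<close>

lemma sol_unique:
  assumes \<epsilon>: "\<epsilon> \<in> {0<..<\<epsilon>0}" and T': "T' \<in> {0<..T}" and u: "is_sol T' \<epsilon> u" and v: "is_sol T' \<epsilon> v"
    and t: "t \<in> {0..T'}"
  shows "v t = u t"
proof -
  have T'': "0 < T'" "T' \<le> T" using T' by auto
  have I: "{0..T'} \<subseteq> {0..T}" using T' by auto
  have sD: "s \<le> s + D" using D_nonneg by simp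
  let ?E = "X (s + D)" and ?G = "X (s + D - m)"
  define du where "du t = h \<epsilon> t - (1 / \<epsilon>) *\<^sub>R L \<epsilon> t (u t) - F \<epsilon> t (u t)" for t
  define dv where "dv t = h \<epsilon> t - (1 / \<epsilon>) *\<^sub>R L \<epsilon> t (v t) - F \<epsilon> t (v t)" for t
  have uC: "C1_fun ?E ?G {0..T'} u du" unfolding du_def by (rule sol_C1[OF u \<epsilon> T'])
  have vC: "C1_fun ?E ?G {0..T'} v dv" unfolding dv_def by (rule sol_C1[OF v \<epsilon> T'])
  define p where "p t = v t - u t" for t
  define dp where "dp t = dv t - du t" for t
  have pC: "C1_fun ?E ?G {0..T'} p dp"
    using uC vC unfolding C1_fun_def p_def dp_def by (auto intro: C_fun_diff has_time_deriv_diff)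
  define U where "U = extend T' u"
  define W where "W = extend T' p"
  define dW where "dW = extend_deriv T' dp"
  define f where "f t = dW t + (1 / \<epsilon>) *\<^sub>R L \<epsilon> t (W t) + Fu \<epsilon> t (U t) (W t)" for t
  have UC: "C1_fun ?E ?G {0..T} U (extend_deriv T' du)"
    unfolding U_def by (rule C1_fun_extend[OF _ _ T'' uC]) auto
  have WC: "C1_fun ?E ?G {0..T} W dW"
    unfolding W_def dW_def by (rule C1_fun_extend[OF _ _ T'' pC]) auto
  have Wc: "C_fun {0..T} ?E W" and dWc: "C_fun {0..T} ?G dW" and Uc: "C_fun {0..T} ?E U"
    using WC UC by (auto simp: C1_fun_def)
  have Lc: "C_fun {0..T} ?G (\<lambda>t. (1 / \<epsilon>) *\<^sub>R L \<epsilon> t (W t))"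
    by (rule C_fun_scale[OF X_banach C_fun_L[OF \<epsilon> sD Wc]]) simp
  have fc: "C_fun {0..T} ?G f"
    unfolding f_def by (rule C_fun_add[OF X_banach C_fun_add[OF X_banach dWc Lc] C_fun_Fu[OF \<epsilon> sD Uc Wc]]) simp
  have lev: "s + d1' \<le> s + D - m" "s0 + m + d1' \<le> s + D - m" "s + d1 \<le> s + D" using D s by auto
  have t0: "(0::real) \<in> {0..T'}" using T'' by simp
  \<comment> \<open>The forcing \<open>f\<close> is defined on all of \<open>[0,T]\<close> so that \<open>W\<close> solves the linearised problem there, where
    uniqueness of its solution is assumed; on \<open>[0,T']\<close> it is the Taylor remainder.\<close>
  have "lin_sol s \<epsilon> U f W"
    unfolding lin_sol_def solves_ivp_def
  proof (intro conjI ballI)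
    show "C_fun {0..T} (X s) W" by (rule C_fun_X_mono[OF Wc sD])
    show "W 0 = 0" using u v T'' by (simp add: W_def extend_eq p_def is_sol_def solves_ivp_def)
    fix t assume t: "t \<in> {0..T}"
    have "has_time_deriv ?G {0..T} W (dW t) t" using WC t by (auto simp: C1_fun_def)
    then have "has_time_deriv (X (s - m)) {0..T} W (dW t) t"
      by (rule deriv_X_mono) (use t D_nonneg in auto)
    then show "\<exists>w. has_time_deriv (X (s - m)) {0..T} W w t \<and> w + (1 / \<epsilon>) *\<^sub>R L \<epsilon> t (W t) + Fu \<epsilon> t (U t) (W t) = f t"
      unfolding f_def by blast
  qed
  obtain C where "nondecreasing2 C" and lin: "\<forall>\<sigma> \<epsilon> u f. s0 + m \<le> \<sigma> \<longrightarrow> \<epsilon> \<in> {0<..<\<epsilon>0} \<longrightarrow> X1_fun X m T (\<sigma> + d1) u \<longrightarrow>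
      C_fun {0..T} (X (\<sigma> + d1')) f \<longrightarrow>
      (\<exists>v. lin_sol \<sigma> \<epsilon> u f v \<and> (\<forall>w. lin_sol \<sigma> \<epsilon> u f w \<longrightarrow> (\<forall>t\<in>{0..T}. w t = v t)) \<and>
        (\<forall>t\<in>{0..T}. nrm (X \<sigma>) (v t) \<le> C \<sigma> (X1_norm X m T \<epsilon> (s0 + m + d1) u) *
          (I_func X (\<sigma> + d1') t f 0 + X1_norm X m T \<epsilon> (\<sigma> + d1) u * I_func X (s0 + m + d1') t f 0)))"
    using linear_problem by (elim exE conjE)
  have US: "C1_fun (X (s + d1)) (X (s + d1 - m)) {0..T} U (extend_deriv T' du)"
    by (rule C1_fun_X_mono[OF UC lev(3)])
  have fS: "C_fun {0..T} (X (s + d1')) f" by (rule C_fun_X_mono[OF fc lev(1)])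
  define N where "N = X1_norm X m T \<epsilon> (s + d1) U"
  have N: "N \<ge> 0" unfolding N_def by (rule X1_norm_nonneg[OF US])
  define c0 where "c0 = C s (X1_norm X m T \<epsilon> (s0 + m + d1) U)"
  from lin[rule_format, OF s \<epsilon> X1_funI[OF US] fS]
  obtain z where z: "\<forall>w. lin_sol s \<epsilon> U f w \<longrightarrow> (\<forall>t\<in>{0..T}. w t = z t)"
    and est0: "\<forall>t\<in>{0..T}. nrm (X s) (z t) \<le> C s (X1_norm X m T \<epsilon> (s0 + m + d1) U) *
          (I_func X (s + d1') t f 0 + X1_norm X m T \<epsilon> (s + d1) U * I_func X (s0 + m + d1') t f 0)"
    by (elim exE conjE)
  have est: "nrm (X s) (p t) \<le> \<bar>c0\<bar> * (I_func X (s + d1') t f 0 + N * I_func X (s0 + m + d1') t f 0)" if t: "t \<in> {0..T'}" for t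
  proof -
    have t': "t \<in> {0..T}" using t T'' by auto
    have "z t = p t" using z \<open>lin_sol s \<epsilon> U f W\<close> t' t by (auto simp: W_def extend_eq)
    then have "nrm (X s) (p t) \<le> c0 * (I_func X (s + d1') t f 0 + N * I_func X (s0 + m + d1') t f 0)"
      using est0 t' unfolding c0_def N_def by metis
    also have "\<dots> \<le> \<bar>c0\<bar> * (I_func X (s + d1') t f 0 + N * I_func X (s0 + m + d1') t f 0)"
    proof (rule mult_right_mono)
      have fs: "C_fun {0..t} ?G f" using C_fun_subset[OF _ fc, of "{0..t}"] t' by auto
      show "0 \<le> I_func X (s + d1') t f 0 + N * I_func X (s0 + m + d1') t f 0"
        using N t lev by (intro add_nonneg_nonneg mult_nonneg_nonneg I_func_nonneg C_fun_X_mono[OF fs]) auto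
    qed simp
    finally show ?thesis .
  qed
  have uE: "C_fun {0..T'} ?E u" and pE: "C_fun {0..T'} ?E p" using uC pC by (auto simp: C1_fun_def)
  define B where "B = C_norm {0..T'} ?E p"
  define B' where "B' = C_norm {0..T'} ?E u + B"
  have pc: "p t \<in> carr ?E" and uc: "u t \<in> carr ?E" if "t \<in> {0..T'}" for t
    using C_fun_carr[OF _ pE that] C_fun_carr[OF _ uE that] by auto
  have pB: "nrm ?E (p t) \<le> B" if "t \<in> {0..T'}" for t unfolding B_def using nrm_le_C_norm[OF _ pE _ that] by simp
  have uB: "nrm ?E (u t) \<le> B' - B" if "t \<in> {0..T'}" for t unfolding B'_def using nrm_le_C_norm[OF _ uE _ that] by simp
  have B: "B \<ge> 0" using pB[OF t0] nrm_nonneg[OF X_banach pc[OF t0]] by simp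
  have B': "B' \<ge> B" using uB[OF t0] nrm_nonneg[OF X_banach uc[OF t0]] by simp
  obtain M where M: "M \<ge> 0" "\<forall>\<epsilon>\<in>{0<..<\<epsilon>0}. \<forall>t\<in>{0..T}. \<forall>u\<in>carr ?E. \<forall>p\<in>carr ?E. \<forall>v\<in>carr ?E.
      nrm (X s) u \<le> B' \<longrightarrow> nrm ?G (Fuu \<epsilon> t u p v) \<le>
       M * (nrm ?E p * nrm (X s) v + nrm (X s) p * nrm ?E v + nrm ?E u * nrm (X s) p * nrm (X s) v)"
    using Fuu_bound[OF sD, of B'] by (elim exE conjE)
  define K where "K = M * (2 * B + B' * B)"
  have K: "K \<ge> 0" unfolding K_def using M B B' by simp
  have pn: "0 \<le> nrm (X s) (p t)" "nrm (X s) (p t) \<le> nrm ?E (p t)" if "t \<in> {0..T'}" for t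
    using X_mono[OF sD pc[OF that]] nrm_nonneg[OF X_banach X_subset[OF sD pc[OF that]]] by auto
  have fb: "nrm ?G (f t) \<le> K * nrm (X s) (p t)" if t: "t \<in> {0..T'}" for t
  proof -
    have t': "t \<in> {0..T}" using t T'' by auto
    note C2 = F_C2[OF \<epsilon> sD] t'
    note pc' = pc[OF t] and uc' = uc[OF t]
    have Lv: "L \<epsilon> t (v t) = L \<epsilon> t (u t) + L \<epsilon> t (p t)"
      using L_linear[OF \<epsilon> sD, of t] pc' uc' unfolding bounded_linear_betw_def linear_betw_def p_def
      by (metis add.commute diff_add_cancel)
    have vt: "v t = u t + p t" by (simp add: p_def)
    have "f t = dp t + (1 / \<epsilon>) *\<^sub>R L \<epsilon> t (p t) + Fu \<epsilon> t (u t) (p t)"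
      using t by (simp add: f_def dW_def W_def U_def extend_eq extend_deriv_eq)
    also have "dp t = - (1 / \<epsilon>) *\<^sub>R L \<epsilon> t (p t) - (F \<epsilon> t (u t + p t) - F \<epsilon> t (u t))"
      unfolding dp_def dv_def du_def Lv by (simp add: scaleR_add_right vt)
    finally have f: "f t = - (F \<epsilon> t (u t + p t) - F \<epsilon> t (u t) - Fu \<epsilon> t (u t) (p t))" by simp
    have "nrm ?G (F \<epsilon> t (u t + p t) - F \<epsilon> t (u t) - Fu \<epsilon> t (u t) (p t)) \<le> K * nrm (X s) (p t)"
    proof (rule C2_taylor[OF _ _ C2 uc' pc'])
      fix x :: real assume x: "x \<in> {0..1}"
      have zc: "u t + x *\<^sub>R p t \<in> carr ?E" using uc' pc' by (simp add: banach_space_closed)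
      have "nrm ?E (u t + x *\<^sub>R p t) \<le> nrm ?E (u t) + nrm ?E (x *\<^sub>R p t)"
        using uc' pc' by (intro nrm_add banach_space_closed) auto
      also have "nrm ?E (x *\<^sub>R p t) \<le> 1 * B"
        unfolding nrm_scale[OF X_banach pc'] using x pB[OF t] nrm_nonneg[OF X_banach pc'] by (intro mult_mono) auto
      finally have zB: "nrm ?E (u t + x *\<^sub>R p t) \<le> B'" using uB[OF t] by simp
      then have zB': "nrm (X s) (u t + x *\<^sub>R p t) \<le> B'" using X_mono[OF sD zc] by simp
      have "nrm ?G (Fuu \<epsilon> t (u t + x *\<^sub>R p t) (p t) (p t)) \<le>
        M * (nrm ?E (p t) * nrm (X s) (p t) + nrm (X s) (p t) * nrm ?E (p t) + nrm ?E (u t + x *\<^sub>R p t) * nrm (X s) (p t) * nrm (X s) (p t))"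
        using M(2)[rule_format, OF \<epsilon> t' zc pc' pc' zB'] .
      also have "\<dots> \<le> M * (B * nrm (X s) (p t) + nrm (X s) (p t) * B + B' * B * nrm (X s) (p t))"
        using M(1) pB[OF t] pn[OF t] zB B B' nrm_nonneg[OF X_banach zc]
        by (intro mult_left_mono add_mono mult_right_mono mult_mono) auto
      also have "\<dots> = K * nrm (X s) (p t)" unfolding K_def by (simp add: algebra_simps)
      finally show "nrm ?G (Fuu \<epsilon> t (u t + x *\<^sub>R p t) (p t) (p t)) \<le> K * nrm (X s) (p t)" .
    qed auto
    moreover have "F \<epsilon> t (u t + p t) - F \<epsilon> t (u t) - Fu \<epsilon> t (u t) (p t) \<in> carr ?G"
      using uc' pc' by (intro banach_space_closed C2_carr[OF _ _ C2] C2_deriv_carr[OF _ _ C2]) auto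
    ultimately show ?thesis unfolding f by (simp only: nrm_minus[OF X_banach])
  qed
  have fcr: "f t \<in> carr ?G" if "t \<in> {0..T'}" for t using C_fun_carr[OF _ fc, of t] that T'' by auto
  define c where "c = \<bar>c0\<bar> * (1 + N) * K"
  have c: "c \<ge> 0" unfolding c_def using N K by simp
  have pow: "\<forall>t\<in>{0..T'}. nrm (X s) (p t) \<le> B * (c * t) ^ n / fact n" for n
  proof (induction n)
    case 0
    show ?case using order_trans[OF pn(2) pB] by simp
  next
    case (Suc n)
    show ?case
    proof
      fix t assume t: "t \<in> {0..T'}"
      define A where "A = K * B * c ^ n / fact n"
      have A: "A \<ge> 0" unfolding A_def using K B c by simp
      have low: "nrm (X \<sigma>) (f x) \<le> A * x ^ n" if "\<sigma> \<le> s + D - m" "x \<in> {0..t}" for \<sigma> x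
      proof -
        have x: "x \<in> {0..T'}" using that t by auto
        have "nrm (X \<sigma>) (f x) \<le> nrm ?G (f x)" using X_mono[OF that(1) fcr[OF x]] .
        also have "\<dots> \<le> K * nrm (X s) (p x)" by (rule fb[OF x])
        also have "\<dots> \<le> K * (B * (c * x) ^ n / fact n)" using Suc x K by (intro mult_left_mono) auto
        also have "\<dots> = A * x ^ n" unfolding A_def by (simp add: power_mult_distrib)
        finally show ?thesis .
      qed
      have t': "0 \<le> t" using t by simp
      have "nrm (X s) (p t) \<le> \<bar>c0\<bar> * (A * t ^ Suc n / Suc n + N * (A * t ^ Suc n / Suc n))"
        using N lev by (intro order_trans[OF est[OF t]] mult_left_mono add_mono I_func_le_power[OF t' A] low) auto
      also have "\<dots> = \<bar>c0\<bar> * (1 + N) * A * t ^ Suc n / Suc n" by (simp add: algebra_simps add_divide_distrib)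
      also have "\<dots> = B * (c * t) ^ Suc n / fact (Suc n)"
      proof -
        have "\<bar>c0\<bar> * (1 + N) * A = c * (B * c ^ n / fact n)"
          unfolding A_def by (simp add: c_def)
        then show ?thesis by (simp add: power_mult_distrib mult_ac)
      qed
      finally show "nrm (X s) (p t) \<le> B * (c * t) ^ Suc n / fact (Suc n)" .
    qed
  qed
  have "(\<lambda>n. B * ((c * t) ^ n / fact n)) \<longlonglongrightarrow> B * 0"
    using summable_LIMSEQ_zero[OF summable_exp[of "c * t"]] by (intro tendsto_mult_left) (simp add: field_simps)
  then have "nrm (X s) (p t) \<le> B * 0"
    by (rule tendsto_lowerbound) (use pow t in \<open>auto intro!: always_eventually\<close>)
  then have "nrm (X s) (p t) = 0" using pn(1)[OF t] by simp
  then have "p t = 0" using nrm_eq_0[OF X_banach X_subset[OF sD pc[OF t]]] by simp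
  then show ?thesis by (simp add: p_def)
qed


section \<open>Smoothing\<close>

lemma Sm_linear: "\<theta> \<ge> 1 \<Longrightarrow> \<sigma> \<le> \<sigma>' \<Longrightarrow> linear_betw (X \<sigma>) (X \<sigma>') (Sm \<theta>)"
  using smoothing unfolding smoothing_operators_def by (elim conjE) blast

lemma Sm_carr: "\<theta> \<ge> 1 \<Longrightarrow> u \<in> carr (X \<sigma>) \<Longrightarrow> Sm \<theta> u \<in> carr (X \<sigma>')"
proof -
  assume *: "\<theta> \<ge> 1" "u \<in> carr (X \<sigma>)"
  have "Sm \<theta> u \<in> carr (X (max \<sigma> \<sigma>'))"
    using Sm_linear[OF *(1), of \<sigma> "max \<sigma> \<sigma>'"] *(2) by (simp add: linear_betw_def)
  then show ?thesis by (rule X_subset[rotated]) simp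
qed

text \<open>\<open>K\<close> serves as the constant in both estimates for \<open>S\<^sub>\<theta>\<close> between the levels \<open>\<sigma> \<le> \<sigma>'\<close>; the
  approximation estimate is required only for \<open>\<sigma> < \<sigma>'\<close>.\<close>

definition smoothing_const :: "real \<Rightarrow> real \<Rightarrow> real \<Rightarrow> bool" where
  "smoothing_const K \<sigma> \<sigma>' \<longleftrightarrow>
     (\<forall>\<theta>\<ge>1. \<forall>u\<in>carr (X \<sigma>). nrm (X \<sigma>') (Sm \<theta> u) \<le> K * \<theta> powr (\<sigma>' - \<sigma>) * nrm (X \<sigma>) u) \<and>
     (\<sigma> < \<sigma>' \<longrightarrow> (\<forall>\<theta>\<ge>1. \<forall>u\<in>carr (X \<sigma>'). nrm (X \<sigma>) (u - Sm \<theta> u) \<le> K * \<theta> powr (\<sigma> - \<sigma>') * nrm (X \<sigma>') u))"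

lemma smoothing_const_mono:
  assumes "smoothing_const K \<sigma> \<sigma>'" "K \<le> K'"
  shows "smoothing_const K' \<sigma> \<sigma>'"
proof -
  have *: "K * \<theta> powr x * nrm (X y) u \<le> K' * \<theta> powr x * nrm (X y) u" if "u \<in> carr (X y)" for \<theta> x y u
    using assms(2) that by (intro mult_right_mono nrm_nonneg) auto
  show ?thesis
    using assms(1) unfolding smoothing_const_def
    by (intro conjI impI allI ballI; elim conjE) (blast intro: order_trans[OF _ *])+
qed

lemma smoothing_const_exists:
  assumes "\<sigma> \<le> \<sigma>'"
  shows "\<exists>K. smoothing_const K \<sigma> \<sigma>'"
proof -
  have 1: "\<forall>s s'. s \<le> s' \<longrightarrow> (\<exists>C. \<forall>\<theta>\<ge>1. \<forall>u\<in>carr (X s). nrm (X s') (Sm \<theta> u) \<le> C * \<theta> powr (s' - s) * nrm (X s) u)"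
    and 2: "\<forall>s s'. s < s' \<longrightarrow> (\<exists>C. \<forall>\<theta>\<ge>1. \<forall>u\<in>carr (X s'). nrm (X s) (u - Sm \<theta> u) \<le> C * \<theta> powr (s - s') * nrm (X s') u)"
    using smoothing unfolding smoothing_operators_def by simp_all
  obtain C where C: "\<forall>\<theta>\<ge>1. \<forall>u\<in>carr (X \<sigma>). nrm (X \<sigma>') (Sm \<theta> u) \<le> C * \<theta> powr (\<sigma>' - \<sigma>) * nrm (X \<sigma>) u"
    using 1[THEN spec, THEN spec, THEN mp, OF assms] by (elim exE)
  obtain C' where C': "\<sigma> < \<sigma>' \<longrightarrow> (\<forall>\<theta>\<ge>1. \<forall>u\<in>carr (X \<sigma>'). nrm (X \<sigma>) (u - Sm \<theta> u) \<le> C' * \<theta> powr (\<sigma> - \<sigma>') * nrm (X \<sigma>') u)"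
    using 2[THEN spec, THEN spec, of \<sigma> \<sigma>'] by (cases "\<sigma> < \<sigma>'") auto
  let ?K = "max C C'"
  have *: "A * \<theta> powr x * nrm (X y) u \<le> ?K * \<theta> powr x * nrm (X y) u" if "u \<in> carr (X y)" "A \<in> {C, C'}" for \<theta> x y u A
    using that by (intro mult_right_mono nrm_nonneg) auto
  have "nrm (X \<sigma>') (Sm \<theta> u) \<le> ?K * \<theta> powr (\<sigma>' - \<sigma>) * nrm (X \<sigma>) u" if "\<theta> \<ge> 1" "u \<in> carr (X \<sigma>)" for \<theta> u
    using C that by (intro order_trans[OF _ *[of u \<sigma> C]]) auto
  moreover have "nrm (X \<sigma>) (u - Sm \<theta> u) \<le> ?K * \<theta> powr (\<sigma> - \<sigma>') * nrm (X \<sigma>') u" if "\<sigma> < \<sigma>'" "\<theta> \<ge> 1" "u \<in> carr (X \<sigma>')" for \<theta> u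
    using C' that by (intro order_trans[OF _ *[of u \<sigma>' C']]) auto
  ultimately show ?thesis unfolding smoothing_const_def by blast
qed

lemma smoothing_const_finite:
  assumes "finite Q" "\<And>\<sigma> \<sigma>'. (\<sigma>, \<sigma>') \<in> Q \<Longrightarrow> \<sigma> \<le> \<sigma>'"
  shows "\<exists>K\<ge>1. \<forall>(\<sigma>, \<sigma>')\<in>Q. smoothing_const K \<sigma> \<sigma>'"
  using assms
proof (induction rule: finite_induct)
  case empty
  show ?case by (intro exI[of _ 1]) auto
next
  case (insert x Q)
  obtain K1 where K1: "K1 \<ge> 1" "\<forall>(\<sigma>, \<sigma>')\<in>Q. smoothing_const K1 \<sigma> \<sigma>'" using insert by auto
  obtain \<sigma> \<sigma>' where x: "x = (\<sigma>, \<sigma>')" by (cases x)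
  obtain K2 where K2: "smoothing_const K2 \<sigma> \<sigma>'" using smoothing_const_exists[of \<sigma> \<sigma>'] insert.prems x by auto
  show ?case
    using K1 K2 x by (intro exI[of _ "max K1 K2"]) (auto intro: smoothing_const_mono)
qed

lemma smoothing_constD:
  assumes "smoothing_const K \<sigma> \<sigma>'" "\<theta> \<ge> 1"
  shows "u \<in> carr (X \<sigma>) \<Longrightarrow> nrm (X \<sigma>') (Sm \<theta> u) \<le> K * \<theta> powr (\<sigma>' - \<sigma>) * nrm (X \<sigma>) u"
    and "\<sigma> < \<sigma>' \<Longrightarrow> u \<in> carr (X \<sigma>') \<Longrightarrow> nrm (X \<sigma>) (u - Sm \<theta> u) \<le> K * \<theta> powr (\<sigma> - \<sigma>') * nrm (X \<sigma>') u"
  using assms unfolding smoothing_const_def by blast+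

lemma Sm_bounded:
  assumes "\<theta> \<ge> 1" "\<sigma> \<le> \<sigma>'"
  shows "bounded_linear_betw (X \<sigma>) (X \<sigma>') (Sm \<theta>)"
proof -
  obtain K where "smoothing_const K \<sigma> \<sigma>'" using smoothing_const_exists[OF assms(2)] by blast
  from smoothing_constD(1)[OF this assms(1)] show ?thesis
    using Sm_linear[OF assms] unfolding bounded_linear_betw_def by blast
qed

section \<open>The iteration scheme\<close>

text \<open>The rate at which the residual decays in \<open>X\<^bsup>s+D-m\<^esup>\<close>. With \<open>\<alpha> = P/2\<close>, products of the size of \<open>v\<close> in
  \<open>X\<^sup>s\<close> and in \<open>X\<^bsup>s+P+m\<^esup>\<close> are of order \<open>\<theta>\<^sup>m\<close>.\<close>

definition \<alpha> :: real where "\<alpha> = P / 2"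

text \<open>The rate at which the residual may grow in \<open>X\<^bsup>s+P\<^esup>\<close>. It exceeds \<open>m\<close>, and \<open>\<beta> - (P + m - D)\<close>, the
  exponent of the smoothing error in \<open>X\<^bsup>s+D-m\<^esup>\<close>, is smaller than \<open>-\<alpha>\<close> by \<open>(\<alpha> - D)/2\<close>.\<close>

definition \<beta> :: real where "\<beta> = m + (\<alpha> - D) / 2"

lemma exponents: "P = 2 * \<alpha>" "D < \<alpha>" "0 < \<alpha>" "m < \<beta>" "0 < \<beta>" "(\<alpha> - D) / 2 \<le> \<beta>"
proof -
  show 1: "P = 2 * \<alpha>" "D < \<alpha>" using P by (auto simp: \<alpha>_def)
  then have 2: "0 < (\<alpha> - D) / 2" by simp
  show "0 < \<alpha>" using 1 D_nonneg by simp
  show "m < \<beta>" unfolding \<beta>_def using 2 by linarith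
  then show "0 < \<beta>" using m by linarith
  show "(\<alpha> - D) / 2 \<le> \<beta>" unfolding \<beta>_def using m by linarith
qed

text \<open>An approximate solution \<open>u\<close> with residual \<open>r\<close>, at stage \<open>\<theta>\<close> of the iteration. The term
  \<open>\<theta>\<^bsup>D-\<alpha>\<^esup>\<close> in the bound of \<open>u\<close> is the room left for the increments that are still to come.\<close>

definition approx_sol :: "real \<Rightarrow> real \<Rightarrow> real \<Rightarrow> real \<Rightarrow> real \<Rightarrow> (real \<Rightarrow> 'a) \<Rightarrow> (real \<Rightarrow> 'a) \<Rightarrow> bool" where
  "approx_sol T' \<epsilon> A B \<theta> u r \<longleftrightarrow>
     C_fun {0..T'} (X (s + P + m)) u \<and> C_fun {0..T'} (X (s + P)) r \<and> u 0 = u0 \<epsilon> \<and>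
     (\<forall>t\<in>{0..T'}.
        has_time_deriv (X (s + P)) {0..T'} u (h \<epsilon> t - r t - (1 / \<epsilon>) *\<^sub>R L \<epsilon> t (u t) - F \<epsilon> t (u t)) t \<and>
        nrm (X (s + D - m)) (r t) \<le> A * \<theta> powr - \<alpha> \<and>
        nrm (X (s + P)) (r t) \<le> A * \<theta> powr \<beta> \<and>
        nrm (X (s + D)) (u t) \<le> B + 1 - \<theta> powr (D - \<alpha>) \<and>
        nrm (X (s + P + m)) (u t) \<le> (B + 1) * \<theta> powr (P + m - \<alpha>))"

lemma data_bound:
  "\<exists>M\<ge>0. \<forall>\<epsilon>\<in>{0<..<\<epsilon>0}. nrm (X (s + P + m)) (u0 \<epsilon>) \<le> M \<and> (\<forall>t\<in>{0..T}. nrm (X (s + P)) (h \<epsilon> t) \<le> M)"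
proof -
  obtain M where M: "\<forall>\<epsilon>\<in>{0<..<\<epsilon>0}. F_norm X m T (s + P) (h \<epsilon>) (u0 \<epsilon>) \<le> M" using data_bdd by blast
  have "nrm (X (s + P + m)) (u0 \<epsilon>) \<le> \<bar>M\<bar> \<and> (\<forall>t\<in>{0..T}. nrm (X (s + P)) (h \<epsilon> t) \<le> \<bar>M\<bar>)" if \<epsilon>: "\<epsilon> \<in> {0<..<\<epsilon>0}" for \<epsilon>
  proof -
    note hc = h_cont[OF \<epsilon>]
    have le: "nrm (X (s + P)) (h \<epsilon> t) \<le> C_norm {0..T} (X (s + P)) (h \<epsilon>)" if "t \<in> {0..T}" for t
      using nrm_le_C_norm[OF _ hc _ that] by simp
    have "0 \<le> nrm (X (s + P)) (h \<epsilon> 0)" using C_fun_carr[OF _ hc, of 0] T by (intro nrm_nonneg) auto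
    then have 0: "0 \<le> C_norm {0..T} (X (s + P)) (h \<epsilon>)" using le[of 0] T by simp
    have "0 \<le> nrm (X (s + P + m)) (u0 \<epsilon>)" using u0_carr[OF \<epsilon>] by (intro nrm_nonneg) auto
    moreover have "C_norm {0..T} (X (s + P)) (h \<epsilon>) + nrm (X (s + P + m)) (u0 \<epsilon>) \<le> M"
      using M \<epsilon> by (simp add: F_norm_def)
    ultimately show ?thesis using 0 le by force
  qed
  then show ?thesis by (intro exI[of _ "\<bar>M\<bar>"]) auto
qed

text \<open>The iteration starts from the solution of the free problem.\<close>

lemma free_solution:
  "\<exists>M\<ge>0. \<forall>\<epsilon>\<in>{0<..<\<epsilon>0}. \<exists>u. C_fun {0..T} (X (s + P + m)) u \<and> u 0 = u0 \<epsilon> \<and>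
     (\<forall>t\<in>{0..T}. has_time_deriv (X (s + P)) {0..T} u (- (1 / \<epsilon>) *\<^sub>R L \<epsilon> t (u t)) t \<and> nrm (X (s + P + m)) (u t) \<le> M)"
proof -
  obtain U where U: "\<forall>\<epsilon>\<in>{0<..<\<epsilon>0}. evolution_operator X m s0 \<epsilon> (L \<epsilon>) (U \<epsilon>)"
    "\<forall>s\<ge>s0. \<exists>M. \<forall>\<epsilon>\<in>{0<..<\<epsilon>0}. \<forall>t\<in>{-T..T}. op_norm (X s) (X s) (U \<epsilon> t) \<le> M"
    using asm1 unfolding assumption1_def by (elim conjE exE)
  have lev: "s0 \<le> s + P + m" "s0 \<le> s + P" using s m P_nonneg by auto
  obtain MU where MU: "\<forall>\<epsilon>\<in>{0<..<\<epsilon>0}. \<forall>t\<in>{-T..T}. op_norm (X (s + P + m)) (X (s + P + m)) (U \<epsilon> t) \<le> MU"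
    using U(2) lev(1) by blast
  obtain Md where Md: "Md \<ge> 0" "\<forall>\<epsilon>\<in>{0<..<\<epsilon>0}. nrm (X (s + P + m)) (u0 \<epsilon>) \<le> Md \<and> (\<forall>t\<in>{0..T}. nrm (X (s + P)) (h \<epsilon> t) \<le> Md)"
    using data_bound by blast
  show ?thesis
  proof (intro exI[of _ "\<bar>MU\<bar> * Md"] conjI ballI)
    show "0 \<le> \<bar>MU\<bar> * Md" using Md by simp
    fix \<epsilon> assume \<epsilon>: "\<epsilon> \<in> {0<..<\<epsilon>0}"
    have ev: "evolution_operator X m s0 \<epsilon> (L \<epsilon>) (U \<epsilon>)" using U(1) \<epsilon> by blast
    have op: "continuous_op euclidean (X (s + P + m)) (X (s + P + m)) (U \<epsilon>)"
      using ev lev(1) unfolding evolution_operator_def by blast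
    have "solves_ivp (X (s + P)) UNIV \<epsilon> (L \<epsilon>) (\<lambda>_ _. 0) (\<lambda>_. 0) (u0 \<epsilon>) (\<lambda>t. U \<epsilon> t (u0 \<epsilon>))"
      using ev lev(2) u0_carr[OF \<epsilon>] unfolding evolution_operator_def by blast
    then have init: "U \<epsilon> 0 (u0 \<epsilon>) = u0 \<epsilon>" and eq: "\<exists>w. has_time_deriv (X (s + P)) UNIV (\<lambda>t. U \<epsilon> t (u0 \<epsilon>)) w t \<and>
        w + (1 / \<epsilon>) *\<^sub>R L \<epsilon> t (U \<epsilon> t (u0 \<epsilon>)) + 0 = 0" for t
      unfolding solves_ivp_def by auto
    show "\<exists>u. C_fun {0..T} (X (s + P + m)) u \<and> u 0 = u0 \<epsilon> \<and>
     (\<forall>t\<in>{0..T}. has_time_deriv (X (s + P)) {0..T} u (- (1 / \<epsilon>) *\<^sub>R L \<epsilon> t (u t)) t \<and> nrm (X (s + P + m)) (u t) \<le> \<bar>MU\<bar> * Md)"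
    proof (intro exI[of _ "\<lambda>t. U \<epsilon> t (u0 \<epsilon>)"] conjI ballI init)
      show "C_fun {0..T} (X (s + P + m)) (\<lambda>t. U \<epsilon> t (u0 \<epsilon>))"
        using C_fun_continuous_op[OF _ _ op _ C_fun_const[OF _ u0_carr[OF \<epsilon>]], of "{0..T}" "\<lambda>t. t"] by simp
      fix t assume t: "t \<in> {0..T}"
      obtain w where w: "has_time_deriv (X (s + P)) UNIV (\<lambda>t. U \<epsilon> t (u0 \<epsilon>)) w t"
        "w + (1 / \<epsilon>) *\<^sub>R L \<epsilon> t (U \<epsilon> t (u0 \<epsilon>)) + 0 = 0" using eq[of t] by blast
      have "w = - (1 / \<epsilon>) *\<^sub>R L \<epsilon> t (U \<epsilon> t (u0 \<epsilon>))" using w(2) by (simp add: eq_neg_iff_add_eq_0)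
      then show "has_time_deriv (X (s + P)) {0..T} (\<lambda>t. U \<epsilon> t (u0 \<epsilon>)) (- (1 / \<epsilon>) *\<^sub>R L \<epsilon> t (U \<epsilon> t (u0 \<epsilon>))) t"
        using has_time_deriv_subset[OF w(1)] by simp
      have "nrm (X (s + P + m)) (U \<epsilon> t (u0 \<epsilon>)) \<le> op_norm (X (s + P + m)) (X (s + P + m)) (U \<epsilon> t) * nrm (X (s + P + m)) (u0 \<epsilon>)"
        using op u0_carr[OF \<epsilon>] by (intro nrm_le_op_norm) (auto simp: continuous_op_def)
      also have "op_norm (X (s + P + m)) (X (s + P + m)) (U \<epsilon> t) \<le> MU"
        using MU \<epsilon> t T by simp
      then have "op_norm (X (s + P + m)) (X (s + P + m)) (U \<epsilon> t) * nrm (X (s + P + m)) (u0 \<epsilon>) \<le> \<bar>MU\<bar> * Md"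
        using Md \<epsilon> nrm_nonneg[OF X_banach u0_carr[OF \<epsilon>]] by (intro mult_mono) auto
      finally show "nrm (X (s + P + m)) (U \<epsilon> t (u0 \<epsilon>)) \<le> \<bar>MU\<bar> * Md" .
    qed
  qed
qed

lemma initial_approximation:
  "\<exists>B\<ge>0. \<forall>\<theta>\<ge>1. \<exists>A>0. \<forall>T'\<in>{0<..T}. \<forall>\<epsilon>\<in>{0<..<\<epsilon>0}. \<exists>u r. approx_sol T' \<epsilon> A B \<theta> u r"
proof -
  obtain B where B: "B \<ge> 0" and free: "\<forall>\<epsilon>\<in>{0<..<\<epsilon>0}. \<exists>u. C_fun {0..T} (X (s + P + m)) u \<and> u 0 = u0 \<epsilon> \<and>
     (\<forall>t\<in>{0..T}. has_time_deriv (X (s + P)) {0..T} u (- (1 / \<epsilon>) *\<^sub>R L \<epsilon> t (u t)) t \<and> nrm (X (s + P + m)) (u t) \<le> B)"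
    using free_solution by (elim exE conjE)
  obtain Md where Md: "Md \<ge> 0" "\<forall>\<epsilon>\<in>{0<..<\<epsilon>0}. nrm (X (s + P + m)) (u0 \<epsilon>) \<le> Md \<and> (\<forall>t\<in>{0..T}. nrm (X (s + P)) (h \<epsilon> t) \<le> Md)"
    using data_bound by blast
  have lev: "s \<le> s + P + m" using P_nonneg m by simp
  have lev2: "s + P + m - m = s + P" by simp
  obtain cF where cF: "cF \<ge> 0" "\<forall>\<epsilon>\<in>{0<..<\<epsilon>0}. \<forall>t\<in>{0..T}. \<forall>u\<in>carr (X (s + P + m)).
     nrm (X s) u \<le> B \<longrightarrow> nrm (X (s + P)) (F \<epsilon> t u) \<le> cF * nrm (X (s + P + m)) u"
    using F_bound[OF lev, of B] unfolding lev2 by blast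
  define Mr where "Mr = Md + cF * B"
  have Mr: "Mr \<ge> 0" unfolding Mr_def using Md cF B by simp
  show ?thesis
  proof (rule exI[of _ B], intro conjI B allI impI)
    fix \<theta> :: real assume \<theta>: "\<theta> \<ge> 1"
    \<comment> \<open>large enough to turn a mere bound \<open>Mr\<close> for the first residual into the decay required at stage \<open>\<theta>\<close>\<close>
    define A where "A = Mr * \<theta> powr \<alpha> + 1"
    have A: "A > 0" unfolding A_def using Mr \<theta> by (simp add: add_nonneg_pos)
    have "Mr = (Mr * \<theta> powr \<alpha>) * \<theta> powr - \<alpha>" using \<theta> by (simp add: powr_minus field_simps)
    also have "\<dots> \<le> A * \<theta> powr - \<alpha>" unfolding A_def by (intro mult_right_mono) auto
    finally have A1: "Mr \<le> A * \<theta> powr - \<alpha>" .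
    have "\<theta> powr - \<alpha> \<le> \<theta> powr \<beta>" using \<theta> exponents by (intro powr_mono) auto
    then have A2: "Mr \<le> A * \<theta> powr \<beta>" using A1 A by (meson order_trans mult_left_mono less_imp_le)
    have th1: "\<theta> powr (D - \<alpha>) \<le> 1" using \<theta> exponents powr_mono[of "D - \<alpha>" 0 \<theta>] by simp
    have th2: "1 \<le> \<theta> powr (P + m - \<alpha>)" using \<theta> exponents m powr_mono[of 0 "P + m - \<alpha>" \<theta>] by simp
    have "\<exists>u r. approx_sol T' \<epsilon> A B \<theta> u r" if T': "T' \<in> {0<..T}" and \<epsilon>: "\<epsilon> \<in> {0<..<\<epsilon>0}" for T' \<epsilon>
    proof -
      obtain u where u: "C_fun {0..T} (X (s + P + m)) u" "u 0 = u0 \<epsilon>" and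
        ut: "\<forall>t\<in>{0..T}. has_time_deriv (X (s + P)) {0..T} u (- (1 / \<epsilon>) *\<^sub>R L \<epsilon> t (u t)) t \<and> nrm (X (s + P + m)) (u t) \<le> B"
        using free \<epsilon> by blast
      have I: "{0..T'} \<subseteq> {0..T}" using T' by auto
      define r where "r t = h \<epsilon> t - F \<epsilon> t (u t)" for t
      have u': "C_fun {0..T'} (X (s + P + m)) u" using C_fun_subset[OF _ u(1) I] by simp
      have Fc: "C_fun {0..T'} (X (s + P)) (\<lambda>t. F \<epsilon> t (u t))" using C_fun_F[OF \<epsilon> lev u' I] by simp
      have hc: "C_fun {0..T'} (X (s + P)) (h \<epsilon>)" using C_fun_subset[OF _ h_cont[OF \<epsilon>] I] by simp
      have r: "C_fun {0..T'} (X (s + P)) r" unfolding r_def by (rule C_fun_diff[OF _ hc Fc]) simp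
      have "approx_sol T' \<epsilon> A B \<theta> u r"
        unfolding approx_sol_def
      proof (intro conjI ballI u' r u(2))
        fix t assume t: "t \<in> {0..T'}"
        then have t': "t \<in> {0..T}" using I by auto
        have eq: "h \<epsilon> t - r t - (1 / \<epsilon>) *\<^sub>R L \<epsilon> t (u t) - F \<epsilon> t (u t) = - (1 / \<epsilon>) *\<^sub>R L \<epsilon> t (u t)"
          by (simp add: r_def)
        show "has_time_deriv (X (s + P)) {0..T'} u (h \<epsilon> t - r t - (1 / \<epsilon>) *\<^sub>R L \<epsilon> t (u t) - F \<epsilon> t (u t)) t"
          unfolding eq using ut t' has_time_deriv_subset[OF _ I] by blast
        have uc: "u t \<in> carr (X (s + P + m))" using C_fun_carr[OF _ u' t] by simp
        have uB: "nrm (X (s + P + m)) (u t) \<le> B" using ut t' by blast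
        have us: "nrm (X s) (u t) \<le> B" using X_mono[OF lev uc] uB by simp
        have "nrm (X (s + P)) (r t) \<le> nrm (X (s + P)) (h \<epsilon> t) + nrm (X (s + P)) (F \<epsilon> t (u t))"
          unfolding r_def using C_fun_carr[OF _ hc t] C_fun_carr[OF _ Fc t] by (intro nrm_diff) auto
        also have "\<dots> \<le> Md + cF * nrm (X (s + P + m)) (u t)"
          using Md(2) cF(2) \<epsilon> t' uc us by (intro add_mono) auto
        also have "\<dots> \<le> Mr" unfolding Mr_def using uB cF(1) by (simp add: mult_left_mono)
        finally have rM: "nrm (X (s + P)) (r t) \<le> Mr" .
        then show "nrm (X (s + P)) (r t) \<le> A * \<theta> powr \<beta>" using A2 by simp
        have "nrm (X (s + D - m)) (r t) \<le> nrm (X (s + P)) (r t)"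
          using P_nonneg m C_fun_carr[OF _ r t] by (intro X_mono) auto
        then show "nrm (X (s + D - m)) (r t) \<le> A * \<theta> powr - \<alpha>" using rM A1 by simp
        have "nrm (X (s + D)) (u t) \<le> nrm (X (s + P + m)) (u t)"
          using P_nonneg m uc by (intro X_mono) auto
        then show "nrm (X (s + D)) (u t) \<le> B + 1 - \<theta> powr (D - \<alpha>)" using uB th1 by simp
        have "B \<le> (B + 1) * 1" by simp
        also have "\<dots> \<le> (B + 1) * \<theta> powr (P + m - \<alpha>)" using th2 B by (intro mult_left_mono) auto
        finally show "nrm (X (s + P + m)) (u t) \<le> (B + 1) * \<theta> powr (P + m - \<alpha>)" using uB by simp
      qed
      then show ?thesis by blast
    qed
    then show "\<exists>A>0. \<forall>T'\<in>{0<..T}. \<forall>\<epsilon>\<in>{0<..<\<epsilon>0}. \<exists>u r. approx_sol T' \<epsilon> A B \<theta> u r" using A by blast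
  qed
qed

text \<open>The increment of the scheme. The loss of derivatives in the linear estimate is paid for by smoothing:
  the coefficient \<open>S\<^sub>\<theta> u\<close> is controlled by \<open>u\<close> in \<open>X\<^bsup>s+D\<^esup>\<close> and by \<open>\<epsilon> \<partial>\<^sub>t u\<close> in \<open>X\<^bsup>s+D-m\<^esup>\<close>, the
  right-hand side \<open>S\<^sub>\<theta> r\<close> by \<open>r\<close> in \<open>X\<^bsup>s+D-m\<^esup>\<close>. Here \<open>\<epsilon> \<partial>\<^sub>t u\<close> is bounded through the equation, uniformly
  in \<open>\<epsilon>\<close>.\<close>

lemma increment:
  assumes A: "A > 0" and B: "B \<ge> 0"
  shows "\<exists>M\<ge>0. \<forall>T'\<in>{0<..T}. \<forall>\<epsilon>\<in>{0<..<\<epsilon>0}. \<forall>\<theta>\<ge>1. \<forall>u r. approx_sol T' \<epsilon> A B \<theta> u r \<longrightarrow>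
    (\<exists>v. C_fun {0..T'} (X (s + P + m)) v \<and> v 0 = 0 \<and>
        (\<forall>t\<in>{0..T'}. has_time_deriv (X (s + P)) {0..T'} v
           (Sm \<theta> (r t) - (1 / \<epsilon>) *\<^sub>R L \<epsilon> t (v t) - Fu \<epsilon> t (Sm \<theta> (u t)) (v t)) t \<and>
           (\<forall>\<sigma>\<in>{s, s + D, s + P + m}. nrm (X \<sigma>) (v t) \<le> M * T' * \<theta> powr (\<sigma> - s - \<alpha>))))"
proof -
  let ?S = "{s, s + D, s + P + m}"
  let ?G = "X (s + D - m)"
  have S: "s \<le> \<sigma>" "\<sigma> \<le> s + P + m" if "\<sigma> \<in> ?S" for \<sigma> using that P_nonneg D_nonneg m by auto
  define Q where "Q = ((\<lambda>\<sigma>. (s + D, \<sigma> + D)) ` ?S) \<union> ((\<lambda>\<sigma>. (s + D - m, \<sigma> + D - m)) ` ?S)"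
  have "\<exists>K\<ge>1. \<forall>(\<sigma>, \<sigma>')\<in>Q. smoothing_const K \<sigma> \<sigma>'"
    unfolding Q_def using S by (intro smoothing_const_finite) fastforce+
  then obtain K where K: "K \<ge> 1" "\<forall>(\<sigma>, \<sigma>')\<in>Q. smoothing_const K \<sigma> \<sigma>'" by blast
  have K1: "nrm (X (\<sigma> + D)) (Sm \<theta> u) \<le> K * \<theta> powr (\<sigma> - s) * nrm (X (s + D)) u"
    if "\<sigma> \<in> ?S" "\<theta> \<ge> 1" "u \<in> carr (X (s + D))" for \<sigma> \<theta> u
  proof -
    have "(s + D, \<sigma> + D) \<in> Q" using that unfolding Q_def by blast
    with K(2) have "smoothing_const K (s + D) (\<sigma> + D)" by blast
    from smoothing_constD(1)[OF this that(2,3)] show ?thesis by simp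
  qed
  have K2: "nrm (X (\<sigma> + D - m)) (Sm \<theta> u) \<le> K * \<theta> powr (\<sigma> - s) * nrm ?G u"
    if "\<sigma> \<in> ?S" "\<theta> \<ge> 1" "u \<in> carr ?G" for \<sigma> \<theta> u
  proof -
    have "(s + D - m, \<sigma> + D - m) \<in> Q" using that unfolding Q_def by blast
    with K(2) have "smoothing_const K (s + D - m) (\<sigma> + D - m)" by blast
    from smoothing_constD(1)[OF this that(2,3)] show ?thesis by simp
  qed
  have sD: "s \<le> s + D" and sN: "s \<le> s + P + m" "s0 + m \<le> s + P + m" and DN: "s + D \<le> s + P + m" "s + D - m \<le> s + P"
    using D_nonneg P_nonneg m s by auto
  obtain cL where cL: "cL \<ge> 0" "\<forall>\<epsilon>\<in>{0<..<\<epsilon>0}. \<forall>t\<in>{0..T}. \<forall>u\<in>carr (X (s + D)). nrm ?G (L \<epsilon> t u) \<le> cL * nrm (X (s + D)) u"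
    using L_bound[OF sD] by blast
  obtain cF where cF: "cF \<ge> 0" "\<forall>\<epsilon>\<in>{0<..<\<epsilon>0}. \<forall>t\<in>{0..T}. \<forall>u\<in>carr (X (s + D)). nrm (X s) u \<le> B + 1 \<longrightarrow> nrm ?G (F \<epsilon> t u) \<le> cF * nrm (X (s + D)) u"
    using F_bound[OF sD, of "B + 1"] by blast
  obtain Md where Md: "Md \<ge> 0" "\<forall>\<epsilon>\<in>{0<..<\<epsilon>0}. nrm (X (s + P + m)) (u0 \<epsilon>) \<le> Md \<and> (\<forall>t\<in>{0..T}. nrm (X (s + P)) (h \<epsilon> t) \<le> Md)"
    using data_bound by blast
  \<comment> \<open>a common bound for \<open>u\<close> in \<open>X\<^bsup>s+D\<^esup>\<close> and for \<open>\<epsilon> \<partial>\<^sub>t u\<close> in \<open>X\<^bsup>s+D-m\<^esup>\<close>\<close>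
  define Kw where "Kw = (B + 1) + \<epsilon>0 * (Md + A + cF * (B + 1)) + cL * (B + 1)"
  have pos: "0 \<le> \<epsilon>0 * (Md + A + cF * (B + 1))" "0 \<le> cL * (B + 1)" "0 \<le> cF * (B + 1)" using eps0 Md A cF B cL by auto
  have Kw: "Kw \<ge> B + 1" "Kw \<ge> 0" "Kw \<ge> \<epsilon>0 * (Md + A + cF * (B + 1)) + cL * (B + 1)" unfolding Kw_def using B pos by auto
  obtain M where M: "M \<ge> 0" and lin: "\<forall>T' \<epsilon> u w f. T' \<in> {0<..T} \<longrightarrow> \<epsilon> \<in> {0<..<\<epsilon>0} \<longrightarrow>
      C1_fun (X (s + P + m + d1)) (X (s + P + m + d1 - m)) {0..T'} u w \<longrightarrow> C_fun {0..T'} (X (s + P + m + d1')) f \<longrightarrow>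
      (\<forall>t\<in>{0..T'}. nrm (X (s0 + m + d1)) (u t) \<le> K * Kw \<and> nrm (X (s0 + m + d1 - m)) (\<epsilon> *\<^sub>R w t) \<le> K * Kw) \<longrightarrow>
      (\<exists>v. C_fun {0..T'} (X (s + P + m)) v \<and> v 0 = 0 \<and>
        (\<forall>t\<in>{0..T'}. has_time_deriv (X (s + P + m - m)) {0..T'} v
           (f t - (1 / \<epsilon>) *\<^sub>R L \<epsilon> t (v t) - Fu \<epsilon> t (u t) (v t)) t) \<and>
        (\<forall>\<sigma>\<in>{s0 + m..s + P + m}. \<forall>A B B0.
          (\<forall>t\<in>{0..T'}. nrm (X (\<sigma> + d1)) (u t) \<le> A \<and> nrm (X (\<sigma> + d1 - m)) (\<epsilon> *\<^sub>R w t) \<le> A \<and>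
             nrm (X (\<sigma> + d1')) (f t) \<le> B \<and> nrm (X (s0 + m + d1')) (f t) \<le> B0) \<longrightarrow>
          (\<forall>t\<in>{0..T'}. nrm (X \<sigma>) (v t) \<le> M * T' * (B + A * B0))))"
    using linear_solve[OF sN(2), of "K * Kw"] by (elim exE conjE)
  define M' where "M' = M * (K * A + K * Kw * (K * A))"
  have M': "M' \<ge> 0" unfolding M'_def using M K(1) A Kw by simp
  show ?thesis
  proof (intro exI[of _ M'] conjI M' ballI allI impI)
    fix T' \<epsilon> \<theta> u r assume T': "T' \<in> {0<..T}" and \<epsilon>: "\<epsilon> \<in> {0<..<\<epsilon>0}" and \<theta>: "1 \<le> (\<theta>::real)" and ap: "approx_sol T' \<epsilon> A B \<theta> u r"
    have T'': "0 < T'" "T' \<le> T" and \<epsilon>': "0 < \<epsilon>" "\<epsilon> < \<epsilon>0" using T' \<epsilon> by auto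
    have I: "{0..T'} \<subseteq> {0..T}" using T' by auto
    define w where "w t = h \<epsilon> t - r t - (1 / \<epsilon>) *\<^sub>R L \<epsilon> t (u t) - F \<epsilon> t (u t)" for t
    have u: "C_fun {0..T'} (X (s + P + m)) u" and r: "C_fun {0..T'} (X (s + P)) r"
      and der: "\<And>t. t \<in> {0..T'} \<Longrightarrow> has_time_deriv (X (s + P)) {0..T'} u (w t) t"
      and rl: "\<And>t. t \<in> {0..T'} \<Longrightarrow> nrm ?G (r t) \<le> A * \<theta> powr - \<alpha>"
      and ul: "\<And>t. t \<in> {0..T'} \<Longrightarrow> nrm (X (s + D)) (u t) \<le> B + 1 - \<theta> powr (D - \<alpha>)"
      using ap unfolding approx_sol_def w_def by auto
    have uB: "nrm (X (s + D)) (u t) \<le> B + 1" if "t \<in> {0..T'}" for t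
      using ul[OF that] powr_ge_zero[of \<theta> "D - \<alpha>"] by linarith
    have hc: "C_fun {0..T'} (X (s + P)) (h \<epsilon>)" using C_fun_subset[OF _ h_cont[OF \<epsilon>] I] by simp
    have Lc: "C_fun {0..T'} (X (s + P)) (\<lambda>t. (1 / \<epsilon>) *\<^sub>R L \<epsilon> t (u t))"
      using C_fun_scale[OF _ C_fun_L[OF \<epsilon> sN(1) u], of "\<lambda>_. 1 / \<epsilon>"] by simp
    have Fc: "C_fun {0..T'} (X (s + P)) (\<lambda>t. F \<epsilon> t (u t))" using C_fun_F[OF \<epsilon> sN(1) u I] by simp
    have wc: "C_fun {0..T'} (X (s + P)) w" unfolding w_def
      by (rule C_fun_diff[OF _ C_fun_diff[OF _ C_fun_diff[OF _ hc r] Lc] Fc]) simp_all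
    note cr = C_fun_carr[OF X_banach u] C_fun_carr[OF X_banach r] C_fun_carr[OF X_banach wc]
    have crD: "u t \<in> carr (X (s + D))" "r t \<in> carr ?G" "w t \<in> carr ?G" if "t \<in> {0..T'}" for t
      using X_subset[OF DN(1) cr(1)[OF that]] X_subset[OF DN(2) cr(2)[OF that]] X_subset[OF DN(2) cr(3)[OF that]] by auto
    have \<theta>a: "\<theta> powr - \<alpha> \<le> 1" using \<theta> exponents powr_mono[of "- \<alpha>" 0 \<theta>] by simp
    have wK: "nrm ?G (\<epsilon> *\<^sub>R w t) \<le> Kw" if t: "t \<in> {0..T'}" for t
    proof -
      have t': "t \<in> {0..T}" using t I by auto
      have h1: "h \<epsilon> t \<in> carr ?G" using X_subset[OF DN(2) C_fun_carr[OF _ hc t]] by simp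
      have h2: "nrm ?G (h \<epsilon> t) \<le> Md" using X_mono[OF DN(2) C_fun_carr[OF _ hc t]] Md(2) \<epsilon> t' by force
      have r2: "nrm ?G (r t) \<le> A"
      proof -
        have "A * \<theta> powr - \<alpha> \<le> A * 1" using \<theta>a A by (intro mult_left_mono) auto
        then show ?thesis using rl[OF t] by simp
      qed
      have L1: "L \<epsilon> t (u t) \<in> carr ?G" using L_linear[OF \<epsilon> sD, of t] crD(1)[OF t] by (auto simp: bounded_linear_betw_def linear_betw_def)
      have L2: "nrm ?G (L \<epsilon> t (u t)) \<le> cL * (B + 1)"
        using cL(2)[rule_format, OF \<epsilon> t' crD(1)[OF t]] mult_left_mono[OF uB[OF t] cL(1)] by simp
      have us: "nrm (X s) (u t) \<le> B + 1" using X_mono[OF sD crD(1)[OF t]] uB[OF t] by simp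
      have F1: "F \<epsilon> t (u t) \<in> carr ?G" using C2_carr[OF _ _ F_C2[OF \<epsilon> sD] t' crD(1)[OF t]] by simp
      have F2: "nrm ?G (F \<epsilon> t (u t)) \<le> cF * (B + 1)"
        using cF(2)[rule_format, OF \<epsilon> t' crD(1)[OF t] us] mult_left_mono[OF uB[OF t] cF(1)] by simp
      let ?a = "h \<epsilon> t - r t - F \<epsilon> t (u t)"
      have ac: "?a \<in> carr ?G" using h1 crD(2)[OF t] F1 by (simp add: banach_space_closed)
      have "nrm ?G ?a \<le> nrm ?G (h \<epsilon> t - r t) + nrm ?G (F \<epsilon> t (u t))"
        using h1 crD(2)[OF t] F1 by (intro nrm_diff) (auto simp: banach_space_closed)
      also have "nrm ?G (h \<epsilon> t - r t) \<le> nrm ?G (h \<epsilon> t) + nrm ?G (r t)"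
        using h1 crD(2)[OF t] by (intro nrm_diff) auto
      finally have a: "nrm ?G ?a \<le> Md + A + cF * (B + 1)" using h2 r2 F2 by simp
      have "\<epsilon> *\<^sub>R w t = \<epsilon> *\<^sub>R ?a - L \<epsilon> t (u t)" unfolding w_def using \<epsilon>' by (simp add: algebra_simps)
      then have "nrm ?G (\<epsilon> *\<^sub>R w t) \<le> nrm ?G (\<epsilon> *\<^sub>R ?a) + nrm ?G (L \<epsilon> t (u t))"
        using nrm_diff[OF X_banach banach_space_scale[OF X_banach ac, of \<epsilon>] L1] by simp
      also have "nrm ?G (\<epsilon> *\<^sub>R ?a) = \<epsilon> * nrm ?G ?a" using nrm_scale[OF X_banach ac, of \<epsilon>] \<epsilon>' by simp
      also have "\<dots> \<le> \<epsilon>0 * (Md + A + cF * (B + 1))"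
        using a \<epsilon>' nrm_nonneg[OF X_banach ac] by (intro mult_mono) auto
      finally show ?thesis using L2 Kw(3) by simp
    qed
    define U where "U t = Sm \<theta> (u t)" for t
    define W where "W t = Sm \<theta> (w t)" for t
    define f where "f t = Sm \<theta> (r t)" for t
    have UC: "C1_fun (X (s + P + m + d1)) (X (s + P + m + d1 - m)) {0..T'} U W"
      unfolding C1_fun_def U_def W_def using d1
      by (intro conjI ballI C_fun_bounded_linear[OF _ _ Sm_bounded u] C_fun_bounded_linear[OF _ _ Sm_bounded wc]
         has_time_deriv_bounded_linear[OF _ _ _ der Sm_bounded] \<theta>) auto
    have fc: "C_fun {0..T'} (X (s + P + m + d1')) f"
      unfolding f_def using d1' m by (intro C_fun_bounded_linear[OF _ _ Sm_bounded r] \<theta>) auto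
    have inS: "s \<in> ?S" by simp
    have powS: "\<theta> powr (s - s) = 1" using \<theta> by simp
    have eW: "\<epsilon> *\<^sub>R W t = Sm \<theta> (\<epsilon> *\<^sub>R w t)" if "t \<in> {0..T'}" for t
      unfolding W_def using Sm_linear[OF \<theta>, of "s + P" "s + P"] cr(3)[OF that] by (simp add: linear_betw_def)
    have bU: "nrm (X (\<sigma> + D)) (U t) \<le> K * \<theta> powr (\<sigma> - s) * Kw" if "\<sigma> \<in> ?S" "t \<in> {0..T'}" for \<sigma> t
    proof -
      have "nrm (X (\<sigma> + D)) (U t) \<le> K * \<theta> powr (\<sigma> - s) * nrm (X (s + D)) (u t)"
        unfolding U_def by (rule K1[OF that(1) \<theta> crD(1)[OF that(2)]])
      also have "\<dots> \<le> K * \<theta> powr (\<sigma> - s) * Kw" using uB[OF that(2)] Kw K(1) by (intro mult_left_mono) auto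
      finally show ?thesis .
    qed
    have bW: "nrm (X (\<sigma> + D - m)) (\<epsilon> *\<^sub>R W t) \<le> K * \<theta> powr (\<sigma> - s) * Kw" if "\<sigma> \<in> ?S" "t \<in> {0..T'}" for \<sigma> t
    proof -
      have "nrm (X (\<sigma> + D - m)) (\<epsilon> *\<^sub>R W t) \<le> K * \<theta> powr (\<sigma> - s) * nrm ?G (\<epsilon> *\<^sub>R w t)"
        unfolding eW[OF that(2)] using crD(3)[OF that(2)] by (intro K2[OF that(1) \<theta>]) (simp add: banach_space_closed)
      also have "\<dots> \<le> K * \<theta> powr (\<sigma> - s) * Kw" using wK[OF that(2)] K(1) by (intro mult_left_mono) auto
      finally show ?thesis .
    qed
    have bf: "nrm (X (\<sigma> + D - m)) (f t) \<le> K * \<theta> powr (\<sigma> - s) * (A * \<theta> powr - \<alpha>)" if "\<sigma> \<in> ?S" "t \<in> {0..T'}" for \<sigma> t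
    proof -
      have "nrm (X (\<sigma> + D - m)) (f t) \<le> K * \<theta> powr (\<sigma> - s) * nrm ?G (r t)"
        unfolding f_def by (rule K2[OF that(1) \<theta> crD(2)[OF that(2)]])
      also have "\<dots> \<le> K * \<theta> powr (\<sigma> - s) * (A * \<theta> powr - \<alpha>)" using rl[OF that(2)] K(1) by (intro mult_left_mono) auto
      finally show ?thesis .
    qed
    have Uc: "U t \<in> carr (X \<sigma>)" "\<epsilon> *\<^sub>R W t \<in> carr (X \<sigma>)" "f t \<in> carr (X \<sigma>)" if "t \<in> {0..T'}" for t \<sigma>
      using Sm_carr[OF \<theta> cr(1)[OF that]] Sm_carr[OF \<theta> cr(2)[OF that]] Sm_carr[OF \<theta> cr(3)[OF that]]
      by (auto simp: U_def W_def f_def banach_space_closed)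
    have low: "\<forall>t\<in>{0..T'}. nrm (X (s0 + m + d1)) (U t) \<le> K * Kw \<and> nrm (X (s0 + m + d1 - m)) (\<epsilon> *\<^sub>R W t) \<le> K * Kw"
    proof (intro ballI conjI)
      fix t assume t: "t \<in> {0..T'}"
      have "nrm (X (s0 + m + d1)) (U t) \<le> nrm (X (s + D)) (U t)" using s D by (intro X_mono Uc[OF t]) auto
      then show "nrm (X (s0 + m + d1)) (U t) \<le> K * Kw" using bU[OF inS t] powS by simp
      have "nrm (X (s0 + m + d1 - m)) (\<epsilon> *\<^sub>R W t) \<le> nrm ?G (\<epsilon> *\<^sub>R W t)" using s D by (intro X_mono Uc[OF t]) auto
      then show "nrm (X (s0 + m + d1 - m)) (\<epsilon> *\<^sub>R W t) \<le> K * Kw" using bW[OF inS t] powS by simp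
    qed
    obtain v where v: "C_fun {0..T'} (X (s + P + m)) v" "v 0 = 0" and
        dv: "\<forall>t\<in>{0..T'}. has_time_deriv (X (s + P + m - m)) {0..T'} v
           (f t - (1 / \<epsilon>) *\<^sub>R L \<epsilon> t (v t) - Fu \<epsilon> t (U t) (v t)) t" and
        est: "\<forall>\<sigma>\<in>{s0 + m..s + P + m}. \<forall>A B B0.
          (\<forall>t\<in>{0..T'}. nrm (X (\<sigma> + d1)) (U t) \<le> A \<and> nrm (X (\<sigma> + d1 - m)) (\<epsilon> *\<^sub>R W t) \<le> A \<and>
             nrm (X (\<sigma> + d1')) (f t) \<le> B \<and> nrm (X (s0 + m + d1')) (f t) \<le> B0) \<longrightarrow>
          (\<forall>t\<in>{0..T'}. nrm (X \<sigma>) (v t) \<le> M * T' * (B + A * B0))"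
      using lin[THEN spec, THEN spec, THEN spec, THEN spec, THEN spec, THEN mp, OF T', THEN mp, OF \<epsilon>,
          THEN mp, OF UC, THEN mp, OF fc, THEN mp, OF low] by (elim exE conjE)
    have ve: "nrm (X \<sigma>) (v t) \<le> M' * T' * \<theta> powr (\<sigma> - s - \<alpha>)" if \<sigma>: "\<sigma> \<in> ?S" and t: "t \<in> {0..T'}" for \<sigma> t
    proof -
      have \<sigma>': "\<sigma> \<in> {s0 + m..s + P + m}" using S[OF \<sigma>] s by auto
      let ?A = "K * \<theta> powr (\<sigma> - s) * Kw" and ?B = "K * \<theta> powr (\<sigma> - s) * (A * \<theta> powr - \<alpha>)" and ?Bs = "K * (A * \<theta> powr - \<alpha>)"
      have "nrm (X (\<sigma> + d1)) (U t) \<le> ?A \<and> nrm (X (\<sigma> + d1 - m)) (\<epsilon> *\<^sub>R W t) \<le> ?A \<and>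
             nrm (X (\<sigma> + d1')) (f t) \<le> ?B \<and> nrm (X (s0 + m + d1')) (f t) \<le> ?Bs" if t: "t \<in> {0..T'}" for t
      proof -
        have "nrm (X (\<sigma> + d1)) (U t) \<le> nrm (X (\<sigma> + D)) (U t)" using D by (intro X_mono Uc[OF t]) auto
        moreover have "nrm (X (\<sigma> + d1 - m)) (\<epsilon> *\<^sub>R W t) \<le> nrm (X (\<sigma> + D - m)) (\<epsilon> *\<^sub>R W t)" using D by (intro X_mono Uc[OF t]) auto
        moreover have "nrm (X (\<sigma> + d1')) (f t) \<le> nrm (X (\<sigma> + D - m)) (f t)" using D by (intro X_mono Uc[OF t]) auto
        moreover have "nrm (X (s0 + m + d1')) (f t) \<le> nrm ?G (f t)" using D s by (intro X_mono Uc[OF t]) auto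
        ultimately show ?thesis using bU[OF \<sigma> t] bW[OF \<sigma> t] bf[OF \<sigma> t] bf[OF inS t] unfolding powS mult_1_right by (intro conjI) linarith+
      qed
      then have "nrm (X \<sigma>) (v t) \<le> M * T' * (?B + ?A * ?Bs)" using est \<sigma>' t by blast
      also have "\<dots> = M' * T' * (\<theta> powr (\<sigma> - s) * \<theta> powr - \<alpha>)" unfolding M'_def by (simp add: algebra_simps)
      also have "\<theta> powr (\<sigma> - s) * \<theta> powr - \<alpha> = \<theta> powr (\<sigma> - s - \<alpha>)" by (simp flip: powr_add)
      finally show ?thesis .
    qed
    show "\<exists>v. C_fun {0..T'} (X (s + P + m)) v \<and> v 0 = 0 \<and>
        (\<forall>t\<in>{0..T'}. has_time_deriv (X (s + P)) {0..T'} v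
           (Sm \<theta> (r t) - (1 / \<epsilon>) *\<^sub>R L \<epsilon> t (v t) - Fu \<epsilon> t (Sm \<theta> (u t)) (v t)) t \<and>
           (\<forall>\<sigma>\<in>?S. nrm (X \<sigma>) (v t) \<le> M' * T' * \<theta> powr (\<sigma> - s - \<alpha>)))"
      using v dv ve unfolding U_def f_def by (intro exI[of _ v]) simp
  qed
qed

text \<open>The new error of one step, in terms of bounds for the increment \<open>v\<close> and for \<open>p = S\<^sub>\<theta> u - u\<close>:
  substitution of \<open>S\<^sub>\<theta> u\<close> for \<open>u\<close> in the linearisation, and Taylor remainder.\<close>

lemma step_error:
  assumes \<sigma>: "s \<le> \<sigma>" and B: "B \<ge> 1"
  shows "\<exists>M\<ge>0. \<forall>\<epsilon>\<in>{0<..<\<epsilon>0}. \<forall>t\<in>{0..T}. \<forall>u\<in>carr (X \<sigma>). \<forall>p\<in>carr (X \<sigma>). \<forall>v\<in>carr (X \<sigma>). \<forall>c x Y.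
     0 \<le> c \<longrightarrow> c \<le> 1 \<longrightarrow> 0 \<le> x \<longrightarrow> x \<le> 1 \<longrightarrow> 0 \<le> Y \<longrightarrow>
     nrm (X s) u \<le> B \<longrightarrow> nrm (X \<sigma>) u \<le> B * Y \<longrightarrow> nrm (X s) p \<le> B * x \<longrightarrow> nrm (X \<sigma>) p \<le> B * Y \<longrightarrow>
     nrm (X s) v \<le> c * x \<longrightarrow> nrm (X \<sigma>) v \<le> c * Y \<longrightarrow>
     nrm (X (\<sigma> - m)) ((Fu \<epsilon> t (u + p) v - Fu \<epsilon> t u v) - (F \<epsilon> t (u + v) - F \<epsilon> t u - Fu \<epsilon> t u v)) \<le> M * c * (x * Y)"
proof -
  let ?G = "X (\<sigma> - m)"
  obtain M where M: "M \<ge> 0" "\<forall>\<epsilon>\<in>{0<..<\<epsilon>0}. \<forall>t\<in>{0..T}. \<forall>u\<in>carr (X \<sigma>). \<forall>p\<in>carr (X \<sigma>). \<forall>v\<in>carr (X \<sigma>).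
      nrm (X s) u \<le> 2 * B \<longrightarrow> nrm ?G (Fuu \<epsilon> t u p v) \<le>
       M * (nrm (X \<sigma>) p * nrm (X s) v + nrm (X s) p * nrm (X \<sigma>) v + nrm (X \<sigma>) u * nrm (X s) p * nrm (X s) v)"
    using Fuu_bound[OF \<sigma>, of "2 * B"] by (elim exE conjE)
  define M' where "M' = M * (2 * B + 2 * B * B)"
  have M': "M' \<ge> 0" unfolding M'_def using M B by simp
  show ?thesis
  proof (intro exI[of _ "M' + M'"] conjI ballI allI impI)
    show "0 \<le> M' + M'" using M' by simp
    fix \<epsilon> t u p v and c x Y :: real
    assume \<epsilon>: "\<epsilon> \<in> {0<..<\<epsilon>0}" and t: "t \<in> {0..T}" and u: "u \<in> carr (X \<sigma>)" and p: "p \<in> carr (X \<sigma>)" and v: "v \<in> carr (X \<sigma>)"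
      and c: "0 \<le> c" "c \<le> 1" and x: "0 \<le> x" "x \<le> 1" and Y: "0 \<le> Y" and us: "nrm (X s) u \<le> B" and u\<sigma>: "nrm (X \<sigma>) u \<le> B * Y"
      and ps: "nrm (X s) p \<le> B * x" and p\<sigma>: "nrm (X \<sigma>) p \<le> B * Y" and vs: "nrm (X s) v \<le> c * x" and v\<sigma>: "nrm (X \<sigma>) v \<le> c * Y"
    note C2 = F_C2[OF \<epsilon> \<sigma>] t
    have est: "nrm ?G (Fuu \<epsilon> t (u + y *\<^sub>R k) k v) \<le> M' * c * (x * Y)"
      if y: "y \<in> {0..1}" and k: "k \<in> carr (X \<sigma>)" "nrm (X s) k \<le> B * x" "nrm (X \<sigma>) k \<le> B * Y" for y k
    proof -
      have ks: "k \<in> carr (X s)" "u \<in> carr (X s)" "v \<in> carr (X s)" using X_subset[OF \<sigma>] k u v by auto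
      have zc: "u + y *\<^sub>R k \<in> carr (X \<sigma>)" using u k by (simp add: banach_space_closed)
      have "nrm (X \<sigma>) (u + y *\<^sub>R k) \<le> nrm (X \<sigma>) u + y * nrm (X \<sigma>) k"
        using nrm_add[OF _ u banach_space_scale[OF _ k(1)], of y] nrm_scale[OF _ k(1), of y] y by simp
      also have "y * nrm (X \<sigma>) k \<le> 1 * (B * Y)" using y k nrm_nonneg[OF _ k(1)] by (intro mult_mono) auto
      finally have z\<sigma>: "nrm (X \<sigma>) (u + y *\<^sub>R k) \<le> 2 * B * Y" using u\<sigma> by simp
      have "nrm (X s) (u + y *\<^sub>R k) \<le> nrm (X s) u + y * nrm (X s) k"
        using nrm_add[OF _ ks(2) banach_space_scale[OF _ ks(1)], of y] nrm_scale[OF _ ks(1), of y] y by simp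
      also have "y * nrm (X s) k \<le> 1 * (B * x)" using y k nrm_nonneg[OF _ ks(1)] by (intro mult_mono) auto
      also have "1 * (B * x) \<le> B" using x B by (simp add: mult_left_le)
      finally have zs: "nrm (X s) (u + y *\<^sub>R k) \<le> 2 * B" using us by simp
      have nn: "0 \<le> nrm (X \<sigma>) k" "0 \<le> nrm (X s) k" "0 \<le> nrm (X \<sigma>) v" "0 \<le> nrm (X s) v" "0 \<le> nrm (X \<sigma>) (u + y *\<^sub>R k)"
        using k v ks zc by (auto intro!: nrm_nonneg)
      have "nrm ?G (Fuu \<epsilon> t (u + y *\<^sub>R k) k v) \<le> M * (nrm (X \<sigma>) k * nrm (X s) v + nrm (X s) k * nrm (X \<sigma>) v + nrm (X \<sigma>) (u + y *\<^sub>R k) * nrm (X s) k * nrm (X s) v)"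
        using M(2)[rule_format, OF \<epsilon> t zc k(1) v zs] .
      also have "\<dots> \<le> M * ((B * Y) * (c * x) + (B * x) * (c * Y) + (2 * B * Y) * (B * x) * (c * x))"
        using M(1) k(2,3) vs v\<sigma> z\<sigma> nn B x Y c by (intro mult_left_mono add_mono mult_mono) auto
      also have "\<dots> \<le> M * ((B * Y) * (c * x) + (B * x) * (c * Y) + (2 * B * Y) * (B * x) * (c * 1))"
        using M(1) B x Y c by (intro mult_left_mono add_mono mult_mono) auto
      also have "\<dots> = M' * c * (x * Y)" unfolding M'_def by (simp add: algebra_simps)
      finally show ?thesis .
    qed
    have vB: "nrm (X s) v \<le> B * x" "nrm (X \<sigma>) v \<le> B * Y"
      using vs v\<sigma> c B x Y mult_right_mono[of c B x] mult_right_mono[of c B Y] by linarith+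
    have 1: "nrm ?G (Fu \<epsilon> t (u + p) v - Fu \<epsilon> t u v) \<le> M' * c * (x * Y)"
      by (rule C2_deriv_increment[OF _ _ C2 u p v est[OF _ p ps p\<sigma>]]) auto
    have 2: "nrm ?G (F \<epsilon> t (u + v) - F \<epsilon> t u - Fu \<epsilon> t u v) \<le> M' * c * (x * Y)"
      by (rule C2_taylor[OF _ _ C2 u v est[OF _ v vB]]) auto
    have "u + p \<in> carr (X \<sigma>)" "u + v \<in> carr (X \<sigma>)" using u p v by (simp_all add: banach_space_closed)
    then have "nrm ?G ((Fu \<epsilon> t (u + p) v - Fu \<epsilon> t u v) - (F \<epsilon> t (u + v) - F \<epsilon> t u - Fu \<epsilon> t u v)) \<le>
      nrm ?G (Fu \<epsilon> t (u + p) v - Fu \<epsilon> t u v) + nrm ?G (F \<epsilon> t (u + v) - F \<epsilon> t u - Fu \<epsilon> t u v)"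
      using u p v C2_carr[OF _ _ C2] C2_deriv_carr[OF _ _ C2] by (intro nrm_diff) (auto simp: banach_space_closed)
    then show "nrm ?G ((Fu \<epsilon> t (u + p) v - Fu \<epsilon> t u v) - (F \<epsilon> t (u + v) - F \<epsilon> t u - Fu \<epsilon> t u v)) \<le> (M' + M') * c * (x * Y)"
      using 1 2 by (simp add: algebra_simps)
  qed
qed


text \<open>The order of the quantifiers is essential: \<open>\<Lambda>\<close> and \<open>\<theta>0\<close> depend only on the smoothing constants,
  \<open>A\<close> may then be chosen in dependence on \<open>\<theta>0\<close>, and \<open>T'\<close> comes last but serves all \<open>\<epsilon>\<close> and \<open>\<theta>\<close>.\<close>

lemma iteration_step:
  "\<exists>\<Lambda>>1. \<Lambda> powr (D - \<alpha>) \<le> 1/2 \<and> (\<exists>\<theta>0\<ge>1. \<forall>A>0. \<forall>B\<ge>0. \<exists>T'\<in>{0<..T}. \<forall>\<epsilon>\<in>{0<..<\<epsilon>0}. \<forall>\<theta>\<ge>\<theta>0. \<forall>u r.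
     approx_sol T' \<epsilon> A B \<theta> u r \<longrightarrow>
     (\<exists>u' r'. approx_sol T' \<epsilon> A B (\<Lambda> * \<theta>) u' r' \<and>
        (\<forall>t\<in>{0..T'}. nrm (X (s + D)) (u' t - u t) \<le> \<theta> powr (D - \<alpha>))))"
proof -
  let ?E = "X (s + D)" and ?G = "X (s + D - m)" and ?N = "X (s + P + m)" and ?H = "X (s + P)"
  note ex = exponents
  have sD: "s \<le> s + D" and sN: "s \<le> s + P + m" "s < s + P + m" and DN: "s + D \<le> s + P + m" "s + D - m \<le> s + P" "s + D - m < s + P"
    using D_nonneg ex m by auto
  define Q where "Q = {(s, s + P + m), (s + D, s + D), (s + P + m, s + P + m), (s + D - m, s + P), (s + P, s + P)}"
  have "\<exists>K\<ge>1. \<forall>(\<sigma>, \<sigma>')\<in>Q. smoothing_const K \<sigma> \<sigma>'"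
    unfolding Q_def using sN DN by (intro smoothing_const_finite) auto
  then obtain K where K: "K \<ge> 1" and KQ: "\<forall>(\<sigma>, \<sigma>')\<in>Q. smoothing_const K \<sigma> \<sigma>'" by blast
  have K1: "smoothing_const K s (s + P + m)" and K2: "smoothing_const K (s + D) (s + D)"
    and K3: "smoothing_const K (s + P + m) (s + P + m)" and K4: "smoothing_const K (s + D - m) (s + P)"
    and K5: "smoothing_const K (s + P) (s + P)" using KQ unfolding Q_def by auto
  have K0: "K \<ge> 0" using K by simp
  define \<kappa> where "\<kappa> = (\<alpha> - D) / 2"
  have \<kappa>: "\<kappa> > 0" unfolding \<kappa>_def using ex by simp
  \<comment> \<open>The smoothing error is up to \<open>1 + K\<close> times as large as the residual in the high norm; the growth
    \<open>\<Lambda>\<^sup>\<beta> \<ge> K + 2\<close> allowed per step makes up for this.\<close>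
  define \<Lambda> where "\<Lambda> = (K + 2) powr (1 / \<kappa>)"
  have \<Lambda>\<kappa>: "\<Lambda> powr \<kappa> = K + 2" unfolding \<Lambda>_def using \<kappa> K by (simp add: powr_powr)
  have "1 powr (1/\<kappa>) < (K + 2) powr (1 / \<kappa>)" using \<kappa> K by (intro powr_less_mono2) auto
  then have \<Lambda>: "\<Lambda> > 1" unfolding \<Lambda>_def by simp
  have \<Lambda>D: "\<Lambda> powr (D - \<alpha>) \<le> 1/2"
  proof -
    have "\<Lambda> powr (D - \<alpha>) \<le> \<Lambda> powr - \<kappa>" using \<Lambda> \<kappa> ex(2) by (intro powr_mono) (simp_all add: \<kappa>_def field_simps)
    also have "\<dots> = 1 / (K + 2)" using \<Lambda>\<kappa> by (simp add: powr_minus divide_inverse)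
    also have "\<dots> \<le> 1/2" using K by (simp add: field_simps)
    finally show ?thesis .
  qed
  have \<Lambda>\<beta>: "K + 2 \<le> \<Lambda> powr \<beta>"
    unfolding \<Lambda>\<kappa>[symmetric] using \<Lambda> ex by (intro powr_mono) (auto simp: \<kappa>_def)
  have \<Lambda>N: "2 \<le> \<Lambda> powr (P + m - \<alpha>)"
  proof -
    have "\<kappa> \<le> P + m - \<alpha>" unfolding \<kappa>_def using ex D_nonneg m by (simp add: field_simps)
    then have "\<Lambda> powr \<kappa> \<le> \<Lambda> powr (P + m - \<alpha>)" using \<Lambda> by (intro powr_mono) auto
    then show ?thesis using \<Lambda>\<kappa> K by simp
  qed
  \<comment> \<open>From \<open>\<theta>0\<close> on, \<open>K \<theta>\<^sup>-\<^sup>\<kappa>\<close> is at most half the decay \<open>\<Lambda>\<^sup>-\<^sup>\<alpha>\<close> required per step in the low norm.\<close>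
  define q where "q = 2 * K * \<Lambda> powr \<alpha>"
  have "1 \<le> \<Lambda> powr \<alpha>" using \<Lambda> ex powr_mono[of 0 \<alpha> \<Lambda>] by simp
  then have "2 * 1 * 1 \<le> 2 * K * \<Lambda> powr \<alpha>" using K by (intro mult_mono) auto
  then have q: "q \<ge> 1" unfolding q_def by simp
  define \<theta>0 where "\<theta>0 = q powr (1 / \<kappa>)"
  have \<theta>0: "\<theta>0 \<ge> 1" unfolding \<theta>0_def using q \<kappa> by (intro ge_one_powr_ge_zero) auto
  have \<theta>0\<kappa>: "\<theta>0 powr \<kappa> = q" unfolding \<theta>0_def using \<kappa> q by (simp add: powr_powr)
  have "\<exists>T'\<in>{0<..T}. \<forall>\<epsilon>\<in>{0<..<\<epsilon>0}. \<forall>\<theta>\<ge>\<theta>0. \<forall>u r.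
     approx_sol T' \<epsilon> A B \<theta> u r \<longrightarrow>
     (\<exists>u' r'. approx_sol T' \<epsilon> A B (\<Lambda> * \<theta>) u' r' \<and>
        (\<forall>t\<in>{0..T'}. nrm (X (s + D)) (u' t - u t) \<le> \<theta> powr (D - \<alpha>)))"
    if A: "A > 0" and B: "B \<ge> 0" for A B :: real
  proof -
    obtain Mv where Mv: "Mv \<ge> 0" and inc: "\<forall>T'\<in>{0<..T}. \<forall>\<epsilon>\<in>{0<..<\<epsilon>0}. \<forall>\<theta>\<ge>1. \<forall>u r. approx_sol T' \<epsilon> A B \<theta> u r \<longrightarrow>
      (\<exists>v. C_fun {0..T'} (X (s + P + m)) v \<and> v 0 = 0 \<and>
        (\<forall>t\<in>{0..T'}. has_time_deriv (X (s + P)) {0..T'} v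
           (Sm \<theta> (r t) - (1 / \<epsilon>) *\<^sub>R L \<epsilon> t (v t) - Fu \<epsilon> t (Sm \<theta> (u t)) (v t)) t \<and>
           (\<forall>\<sigma>\<in>{s, s + D, s + P + m}. nrm (X \<sigma>) (v t) \<le> Mv * T' * \<theta> powr (\<sigma> - s - \<alpha>))))"
      using increment[OF A B] by (elim exE conjE)
    define R where "R = (1 + K) * (B + 1)"
    have "1 * 1 \<le> R" unfolding R_def using K B by (intro mult_mono) auto
    then have R: "R \<ge> 1" by simp
    have RK: "K * (B + 1) \<le> R" "B + 1 \<le> R" unfolding R_def using K B by (simp_all add: algebra_simps)
    obtain M1 where M1: "M1 \<ge> 0" and err1: "\<forall>\<epsilon>\<in>{0<..<\<epsilon>0}. \<forall>t\<in>{0..T}. \<forall>u\<in>carr ?E. \<forall>p\<in>carr ?E. \<forall>v\<in>carr ?E. \<forall>c x Y.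
     0 \<le> c \<longrightarrow> c \<le> 1 \<longrightarrow> 0 \<le> x \<longrightarrow> x \<le> 1 \<longrightarrow> 0 \<le> Y \<longrightarrow>
     nrm (X s) u \<le> R \<longrightarrow> nrm ?E u \<le> R * Y \<longrightarrow> nrm (X s) p \<le> R * x \<longrightarrow> nrm ?E p \<le> R * Y \<longrightarrow>
     nrm (X s) v \<le> c * x \<longrightarrow> nrm ?E v \<le> c * Y \<longrightarrow>
     nrm ?G ((Fu \<epsilon> t (u + p) v - Fu \<epsilon> t u v) - (F \<epsilon> t (u + v) - F \<epsilon> t u - Fu \<epsilon> t u v)) \<le> M1 * c * (x * Y)"
      using step_error[OF sD R] by (elim exE conjE)
    have NH: "s + P + m - m = s + P" by simp
    obtain M2 where M2: "M2 \<ge> 0" and err2: "\<forall>\<epsilon>\<in>{0<..<\<epsilon>0}. \<forall>t\<in>{0..T}. \<forall>u\<in>carr ?N. \<forall>p\<in>carr ?N. \<forall>v\<in>carr ?N. \<forall>c x Y.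
     0 \<le> c \<longrightarrow> c \<le> 1 \<longrightarrow> 0 \<le> x \<longrightarrow> x \<le> 1 \<longrightarrow> 0 \<le> Y \<longrightarrow>
     nrm (X s) u \<le> R \<longrightarrow> nrm ?N u \<le> R * Y \<longrightarrow> nrm (X s) p \<le> R * x \<longrightarrow> nrm ?N p \<le> R * Y \<longrightarrow>
     nrm (X s) v \<le> c * x \<longrightarrow> nrm ?N v \<le> c * Y \<longrightarrow>
     nrm ?H ((Fu \<epsilon> t (u + p) v - Fu \<epsilon> t u v) - (F \<epsilon> t (u + v) - F \<epsilon> t u - Fu \<epsilon> t u v)) \<le> M2 * c * (x * Y)"
      using step_error[OF sN(1) R] unfolding NH by (elim exE conjE)
    define l where "l = \<Lambda> powr - \<alpha>"
    have l: "l > 0" "l \<le> 1" unfolding l_def using \<Lambda> ex powr_mono[of "- \<alpha>" 0 \<Lambda>] by auto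
    \<comment> \<open>The bound for the factor \<open>c = Mv T'\<close> of the increment that makes the errors containing it harmless.\<close>
    define \<eta> where "\<eta> = min (1/2) (A * l / (2 * (M1 + M2 + 1)))"
    have "A * l / (2 * (M1 + M2 + 1)) > 0" using A l M1 M2 by simp
    then have \<eta>: "\<eta> > 0" "\<eta> \<le> 1/2" unfolding \<eta>_def by (simp_all only: min_less_iff_conj min.cobounded1) simp
    have "\<eta> \<le> A * l / (2 * (M1 + M2 + 1))" unfolding \<eta>_def by simp
    then have \<eta>M: "(M1 + M2 + 1) * \<eta> \<le> A * l / 2"
      using M1 M2 by (simp add: field_simps)
    define T' where "T' = min T (\<eta> / (Mv + 1))"
    have T': "T' \<in> {0<..T}" unfolding T'_def using T \<eta> Mv by auto
    define c where "c = Mv * T'"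
    have c: "0 \<le> c" "c \<le> \<eta>"
    proof -
      show "0 \<le> c" unfolding c_def using Mv T' by simp
      have "c \<le> (Mv + 1) * T'" unfolding c_def using T' by (intro mult_right_mono) auto
      also have "\<dots> \<le> (Mv + 1) * (\<eta> / (Mv + 1))" unfolding T'_def using Mv by (intro mult_left_mono) auto
      also have "\<dots> = \<eta>" using Mv by simp
      finally show "c \<le> \<eta>" .
    qed
    have c1: "c \<le> 1" "c \<le> 1/2" using c \<eta> by auto
    have "M1 * c \<le> (M1 + M2 + 1) * \<eta>" using c M1 M2 by (intro mult_mono) auto
    then have M1c: "M1 * c \<le> A * l / 2" using \<eta>M by simp
    have "M2 * c \<le> (M1 + M2 + 1) * \<eta>" using c M1 M2 by (intro mult_mono) auto
    also have "\<dots> \<le> A * l / 2" by (rule \<eta>M)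
    also have "\<dots> \<le> A * 1" using A l by (simp add: field_simps)
    finally have M2c: "M2 * c \<le> A" by simp
    have I: "{0..T'} \<subseteq> {0..T}" using T' by auto
    show ?thesis
    proof (rule bexI[OF _ T'], intro ballI allI impI)
      fix \<epsilon> \<theta> u r assume \<epsilon>: "\<epsilon> \<in> {0<..<\<epsilon>0}" and \<theta>\<theta>: "\<theta>0 \<le> (\<theta>::real)" and ap: "approx_sol T' \<epsilon> A B \<theta> u r"
      have \<theta>: "\<theta> \<ge> 1" using \<theta>0 \<theta>\<theta> by simp
      have u: "C_fun {0..T'} ?N u" and r: "C_fun {0..T'} ?H r" and init: "u 0 = u0 \<epsilon>"
        and der: "\<And>t. t \<in> {0..T'} \<Longrightarrow> has_time_deriv ?H {0..T'} u (h \<epsilon> t - r t - (1 / \<epsilon>) *\<^sub>R L \<epsilon> t (u t) - F \<epsilon> t (u t)) t"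
        and rl: "\<And>t. t \<in> {0..T'} \<Longrightarrow> nrm ?G (r t) \<le> A * \<theta> powr - \<alpha>"
        and rh: "\<And>t. t \<in> {0..T'} \<Longrightarrow> nrm ?H (r t) \<le> A * \<theta> powr \<beta>"
        and ul: "\<And>t. t \<in> {0..T'} \<Longrightarrow> nrm ?E (u t) \<le> B + 1 - \<theta> powr (D - \<alpha>)"
        and uh: "\<And>t. t \<in> {0..T'} \<Longrightarrow> nrm ?N (u t) \<le> (B + 1) * \<theta> powr (P + m - \<alpha>)"
        using ap unfolding approx_sol_def by auto
      obtain v where v: "C_fun {0..T'} ?N v" and v0: "v 0 = 0" and vd: "\<forall>t\<in>{0..T'}. has_time_deriv ?H {0..T'} v
           (Sm \<theta> (r t) - (1 / \<epsilon>) *\<^sub>R L \<epsilon> t (v t) - Fu \<epsilon> t (Sm \<theta> (u t)) (v t)) t \<and>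
           (\<forall>\<sigma>\<in>{s, s + D, s + P + m}. nrm (X \<sigma>) (v t) \<le> Mv * T' * \<theta> powr (\<sigma> - s - \<alpha>))"
        using inc[rule_format, OF T' \<epsilon> \<theta> ap] by (elim exE conjE)
      define x where "x = \<theta> powr - \<alpha>"
      define y where "y = \<theta> powr (D - \<alpha>)"
      define Y where "Y = \<theta> powr (P + m - \<alpha>)"
      have x: "0 \<le> x" "x \<le> 1" unfolding x_def using \<theta> ex powr_mono[of "- \<alpha>" 0 \<theta>] by auto
      have y: "0 \<le> y" "y \<le> 1" unfolding y_def using \<theta> ex powr_mono[of "D - \<alpha>" 0 \<theta>] by auto
      have Y: "0 \<le> Y" unfolding Y_def by simp
      define w where "w t = u t + v t" for t
      define z where "z t = Sm \<theta> (u t)" for t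
      define g where "g t = r t - Sm \<theta> (r t)" for t
      define r' where "r' t = g t + (Fu \<epsilon> t (z t) (v t) - (F \<epsilon> t (w t) - F \<epsilon> t (u t)))" for t
      have w: "C_fun {0..T'} ?N w" unfolding w_def by (rule C_fun_add[OF _ u v]) simp
      have z: "C_fun {0..T'} ?N z" unfolding z_def by (rule C_fun_bounded_linear[OF _ _ Sm_bounded u]) (use \<theta> in auto)
      have Sr: "C_fun {0..T'} ?H (\<lambda>t. Sm \<theta> (r t))" by (rule C_fun_bounded_linear[OF _ _ Sm_bounded r]) (use \<theta> in auto)
      have g: "C_fun {0..T'} ?H g" unfolding g_def by (rule C_fun_diff[OF _ r Sr]) simp
      have Fw: "C_fun {0..T'} ?H (\<lambda>t. F \<epsilon> t (w t))" using C_fun_F[OF \<epsilon> sN(1) w I] by simp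
      have Fu': "C_fun {0..T'} ?H (\<lambda>t. F \<epsilon> t (u t))" using C_fun_F[OF \<epsilon> sN(1) u I] by simp
      have Fz: "C_fun {0..T'} ?H (\<lambda>t. Fu \<epsilon> t (z t) (v t))" using C_fun_Fu[OF \<epsilon> sN(1) z v I] by simp
      have r': "C_fun {0..T'} ?H r'" unfolding r'_def
        by (rule C_fun_add[OF _ g C_fun_diff[OF _ Fz C_fun_diff[OF _ Fw Fu']]]) simp_all
      have bounds: "nrm ?G (r' t) \<le> A * (\<Lambda> * \<theta>) powr - \<alpha> \<and> nrm ?H (r' t) \<le> A * (\<Lambda> * \<theta>) powr \<beta> \<and>
         nrm ?E (w t) \<le> B + 1 - (\<Lambda> * \<theta>) powr (D - \<alpha>) \<and> nrm ?N (w t) \<le> (B + 1) * (\<Lambda> * \<theta>) powr (P + m - \<alpha>) \<and>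
         nrm ?E (v t) \<le> y" if t: "t \<in> {0..T'}" for t
      proof -
        have t': "t \<in> {0..T}" using t I by auto
        have uN: "u t \<in> carr ?N" and vN: "v t \<in> carr ?N" and zN: "z t \<in> carr ?N" and rH: "r t \<in> carr ?H"
          and gH: "g t \<in> carr ?H" and SrH: "Sm \<theta> (r t) \<in> carr ?H"
          using C_fun_carr[OF _ u t] C_fun_carr[OF _ v t] C_fun_carr[OF _ z t] C_fun_carr[OF _ r t] C_fun_carr[OF _ g t] C_fun_carr[OF _ Sr t] by auto
        have uE: "u t \<in> carr ?E" and vE: "v t \<in> carr ?E" and zE: "z t \<in> carr ?E" and rG: "r t \<in> carr ?G" and gG: "g t \<in> carr ?G"
          using X_subset[OF DN(1) uN] X_subset[OF DN(1) vN] X_subset[OF DN(1) zN] X_subset[OF DN(2) rH] X_subset[OF DN(2) gH] by auto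
        have vest: "nrm (X \<sigma>) (v t) \<le> c * \<theta> powr (\<sigma> - s - \<alpha>)" if "\<sigma> \<in> {s, s + D, s + P + m}" for \<sigma>
          using vd t that unfolding c_def by blast
        have vs: "nrm (X s) (v t) \<le> c * x" using vest[of s] by (simp add: x_def)
        have vy: "nrm ?E (v t) \<le> c * y" using vest[of "s + D"] by (simp add: y_def)
        have vY: "nrm ?N (v t) \<le> c * Y" using vest[of "s + P + m"] by (simp add: Y_def algebra_simps)
        have "c * y \<le> c * 1" using c y by (intro mult_left_mono) auto
        then have v1: "nrm ?E (v t) \<le> c * 1" using vy by simp
        have uB: "nrm ?E (u t) \<le> B + 1" using ul[OF t] y(1) unfolding y_def by linarith
        have uR: "nrm ?E (u t) \<le> R * 1" using uB RK by simp
        have us: "nrm (X s) (u t) \<le> R" using X_mono[OF sD uE] uR by simp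
        have "(B + 1) * Y \<le> R * Y" using RK Y by (intro mult_right_mono) auto
        then have uY: "nrm ?N (u t) \<le> R * Y" using uh[OF t] unfolding Y_def by simp
        define p where "p = z t - u t"
        have pN: "p \<in> carr ?N" and pE: "p \<in> carr ?E" unfolding p_def using uN zN uE zE by (simp_all add: banach_space_closed)
        have ps: "nrm (X s) p \<le> R * x"
        proof -
          have "nrm (X s) p = nrm (X s) (u t - Sm \<theta> (u t))"
            unfolding p_def z_def[symmetric] using X_subset[OF sN(1)] uN zN by (intro nrm_diff_commute) auto
          also have "\<dots> \<le> K * \<theta> powr (s - (s + P + m)) * nrm ?N (u t)"
            by (rule smoothing_constD(2)[OF K1 \<theta> sN(2) uN])
          also have "\<dots> \<le> K * \<theta> powr (s - (s + P + m)) * ((B + 1) * Y)"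
            using uh[OF t] K0 unfolding Y_def by (intro mult_left_mono) auto
          also have "\<dots> = K * (B + 1) * (\<theta> powr (s - (s + P + m)) * Y)" by (simp add: mult_ac)
          also have "\<theta> powr (s - (s + P + m)) * Y = x" unfolding Y_def x_def by (simp flip: powr_add)
          also have "K * (B + 1) * x \<le> R * x" using RK x by (intro mult_right_mono) auto
          finally show ?thesis .
        qed
        have p1: "nrm ?E p \<le> R * 1"
        proof -
          have "nrm ?E p \<le> nrm ?E (z t) + nrm ?E (u t)" unfolding p_def using uE zE by (intro nrm_diff) auto
          also have "nrm ?E (z t) \<le> K * nrm ?E (u t)"
            using smoothing_constD(1)[OF K2 \<theta> uE] \<theta> by (simp add: z_def)
          also have "K * nrm ?E (u t) \<le> K * (B + 1)" using uB K0 by (intro mult_left_mono) auto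
          finally show ?thesis using uB unfolding R_def by (simp add: algebra_simps)
        qed
        have pY: "nrm ?N p \<le> R * Y"
        proof -
          have "nrm ?N p \<le> nrm ?N (z t) + nrm ?N (u t)" unfolding p_def using uN zN by (intro nrm_diff) auto
          also have "nrm ?N (z t) \<le> K * nrm ?N (u t)"
            using smoothing_constD(1)[OF K3 \<theta> uN] \<theta> by (simp add: z_def)
          also have "K * nrm ?N (u t) \<le> K * ((B + 1) * Y)" using uh[OF t] K0 unfolding Y_def by (intro mult_left_mono) auto
          finally show ?thesis using uh[OF t] unfolding R_def Y_def by (simp add: algebra_simps)
        qed
        \<comment> \<open>the part of the new residual that contains the increment, with \<open>u t + p = S\<^sub>\<theta> u\<close>\<close>
        define e where "e = (Fu \<epsilon> t (u t + p) (v t) - Fu \<epsilon> t (u t) (v t)) - (F \<epsilon> t (u t + v t) - F \<epsilon> t (u t) - Fu \<epsilon> t (u t) (v t))"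
        have r'e: "r' t = g t + e" unfolding r'_def e_def p_def w_def by simp
        have eH: "e \<in> carr ?H"
        proof -
          have "e = r' t - g t" using r'e by simp
          then show ?thesis using C_fun_carr[OF _ r' t] gH by (simp add: banach_space_closed)
        qed
        have eG: "e \<in> carr ?G" using X_subset[OF DN(2) eH] .
        have e1: "nrm ?G e \<le> M1 * c * (x * 1)"
          unfolding e_def by (rule err1[rule_format, OF \<epsilon> t' uE pE vE c(1) c1(1) x _ us uR ps p1 vs v1]) simp
        have e2: "nrm ?H e \<le> M2 * c * (x * Y)"
          unfolding e_def by (rule err2[rule_format, OF \<epsilon> t' uN pN vN c(1) c1(1) x Y us uY ps pY vs vY])
        have g1: "nrm ?G (g t) \<le> A * l / 2 * x"
        proof -
          have "nrm ?G (g t) \<le> K * \<theta> powr (s + D - m - (s + P)) * nrm ?H (r t)"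
            unfolding g_def by (rule smoothing_constD(2)[OF K4 \<theta> DN(3) rH])
          also have "\<dots> \<le> K * \<theta> powr (s + D - m - (s + P)) * (A * \<theta> powr \<beta>)"
            using rh[OF t] K0 by (intro mult_left_mono) auto
          also have "\<dots> = K * A * (\<theta> powr (s + D - m - (s + P)) * \<theta> powr \<beta>)" by (simp add: mult_ac)
          also have "\<theta> powr (s + D - m - (s + P)) * \<theta> powr \<beta> = x * \<theta> powr - \<kappa>"
          proof -
            have "s + D - m - (s + P) + \<beta> = - \<alpha> + - \<kappa>" unfolding \<beta>_def \<kappa>_def using ex(1) by (simp add: field_simps)
            then show ?thesis unfolding x_def by (simp only: powr_add[symmetric])
          qed
          also have "K * A * (x * \<theta> powr - \<kappa>) \<le> K * A * (x * (1 / q))"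
          proof -
            have "q \<le> \<theta> powr \<kappa>" unfolding \<theta>0\<kappa>[symmetric] using \<theta>0 \<theta>\<theta> \<kappa> by (intro powr_mono2) auto
            then have "\<theta> powr - \<kappa> \<le> 1 / q"
              unfolding powr_minus_divide using q \<theta> by (intro divide_left_mono mult_pos_pos) auto
            then show ?thesis using K0 A x by (intro mult_left_mono) auto
          qed
          also have "\<dots> = A * l / 2 * x" unfolding q_def l_def using K by (simp add: powr_minus field_simps)
          finally show ?thesis .
        qed
        have g2: "nrm ?H (g t) \<le> (1 + K) * A * \<theta> powr \<beta>"
        proof -
          have "nrm ?H (g t) \<le> nrm ?H (r t) + nrm ?H (Sm \<theta> (r t))" unfolding g_def using rH SrH by (intro nrm_diff) auto
          also have "nrm ?H (Sm \<theta> (r t)) \<le> K * nrm ?H (r t)" using smoothing_constD(1)[OF K5 \<theta> rH] \<theta> by simp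
          also have "nrm ?H (r t) + K * nrm ?H (r t) = (1 + K) * nrm ?H (r t)" by (simp add: algebra_simps)
          also have "\<dots> \<le> (1 + K) * (A * \<theta> powr \<beta>)" using rh[OF t] K0 by (intro mult_left_mono) auto
          finally show ?thesis by (simp add: mult_ac)
        qed
        have mul: "(\<Lambda> * \<theta>) powr k = \<Lambda> powr k * \<theta> powr k" for k using \<Lambda> \<theta> by (simp add: powr_mult)
        have "nrm ?G (r' t) \<le> nrm ?G (g t) + nrm ?G e" unfolding r'e using gG eG by (intro nrm_add) auto
        also have "\<dots> \<le> A * l / 2 * x + A * l / 2 * x"
        proof -
          have "M1 * c * x \<le> A * l / 2 * x" using M1c x by (intro mult_right_mono) auto
          then show ?thesis using g1 e1 by simp
        qed
        also have "\<dots> = A * (\<Lambda> * \<theta>) powr - \<alpha>" unfolding mul l_def x_def by simp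
        finally have b1: "nrm ?G (r' t) \<le> A * (\<Lambda> * \<theta>) powr - \<alpha>" .
        have "nrm ?H (r' t) \<le> nrm ?H (g t) + nrm ?H e" unfolding r'e using gH eH by (intro nrm_add) auto
        also have "nrm ?H e \<le> A * \<theta> powr \<beta>"
        proof -
          have "x * Y = \<theta> powr m" unfolding x_def Y_def using ex(1) by (simp flip: powr_add)
          also have "\<dots> \<le> \<theta> powr \<beta>" using \<theta> ex by (intro powr_mono) auto
          finally have "M2 * c * (x * Y) \<le> A * \<theta> powr \<beta>" using M2c A x Y by (intro mult_mono) auto
          then show ?thesis using e2 by simp
        qed
        also have "nrm ?H (g t) + A * \<theta> powr \<beta> \<le> (K + 2) * (A * \<theta> powr \<beta>)" using g2 by (simp add: algebra_simps)
        also have "\<dots> \<le> \<Lambda> powr \<beta> * (A * \<theta> powr \<beta>)" using \<Lambda>\<beta> A by (intro mult_right_mono) auto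
        also have "\<dots> = A * (\<Lambda> * \<theta>) powr \<beta>" unfolding mul by (simp add: mult_ac)
        finally have b2: "nrm ?H (r' t) \<le> A * (\<Lambda> * \<theta>) powr \<beta>" by simp
        have "nrm ?E (w t) \<le> nrm ?E (u t) + nrm ?E (v t)" unfolding w_def using uE vE by (intro nrm_add) auto
        also have "\<dots> \<le> (B + 1 - y) + 1/2 * y"
        proof -
          have "c * y \<le> 1/2 * y" using c1 y by (intro mult_right_mono) auto
          then show ?thesis using ul[OF t] vy unfolding y_def by linarith
        qed
        also have "\<dots> \<le> B + 1 - \<Lambda> powr (D - \<alpha>) * y"
          using mult_right_mono[OF \<Lambda>D y(1)] by simp
        finally have b3: "nrm ?E (w t) \<le> B + 1 - (\<Lambda> * \<theta>) powr (D - \<alpha>)" unfolding mul y_def .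
        have "nrm ?N (w t) \<le> nrm ?N (u t) + nrm ?N (v t)" unfolding w_def using uN vN by (intro nrm_add) auto
        also have "\<dots> \<le> (B + 1) * Y + (B + 1) * Y"
        proof -
          have "c * Y \<le> (B + 1) * Y" using c1 B Y by (intro mult_right_mono) auto
          then show ?thesis using uh[OF t] vY unfolding Y_def by linarith
        qed
        also have "\<dots> = (B + 1) * (2 * Y)" by simp
        also have "\<dots> \<le> (B + 1) * (\<Lambda> powr (P + m - \<alpha>) * Y)" using \<Lambda>N B Y by (intro mult_left_mono mult_right_mono) auto
        finally have b4: "nrm ?N (w t) \<le> (B + 1) * (\<Lambda> * \<theta>) powr (P + m - \<alpha>)" unfolding mul Y_def .
        have "c * y \<le> 1 * y" using c1 y by (intro mult_right_mono) auto
        then have b5: "nrm ?E (v t) \<le> y" using vy by simp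
        show ?thesis using b1 b2 b3 b4 b5 by blast
      qed
      have "approx_sol T' \<epsilon> A B (\<Lambda> * \<theta>) w r'"
        unfolding approx_sol_def
      proof (intro conjI ballI w r')
        show "w 0 = u0 \<epsilon>" using init v0 by (simp add: w_def)
        fix t assume t: "t \<in> {0..T'}"
        have uN: "u t \<in> carr ?N" and vN: "v t \<in> carr ?N" using C_fun_carr[OF _ u t] C_fun_carr[OF _ v t] by auto
        have Lw: "L \<epsilon> t (w t) = L \<epsilon> t (u t) + L \<epsilon> t (v t)"
          using L_linear[OF \<epsilon> sN(1), of t] uN vN by (simp add: w_def bounded_linear_betw_def linear_betw_def)
        have "has_time_deriv ?H {0..T'} w ((h \<epsilon> t - r t - (1 / \<epsilon>) *\<^sub>R L \<epsilon> t (u t) - F \<epsilon> t (u t)) +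
            (Sm \<theta> (r t) - (1 / \<epsilon>) *\<^sub>R L \<epsilon> t (v t) - Fu \<epsilon> t (z t) (v t))) t"
          unfolding w_def z_def using vd t by (intro has_time_deriv_add[OF _ t der[OF t]]) auto
        also have "(h \<epsilon> t - r t - (1 / \<epsilon>) *\<^sub>R L \<epsilon> t (u t) - F \<epsilon> t (u t)) +
            (Sm \<theta> (r t) - (1 / \<epsilon>) *\<^sub>R L \<epsilon> t (v t) - Fu \<epsilon> t (z t) (v t)) = h \<epsilon> t - r' t - (1 / \<epsilon>) *\<^sub>R L \<epsilon> t (w t) - F \<epsilon> t (w t)"
          unfolding Lw r'_def g_def by (simp add: algebra_simps)
        finally show "has_time_deriv ?H {0..T'} w (h \<epsilon> t - r' t - (1 / \<epsilon>) *\<^sub>R L \<epsilon> t (w t) - F \<epsilon> t (w t)) t" .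
      qed (use bounds in blast)+
      moreover have "\<forall>t\<in>{0..T'}. nrm ?E (w t - u t) \<le> \<theta> powr (D - \<alpha>)"
        using bounds unfolding w_def y_def by simp
      ultimately show "\<exists>u' r'. approx_sol T' \<epsilon> A B (\<Lambda> * \<theta>) u' r' \<and>
        (\<forall>t\<in>{0..T'}. nrm (X (s + D)) (u' t - u t) \<le> \<theta> powr (D - \<alpha>))" by blast
    qed
  qed
  then have "\<exists>\<theta>0\<ge>1. \<forall>A>0. \<forall>B\<ge>0. \<exists>T'\<in>{0<..T}. \<forall>\<epsilon>\<in>{0<..<\<epsilon>0}. \<forall>\<theta>\<ge>\<theta>0. \<forall>u r.
     approx_sol T' \<epsilon> A B \<theta> u r \<longrightarrow>
     (\<exists>u' r'. approx_sol T' \<epsilon> A B (\<Lambda> * \<theta>) u' r' \<and>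
        (\<forall>t\<in>{0..T'}. nrm (X (s + D)) (u' t - u t) \<le> \<theta> powr (D - \<alpha>)))"
    using \<theta>0 by blast
  with \<Lambda> \<Lambda>D show ?thesis by blast
qed


section \<open>Convergence\<close>

text \<open>The increments are bounded by \<open>2\<^sup>-\<^sup>k\<close> in \<open>X\<^bsup>s+D\<^esup>\<close>, and \<open>u 0\<close> by \<open>B + 1\<close>; hence the bound
  \<open>B + 3\<close>, which does not depend on \<open>\<epsilon>\<close>. The rate at which the time derivatives converge may depend on
  \<open>\<epsilon>\<close>.\<close>

lemma scheme_limit:
  assumes \<epsilon>: "\<epsilon> \<in> {0<..<\<epsilon>0}" and T': "T' \<in> {0<..T}" and B: "B \<ge> 0" and A: "A > 0"
    and \<Lambda>: "\<Lambda> > 1" "\<Lambda> powr (D - \<alpha>) \<le> 1/2" and \<theta>0: "\<theta>0 \<ge> 1"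
    and ap: "\<And>k. approx_sol T' \<epsilon> A B (\<theta>0 * \<Lambda> ^ k) (u k) (r k)"
    and inc: "\<And>k t. t \<in> {0..T'} \<Longrightarrow> nrm (X (s + D)) (u (Suc k) t - u k t) \<le> (\<theta>0 * \<Lambda> ^ k) powr (D - \<alpha>)"
  shows "\<exists>v. is_sol T' \<epsilon> v \<and> (\<forall>t\<in>{0..T'}. nrm (X (s + D)) (v t) \<le> B + 3)"
proof -
  let ?E = "X (s + D)" and ?G = "X (s + D - m)"
  note ex = exponents
  have T'': "0 < T'" "T' \<le> T" and \<epsilon>': "\<epsilon> > 0" using T' \<epsilon> by auto
  have I: "{0..T'} \<subseteq> {0..T}" using T' by auto
  have sD: "s \<le> s + D" and DN: "s + D \<le> s + P + m" "s + D - m \<le> s + P" and GE: "s + D - m \<le> s + D"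
    using D_nonneg ex m by auto
  have th1: "\<theta>0 * \<Lambda> ^ k \<ge> 1" for k
    using mult_mono[of 1 \<theta>0 1 "\<Lambda> ^ k"] \<theta>0 \<Lambda> by (simp add: one_le_power)
  define c where "c k = (1/2::real) ^ k" for k
  have cle: "(\<theta>0 * \<Lambda> ^ k) powr (D - \<alpha>) \<le> c k" for k
  proof -
    have "(\<theta>0 * \<Lambda> ^ k) powr (D - \<alpha>) = \<theta>0 powr (D - \<alpha>) * (\<Lambda> powr (D - \<alpha>)) ^ k"
      using \<theta>0 \<Lambda> by (simp add: powr_mult powr_power powr_realpow[symmetric] powr_powr mult.commute)
    also have "\<dots> \<le> 1 * (1/2) ^ k"
      using \<theta>0 \<Lambda> ex powr_mono[of "D - \<alpha>" 0 \<theta>0] by (intro mult_mono power_mono) auto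
    finally show ?thesis by (simp add: c_def)
  qed
  have sc: "summable c" unfolding c_def by (rule summable_geometric) simp
  define e where "e k = (\<Sum>j. c (j + k))" for k
  have e0: "e \<longlonglongrightarrow> 0" unfolding e_def by (rule suminf_exist_split2[OF sc])
  have eE: "e 0 = 2" unfolding e_def c_def using suminf_geometric[of "1/2::real"] by simp
  have uN: "C_fun {0..T'} (X (s + P + m)) (u k)" and rH: "C_fun {0..T'} (X (s + P)) (r k)" and init: "u k 0 = u0 \<epsilon>"
    and der: "\<And>t. t \<in> {0..T'} \<Longrightarrow> has_time_deriv (X (s + P)) {0..T'} (u k) (h \<epsilon> t - r k t - (1 / \<epsilon>) *\<^sub>R L \<epsilon> t (u k t) - F \<epsilon> t (u k t)) t"
    and rl: "\<And>t. t \<in> {0..T'} \<Longrightarrow> nrm ?G (r k t) \<le> A * (\<theta>0 * \<Lambda> ^ k) powr - \<alpha>"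
    and ul: "\<And>t. t \<in> {0..T'} \<Longrightarrow> nrm ?E (u k t) \<le> B + 1 - (\<theta>0 * \<Lambda> ^ k) powr (D - \<alpha>)" for k
    using ap[of k] unfolding approx_sol_def by auto
  have uB: "nrm ?E (u k t) \<le> B + 1" if "t \<in> {0..T'}" for k t
    using ul[OF that, of k] powr_ge_zero[of "\<theta>0 * \<Lambda> ^ k" "D - \<alpha>"] by linarith
  have uE: "C_fun {0..T'} ?E (u k)" for k by (rule C_fun_X_mono[OF uN DN(1)])
  have "\<exists>v. C_fun {0..T'} ?E v \<and> (\<forall>k. \<forall>t\<in>{0..T'}. nrm ?E (v t - u k t) \<le> (\<Sum>j. c (j + k)))"
    by (rule uniform_limit_exists[OF _ uE order_trans[OF inc cle] sc]) (auto simp: c_def)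
  then obtain v where v: "C_fun {0..T'} ?E v" and ve: "\<And>k t. t \<in> {0..T'} \<Longrightarrow> nrm ?E (v t - u k t) \<le> e k"
    unfolding e_def by blast
  have uc: "u k t \<in> carr ?E" and vc: "v t \<in> carr ?E" if "t \<in> {0..T'}" for k t
    using C_fun_carr[OF _ uE that] C_fun_carr[OF _ v that] by auto
  have vB: "nrm ?E (v t) \<le> B + 3" if t: "t \<in> {0..T'}" for t
    using nrm_le_add_diff[OF _ vc[OF t] uc[OF t, of 0]] ve[OF t, of 0] uB[OF t, of 0] eE by simp
  define dv where "dv t = h \<epsilon> t - (1 / \<epsilon>) *\<^sub>R L \<epsilon> t (v t) - F \<epsilon> t (v t)" for t
  define du where "du k t = h \<epsilon> t - r k t - (1 / \<epsilon>) *\<^sub>R L \<epsilon> t (u k t) - F \<epsilon> t (u k t)" for k t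
  have hc: "C_fun {0..T'} ?G (h \<epsilon>)"
    by (rule C_fun_X_mono[OF C_fun_subset[OF _ h_cont[OF \<epsilon>] I] DN(2)]) simp
  have Lc: "C_fun {0..T'} ?G (\<lambda>t. (1 / \<epsilon>) *\<^sub>R L \<epsilon> t (v t))"
    by (rule C_fun_scale[OF _ C_fun_L[OF \<epsilon> sD v]]) auto
  have Fc: "C_fun {0..T'} ?G (\<lambda>t. F \<epsilon> t (v t))" by (rule C_fun_F[OF \<epsilon> sD v I])
  have dvc: "C_fun {0..T'} ?G dv"
    unfolding dv_def by (rule C_fun_diff[OF _ C_fun_diff[OF _ hc Lc] Fc]) simp_all
  obtain cL where cL: "cL \<ge> 0" "\<forall>\<epsilon>\<in>{0<..<\<epsilon>0}. \<forall>t\<in>{0..T}. \<forall>u\<in>carr ?E. nrm ?G (L \<epsilon> t u) \<le> cL * nrm ?E u"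
    using L_bound[OF sD] by blast
  define R where "R = 3 * (B + 3)"
  obtain cF where cF: "cF \<ge> 0" "\<forall>\<epsilon>\<in>{0<..<\<epsilon>0}. \<forall>t\<in>{0..T}. \<forall>u\<in>carr ?E. \<forall>v\<in>carr ?E.
     nrm (X s) u \<le> R \<longrightarrow> nrm ?G (Fu \<epsilon> t u v) \<le> cF * (nrm ?E v + nrm ?E u * nrm (X s) v)"
    using Fu_bound[OF sD, of R] by (elim exE conjE)
  define M where "M = 1 + cL / \<epsilon> + cF * (1 + R)"
  have M: "M \<ge> 1" unfolding M_def R_def using cL cF B \<epsilon>' by simp
  define a where "a k = M * e k + A * (\<theta>0 * \<Lambda> ^ k) powr - \<alpha>" for k
  have a0: "a \<longlonglongrightarrow> 0"
  proof -
    have "(\<lambda>k. (\<theta>0 * \<Lambda> ^ k) powr - \<alpha>) \<longlonglongrightarrow> 0"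
    proof (rule tendsto_neg_powr)
      have "filterlim (\<lambda>k. \<Lambda> ^ k) at_top sequentially"
        using \<Lambda> by (intro filterlim_at_infinity_imp_filterlim_at_top filterlim_realpow_sequentially_gt1) auto
      then show "filterlim (\<lambda>k. \<theta>0 * \<Lambda> ^ k) at_top sequentially"
        using \<theta>0 by (intro filterlim_tendsto_pos_mult_at_top[OF tendsto_const]) auto
    qed (use ex in simp)
    then have "a \<longlonglongrightarrow> M * 0 + A * 0" unfolding a_def by (intro tendsto_intros e0)
    then show ?thesis by simp
  qed
  have e_nn: "e k \<ge> 0" for k unfolding e_def using sc by (intro suminf_nonneg) (auto simp: c_def)
  have a1: "nrm ?G (v t - u k t) \<le> a k" if t: "t \<in> {0..T'}" for k t
  proof -
    have "nrm ?G (v t - u k t) \<le> nrm ?E (v t - u k t)"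
      using uc[OF t] vc[OF t] GE by (intro X_mono) (auto simp: banach_space_closed)
    also have "\<dots> \<le> 1 * e k" using ve[OF t] by simp
    also have "\<dots> \<le> M * e k" using M e_nn by (intro mult_right_mono) auto
    also have "\<dots> \<le> a k" unfolding a_def using A by simp
    finally show ?thesis .
  qed
  have a2: "nrm ?G (dv t - du k t) \<le> a k" if t: "t \<in> {0..T'}" for k t
  proof -
    have t': "t \<in> {0..T}" using t I by auto
    note C2 = F_C2[OF \<epsilon> sD] t'
    note U = uc[OF t, of k] and V = vc[OF t]
    define p where "p = v t - u k t"
    have pc: "p \<in> carr ?E" unfolding p_def using U V by (simp add: banach_space_closed)
    have pe: "nrm ?E p \<le> e k" unfolding p_def using ve[OF t] .
    have pB: "nrm ?E p \<le> 2 * (B + 3)"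
      unfolding p_def using nrm_diff[OF _ V U] vB[OF t] uB[OF t, of k] by simp
    have ps: "nrm (X s) p \<le> nrm ?E p" by (rule X_mono[OF sD pc])
    have rG: "r k t \<in> carr ?G" by (rule X_subset[OF DN(2) C_fun_carr[OF _ rH t]]) simp
    have LG: "L \<epsilon> t p \<in> carr ?G" using L_linear[OF \<epsilon> sD, of t] pc by (auto simp: bounded_linear_betw_def linear_betw_def)
    have Lp: "L \<epsilon> t p = L \<epsilon> t (v t) - L \<epsilon> t (u k t)"
      unfolding p_def using L_linear[OF \<epsilon> sD, of t] U V by (intro linear_betw_diff[of ?E ?G]) (auto simp: bounded_linear_betw_def)
    have FG: "F \<epsilon> t (u k t + p) - F \<epsilon> t (u k t) \<in> carr ?G"
      using C2_carr[OF _ _ C2] U pc by (simp add: banach_space_closed)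
    have "nrm ?G (F \<epsilon> t (u k t + p) - F \<epsilon> t (u k t)) \<le> cF * ((1 + R) * nrm ?E p)"
    proof (rule C2_increment[OF _ _ C2 U pc])
      fix x :: real assume x: "x \<in> {0..1}"
      have zc: "u k t + x *\<^sub>R p \<in> carr ?E" using U pc by (simp add: banach_space_closed)
      have "nrm ?E (u k t + x *\<^sub>R p) \<le> nrm ?E (u k t) + nrm ?E (x *\<^sub>R p)"
        using U pc by (intro nrm_add) (auto simp: banach_space_closed)
      also have "nrm ?E (x *\<^sub>R p) \<le> 1 * (2 * (B + 3))"
        unfolding nrm_scale[OF X_banach pc] using x pB nrm_nonneg[OF X_banach pc] by (intro mult_mono) auto
      finally have zR: "nrm ?E (u k t + x *\<^sub>R p) \<le> R" using uB[OF t, of k] unfolding R_def by simp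
      have zs: "nrm (X s) (u k t + x *\<^sub>R p) \<le> R" using X_mono[OF sD zc] zR by simp
      have "nrm ?G (Fu \<epsilon> t (u k t + x *\<^sub>R p) p) \<le> cF * (nrm ?E p + nrm ?E (u k t + x *\<^sub>R p) * nrm (X s) p)"
        using cF(2)[rule_format, OF \<epsilon> t' zc pc zs] .
      also have "\<dots> \<le> cF * (nrm ?E p + R * nrm ?E p)"
        using cF(1) zR ps nrm_nonneg[OF X_banach pc] nrm_nonneg[OF X_banach X_subset[OF sD pc]] nrm_nonneg[OF X_banach zc]
        by (intro mult_left_mono add_mono mult_mono) auto
      finally show "nrm ?G (Fu \<epsilon> t (u k t + x *\<^sub>R p) p) \<le> cF * ((1 + R) * nrm ?E p)" by (simp add: algebra_simps)
    qed auto
    also have "\<dots> \<le> cF * ((1 + R) * e k)" using pe cF(1) B unfolding R_def by (intro mult_left_mono) auto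
    finally have Fp: "nrm ?G (F \<epsilon> t (u k t + p) - F \<epsilon> t (u k t)) \<le> cF * (1 + R) * e k" by simp
    have "nrm ?G (L \<epsilon> t p) \<le> cL * nrm ?E p" using cL(2) \<epsilon> t' pc by blast
    also have "\<dots> \<le> cL * e k" using pe cL(1) by (rule mult_left_mono)
    finally have "nrm ?G ((1 / \<epsilon>) *\<^sub>R L \<epsilon> t p) \<le> (1 / \<epsilon>) * (cL * e k)"
      unfolding nrm_scale[OF X_banach LG] using \<epsilon>' nrm_nonneg[OF X_banach LG] by (intro mult_mono) auto
    then have Lp': "nrm ?G ((1 / \<epsilon>) *\<^sub>R L \<epsilon> t p) \<le> cL / \<epsilon> * e k" by simp
    have eq: "dv t - du k t = r k t - (1 / \<epsilon>) *\<^sub>R L \<epsilon> t p - (F \<epsilon> t (u k t + p) - F \<epsilon> t (u k t))"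
      unfolding Lp dv_def du_def by (simp add: p_def algebra_simps)
    have "nrm ?G (dv t - du k t) \<le> nrm ?G (r k t - (1 / \<epsilon>) *\<^sub>R L \<epsilon> t p) + nrm ?G (F \<epsilon> t (u k t + p) - F \<epsilon> t (u k t))"
      unfolding eq using rG LG FG by (intro nrm_diff) (auto simp: banach_space_closed)
    also have "nrm ?G (r k t - (1 / \<epsilon>) *\<^sub>R L \<epsilon> t p) \<le> nrm ?G (r k t) + nrm ?G ((1 / \<epsilon>) *\<^sub>R L \<epsilon> t p)"
      using rG LG by (intro nrm_diff) (auto simp: banach_space_closed)
    finally have "nrm ?G (dv t - du k t) \<le> A * (\<theta>0 * \<Lambda> ^ k) powr - \<alpha> + cL / \<epsilon> * e k + cF * (1 + R) * e k"
      using rl[OF t, of k] Lp' Fp by linarith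
    also have "\<dots> \<le> a k" unfolding a_def M_def using e_nn[of k] by (simp add: algebra_simps)
    finally show ?thesis .
  qed
  have dud: "has_time_deriv ?G {0..T'} (u k) (du k t) t" if t: "t \<in> {0..T'}" for k t
    unfolding du_def by (rule deriv_X_mono[OF der[OF t] DN(2) t])
  have vd: "has_time_deriv ?G {0..T'} v (dv t) t" if t: "t \<in> {0..T'}" for t
    by (rule uniform_limit_deriv[OF _ t dud _ dvc a1 a2 a0]) (use X_subset[OF GE vc] in auto)
  have t0: "(0::real) \<in> {0..T'}" using T'' by simp
  have "v 0 = u0 \<epsilon>"
  proof -
    have "nrm ?E (v 0 - u0 \<epsilon>) \<le> 0"
      by (rule tendsto_lowerbound[OF e0]) (use ve[OF t0] init in auto)
    moreover have c0: "v 0 - u0 \<epsilon> \<in> carr ?E"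
      using vc[OF t0] uc[OF t0, of 0] init[of 0] by (simp add: banach_space_closed)
    ultimately have "nrm ?E (v 0 - u0 \<epsilon>) = 0" using nrm_nonneg[OF X_banach c0] by simp
    then show ?thesis using nrm_eq_0[OF X_banach c0] by simp
  qed
  then have "is_sol T' \<epsilon> v"
    unfolding is_sol_def solves_ivp_def
  proof (intro conjI ballI v)
    fix t assume t: "t \<in> {0..T'}"
    have "dv t + (1 / \<epsilon>) *\<^sub>R L \<epsilon> t (v t) + F \<epsilon> t (v t) = h \<epsilon> t" by (simp add: dv_def)
    then show "\<exists>w. has_time_deriv ?G {0..T'} v w t \<and> w + (1 / \<epsilon>) *\<^sub>R L \<epsilon> t (v t) + F \<epsilon> t (v t) = h \<epsilon> t"
      using vd[OF t] by blast
  qed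
  then show ?thesis using vB by blast
qed

lemma solution_exists:
  "\<exists>T'\<in>{0<..T}. \<exists>M. \<forall>\<epsilon>\<in>{0<..<\<epsilon>0}. \<exists>v. is_sol T' \<epsilon> v \<and> (\<forall>t\<in>{0..T'}. nrm (X (s + D)) (v t) \<le> M)"
proof -
  obtain \<Lambda> \<theta>0 where \<Lambda>: "\<Lambda> > 1" "\<Lambda> powr (D - \<alpha>) \<le> 1/2" and \<theta>0: "\<theta>0 \<ge> 1" and
    step: "\<forall>A>0. \<forall>B\<ge>0. \<exists>T'\<in>{0<..T}. \<forall>\<epsilon>\<in>{0<..<\<epsilon>0}. \<forall>\<theta>\<ge>\<theta>0. \<forall>u r.
     approx_sol T' \<epsilon> A B \<theta> u r \<longrightarrow>
     (\<exists>u' r'. approx_sol T' \<epsilon> A B (\<Lambda> * \<theta>) u' r' \<and>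
        (\<forall>t\<in>{0..T'}. nrm (X (s + D)) (u' t - u t) \<le> \<theta> powr (D - \<alpha>)))"
    using iteration_step by (elim exE conjE)
  obtain B where B: "B \<ge> 0" and init: "\<forall>\<theta>\<ge>1. \<exists>A>0. \<forall>T'\<in>{0<..T}. \<forall>\<epsilon>\<in>{0<..<\<epsilon>0}. \<exists>u r. approx_sol T' \<epsilon> A B \<theta> u r"
    using initial_approximation by (elim exE conjE)
  obtain A where A: "A > 0" and start: "\<forall>T'\<in>{0<..T}. \<forall>\<epsilon>\<in>{0<..<\<epsilon>0}. \<exists>u r. approx_sol T' \<epsilon> A B \<theta>0 u r"
    using init \<theta>0 by blast
  obtain T' where T': "T' \<in> {0<..T}" and next': "\<forall>\<epsilon>\<in>{0<..<\<epsilon>0}. \<forall>\<theta>\<ge>\<theta>0. \<forall>u r.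
     approx_sol T' \<epsilon> A B \<theta> u r \<longrightarrow>
     (\<exists>u' r'. approx_sol T' \<epsilon> A B (\<Lambda> * \<theta>) u' r' \<and>
        (\<forall>t\<in>{0..T'}. nrm (X (s + D)) (u' t - u t) \<le> \<theta> powr (D - \<alpha>)))"
    using step[rule_format, OF A B] by (elim bexE)
  have "\<exists>v. is_sol T' \<epsilon> v \<and> (\<forall>t\<in>{0..T'}. nrm (X (s + D)) (v t) \<le> B + 3)" if \<epsilon>: "\<epsilon> \<in> {0<..<\<epsilon>0}" for \<epsilon>
  proof -
    define Ap where "Ap k z \<longleftrightarrow> approx_sol T' \<epsilon> A B (\<theta>0 * \<Lambda> ^ k) (fst z) (snd z)" for k :: nat and z
    define Re where "Re k z z' \<longleftrightarrow> (\<forall>t\<in>{0..T'}. nrm (X (s + D)) (fst z' t - fst z t) \<le> (\<theta>0 * \<Lambda> ^ k) powr (D - \<alpha>))"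
      for k :: nat and z z' :: "(real \<Rightarrow> 'a) \<times> (real \<Rightarrow> 'a)"
    have "\<exists>f. \<forall>k. Ap k (f k) \<and> Re k (f k) (f (Suc k))"
    proof (rule dependent_nat_choice)
      show "\<exists>z. Ap 0 z" unfolding Ap_def using start T' \<epsilon> by simp
      fix z k assume z: "Ap k z"
      have le: "\<theta>0 \<le> \<theta>0 * \<Lambda> ^ k" using \<theta>0 \<Lambda> one_le_power[of \<Lambda> k] by simp
      obtain u' r' where "approx_sol T' \<epsilon> A B (\<Lambda> * (\<theta>0 * \<Lambda> ^ k)) u' r'"
        "\<forall>t\<in>{0..T'}. nrm (X (s + D)) (u' t - fst z t) \<le> (\<theta>0 * \<Lambda> ^ k) powr (D - \<alpha>)"
        using next'[rule_format, OF \<epsilon> le z[unfolded Ap_def]] by (elim exE conjE)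
      then show "\<exists>z'. Ap (Suc k) z' \<and> Re k z z'"
        unfolding Ap_def Re_def by (intro exI[of _ "(u', r')"]) (simp add: mult_ac)
    qed
    then obtain f where f: "\<And>k. Ap k (f k)" "\<And>k. Re k (f k) (f (Suc k))" by blast
    show ?thesis
      by (rule scheme_limit[OF \<epsilon> T' B A \<Lambda> \<theta>0, of "\<lambda>k. fst (f k)" "\<lambda>k. snd (f k)"])
        (use f in \<open>auto simp: Ap_def Re_def\<close>)
  qed
  with T' show ?thesis by blast
qed

lemma well_posed:
  "\<exists>T'. 0 < T' \<and> T' \<le> T \<and>
    (\<exists>u. bounded_solution_family X m T' \<epsilon>0 (s + D) L F h u0 u \<and>
       (\<forall>v. bounded_solution_family X m T' \<epsilon>0 (s + D) L F h u0 v \<longrightarrow>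
          (\<forall>\<epsilon>\<in>{0<..<\<epsilon>0}. \<forall>t\<in>{0..T'}. v \<epsilon> t = u \<epsilon> t)))"
proof -
  obtain T' M where T': "T' \<in> {0<..T}" and
    ex: "\<forall>\<epsilon>\<in>{0<..<\<epsilon>0}. \<exists>v. is_sol T' \<epsilon> v \<and> (\<forall>t\<in>{0..T'}. nrm (X (s + D)) (v t) \<le> M)"
    using solution_exists by blast
  then obtain u where u: "\<forall>\<epsilon>\<in>{0<..<\<epsilon>0}. is_sol T' \<epsilon> (u \<epsilon>) \<and> (\<forall>t\<in>{0..T'}. nrm (X (s + D)) (u \<epsilon> t) \<le> M)"
    by metis
  have fam: "bounded_solution_family X m T' \<epsilon>0 (s + D) L F h u0 v \<longleftrightarrow>
     (\<forall>\<epsilon>\<in>{0<..<\<epsilon>0}. is_sol T' \<epsilon> (v \<epsilon>)) \<and> (\<exists>M. \<forall>\<epsilon>\<in>{0<..<\<epsilon>0}. C_norm {0..T'} (X (s + D)) (v \<epsilon>) \<le> M)" for v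
    by (simp add: bounded_solution_family_def is_sol_def)
  have "C_norm {0..T'} (X (s + D)) (u \<epsilon>) \<le> M" if "\<epsilon> \<in> {0<..<\<epsilon>0}" for \<epsilon>
    using u that T' by (intro C_norm_le) auto
  then have "bounded_solution_family X m T' \<epsilon>0 (s + D) L F h u0 u" unfolding fam using u by blast
  moreover have "v \<epsilon> t = u \<epsilon> t"
    if "bounded_solution_family X m T' \<epsilon>0 (s + D) L F h u0 v" "\<epsilon> \<in> {0<..<\<epsilon>0}" "t \<in> {0..T'}" for v \<epsilon> t
    using that u by (intro sol_unique[OF that(2) T' _ _ that(3)]) (auto simp: fam)
  ultimately show ?thesis using T' by (intro exI[of _ T'] conjI exI[of _ u]) auto
qed

end

theorem theorem1:
  fixes X :: "real \<Rightarrow> 'a::real_vector nspace"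
    and \<epsilon>0 T s0 m d1 d1' \<delta> D q Pmin P s :: real
    and L F :: "real \<Rightarrow> real \<Rightarrow> 'a \<Rightarrow> 'a"
    and Fu :: "real \<Rightarrow> real \<Rightarrow> 'a \<Rightarrow> 'a \<Rightarrow> 'a"
    and Fuu :: "real \<Rightarrow> real \<Rightarrow> 'a \<Rightarrow> 'a \<Rightarrow> 'a \<Rightarrow> 'a"
    and h :: "real \<Rightarrow> real \<Rightarrow> 'a" and u0 :: "real \<Rightarrow> 'a"
  assumes "\<epsilon>0 > 0" and "banach_scale X"
    and "T > 0" and "m \<ge> 0" and "d1 \<ge> 0" and "d1' \<ge> 0"
    and "assumption1 X m s0 T \<epsilon>0 L"
    and "assumption2 X m s0 T \<epsilon>0 F Fu Fuu"
    and "assumption3 X m s0 d1 d1' T \<epsilon>0 L Fu"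
    and "\<delta> = max d1 (d1' + m)" and "D > \<delta>" and "q = D - m - d1'"
    and "Pmin = \<delta> + D / q * (sqrt \<delta> + sqrt (2 * (\<delta> + q)))\<^sup>2"
    and "P > Pmin" and "s \<ge> s0 + m"
    and "\<forall>\<epsilon>\<in>{0<..<\<epsilon>0}. F_space X m T (s + P) (h \<epsilon>) (u0 \<epsilon>)"
    and "\<exists>M. \<forall>\<epsilon>\<in>{0<..<\<epsilon>0}. F_norm X m T (s + P) (h \<epsilon>) (u0 \<epsilon>) \<le> M"
  shows "\<exists>T'. 0 < T' \<and> T' \<le> T \<and>
    (\<exists>u. bounded_solution_family X m T' \<epsilon>0 (s + D) L F h u0 u \<and>
       (\<forall>v. bounded_solution_family X m T' \<epsilon>0 (s + D) L F h u0 v \<longrightarrow>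
          (\<forall>\<epsilon>\<in>{0<..<\<epsilon>0}. \<forall>t\<in>{0..T'}. v \<epsilon> t = u \<epsilon> t)))"
proof -
  have \<delta>: "\<delta> \<ge> 0" "d1 \<le> \<delta>" "d1' + m \<le> \<delta>" using assms(5,10) by auto
  have q: "q > 0" using \<delta> assms(11,12) by simp
  have D: "D > 0" using \<delta> assms(11) by simp
  \<comment> \<open>\<open>P\<^sub>m\<^sub>i\<^sub>n \<ge> (D / q) \<sqdot> 2 q = 2 D\<close>, since the squared sum of roots is at least \<open>2 (\<delta> + q)\<close>.\<close>
  have "2 * q \<le> (sqrt (2 * (\<delta> + q)))\<^sup>2" using \<delta> q by simp
  also have "\<dots> \<le> (sqrt \<delta> + sqrt (2 * (\<delta> + q)))\<^sup>2" using \<delta> q by (intro power_mono) auto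
  finally have "D / q * (2 * q) \<le> D / q * (sqrt \<delta> + sqrt (2 * (\<delta> + q)))\<^sup>2"
    using D q by (intro mult_left_mono) auto
  then have P: "2 * D < P" using q \<delta> assms(13,14) by simp
  obtain Sm where "smoothing_operators X Sm" using assms(2) unfolding banach_scale_def by (elim conjE exE)
  then interpret singular_evolution X Sm \<epsilon>0 T s0 m d1 d1' D P s L F Fu Fuu h u0
    using assms \<delta> P by unfold_locales auto
  show ?thesis by (rule well_posed)
qed

end
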